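(* Let $\Omega$ be a countably infinite set, $S=\mathrm{Sym}(\Omega)$, and $E=\mathrm{Self}(\Omega)$. Let $G_1,G_2$ be subgroups of $S$ that are closed in the function topology on $S$. Then $G_1\approx_S G_2$ if and only if $G_1\approx G_2$.
   Context: $\mathrm{Self}(\Omega)$ is the monoid of all maps $\Omega\to\Omega$ under composition and $\mathrm{Sym}(\Omega)\subseteq\mathrm{Self}(\Omega)$ is the group of permutations. The function topology on $E$ (and on $S$ as a subspace) has as subbasis the sets $\{f:(\alpha)f=\beta\}$ for $\alpha,\beta\in\Omega$. For subgroups $G_1,G_2\subseteq S$, $G_1\approx_S G_2$ means there is a finite $U\subseteq S$ such that the subgroup of $S$ generated by $G_1\cup U$ equals the subgroup generated by $G_2\cup U$. For submonoids $M_1,M_2\subseteq E$, $M_1\approx M_2$ means there exist finite $U,V\subseteq E$ with $M_1\subseteq\langle M_2\cup U\rangle$ and $M_2\subseteq\langle M_1\cup V\rangle$, where $\langle X\rangle$ denotes the submonoid of $E$ generated by $X$; subgroups of $S$ are regarded as submonoids of $E$. *)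

theory Defs
  imports
    "HOL-Algebra.Generated_Groups"
    "HOL-Analysis.Abstract_Topology"
    "HOL-Library.Countable_Set"
begin

text \<open>
  The set \<open>\<Omega>\<close> is the universe of the type \<open>'a\<close>. Maps are written on the right of their
  arguments in the source, so the product of \<open>f\<close> and \<open>g\<close> is ``first \<open>f\<close>, then \<open>g\<close>''.
\<close>

definition Self :: "('a \<Rightarrow> 'a) monoid" where
  "Self = \<lparr>carrier = UNIV, monoid.mult = (\<lambda>f g. g \<circ> f), one = id\<rparr>"

definition Sym :: "('a \<Rightarrow> 'a) monoid" where
  "Sym = Self\<lparr>carrier := {f. bij f}\<rparr>"

definition function_topology :: "('a \<Rightarrow> 'a) topology" where
  "function_topology = topology_generated_by {{f. f \<alpha> = \<beta>} |\<alpha> \<beta>. True}"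

definition generate_submonoid :: "('b, 'c) monoid_scheme \<Rightarrow> 'b set \<Rightarrow> 'b set" where
  "generate_submonoid M X = \<Inter>{N. submonoid N M \<and> X \<subseteq> N}"

definition approx_Sym :: "('a \<Rightarrow> 'a) set \<Rightarrow> ('a \<Rightarrow> 'a) set \<Rightarrow> bool" (infix "\<approx>\<^sub>S" 50) where
  "G1 \<approx>\<^sub>S G2 \<longleftrightarrow>
     (\<exists>U. finite U \<and> U \<subseteq> carrier Sym \<and> generate Sym (G1 \<union> U) = generate Sym (G2 \<union> U))"

definition approx_Self :: "('a \<Rightarrow> 'a) set \<Rightarrow> ('a \<Rightarrow> 'a) set \<Rightarrow> bool" (infix "\<approx>\<^sub>E" 50) where
  "M1 \<approx>\<^sub>E M2 \<longleftrightarrow>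
     (\<exists>U V. finite U \<and> U \<subseteq> carrier Self \<and> finite V \<and> V \<subseteq> carrier Self \<and>
        M1 \<subseteq> generate_submonoid Self (M2 \<union> U) \<and>
        M2 \<subseteq> generate_submonoid Self (M1 \<union> V))"

lemma monoid_Self: "monoid Self"
  by (rule monoidI) (auto simp: Self_def comp_assoc)

lemma group_Sym: "group Sym"
proof (rule groupI)
  fix f :: "'a \<Rightarrow> 'a" assume "f \<in> carrier Sym"
  then have "bij f" by (simp add: Sym_def)
  then have "inv_into UNIV f \<in> carrier Sym" "inv_into UNIV f \<otimes>\<^bsub>Sym\<^esub> f = \<one>\<^bsub>Sym\<^esub>"
    by (simp_all add: Sym_def Self_def bij_imp_bij_inv bij_is_surj flip: surj_iff)
  then show "\<exists>g\<in>carrier Sym. g \<otimes>\<^bsub>Sym\<^esub> f = \<one>\<^bsub>Sym\<^esub>" by blast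
qed (auto simp: Sym_def Self_def comp_assoc intro: bij_comp)

lemma subgroup_Sym_imp_submonoid_Self:
  assumes "subgroup G Sym"
  shows "submonoid G Self"
  using subgroup.one_closed[OF assms] subgroup.m_closed[OF assms]
  by (intro submonoid.intro) (auto simp: Sym_def Self_def)

lemma topspace_function_topology: "topspace function_topology = UNIV"
  unfolding function_topology_def topology_generated_by_topspace by blast

end

theory Submission
  imports Defs "HOL-Library.Infinite_Set" "HOL-Library.Nat_Bijection" "HOL-Combinatorics.Permutations"
begin

text \<open>
  Call the orbit types of a closed group \<open>G\<close> the sizes of the orbits of the pointwise stabilizers
  \<open>stab G F\<close>, \<open>F\<close> finite. They fall into four kinds (Bergman and Shelah): every stabilizer has
  an infinite orbit; the orbits of some stabilizer are finite, but those of no stabilizer are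
  bounded; the orbits of some stabilizer are bounded, but no stabilizer is trivial; some stabilizer
  is trivial.

  If \<open>G1 \<subseteq> generate_submonoid Self (G2 \<union> U)\<close> with \<open>U\<close> finite, then the kind of \<open>G2\<close> is that of
  \<open>G1\<close> or an earlier one in this list: up to countably many fixed maps, elements of \<open>G2\<close>
  are elements of a stabilizer, so the words fall into countably many classes, each of which moves
  a point to few places, and a limit of elements of the closed group \<open>G1\<close> avoids all of them.

  Conversely the kind decides whether \<open>G1\<close> is generated by \<open>G2\<close> and finitely many permutations.
  Along a tree of elements of \<open>G2\<close> one constructs points \<open>\<alpha> n\<close> such that limits \<open>g\<close> of branches
  in \<open>G2\<close> map \<open>\<alpha> n\<close> to a point that encodes an initial segment of a permutation \<open>\<phi>\<close> of the
  indices. A single permutation \<open>t\<close> decodes all these points, so that conjugates of \<open>t\<close> act on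
  the \<open>\<alpha> n\<close> by any prescribed \<open>\<phi>\<close> of the relevant kind, with no control elsewhere. Commutators
  with a shift turn this into permutations supported on a copy of \<open>\<Omega>\<close>, which are then moved back.

  Maps act on the left below, so \<open>f \<circ> g\<close> is the product \<open>g \<otimes> f\<close> in \<open>Sym\<close>.
\<close>

unbundle no m_inv_syntax

subsection \<open>Groups of permutations\<close>

text \<open>The relation \<open>\<approx>\<^sub>E\<close> admits arbitrary finite sets of self-maps,
  and nothing turns these into permutations; hence the detour through an invariant that even words
  in self-maps respect. The kind is a complete invariant because every countable set of permutations
  lies in a finitely generated group: the stabilizer of a finite set has countably many cosets, so
  it generates the whole group together with finitely many permutations, and only some stabilizer
  has to be reached. By kind, that stabilizer lies in one of four models: the group of all
  permutations, the product of the symmetric groups of finite blocks, the same with bounded blocks,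
  the trivial group. The obstacle in reaching a model is convergence. A limit of group elements is a
  permutation only if preimages are frozen along with images, but these preimages become known after
  later points \<alpha> m have been chosen, and freezing them may shrink the orbits of those points.
  Reservoirs, obtained from a maximal ideal or from invariant sets, supply points that survive
  this.\<close>

definition pgroup :: "('a \<Rightarrow> 'a) set \<Rightarrow> bool" where
  "pgroup G \<longleftrightarrow> G \<subseteq> Collect bij \<and> id \<in> G \<and> (\<forall>f\<in>G. \<forall>g\<in>G. f \<circ> g \<in> G) \<and> (\<forall>f\<in>G. inv f \<in> G)"

abbreviation gen :: "('a \<Rightarrow> 'a) set \<Rightarrow> ('a \<Rightarrow> 'a) set" where
  "gen \<equiv> generate Sym"

lemma pgroup_bij: "pgroup G \<Longrightarrow> f \<in> G \<Longrightarrow> bij f"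
  by (auto simp: pgroup_def)

lemma pgroup_id: "pgroup G \<Longrightarrow> id \<in> G"
  by (auto simp: pgroup_def)

lemma pgroup_comp: "pgroup G \<Longrightarrow> f \<in> G \<Longrightarrow> g \<in> G \<Longrightarrow> f \<circ> g \<in> G"
  by (auto simp: pgroup_def)

lemma pgroup_inv: "pgroup G \<Longrightarrow> f \<in> G \<Longrightarrow> inv f \<in> G"
  by (auto simp: pgroup_def)

lemma inv_bij_left [simp]: "bij f \<Longrightarrow> inv f (f x) = x"
  by (simp add: bij_is_inj)

lemma inv_bij_right [simp]: "bij f \<Longrightarrow> f (inv f x) = x"
  by (simp add: bij_is_surj surj_f_inv_f)

lemma inv_bij_comp_left: "bij f \<Longrightarrow> inv f \<circ> f = id"
  by (auto simp: fun_eq_iff)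

lemma inv_bij_comp_right: "bij f \<Longrightarrow> f \<circ> inv f = id"
  by (auto simp: fun_eq_iff)

lemma pgroup_inv_left [simp]: "pgroup G \<Longrightarrow> f \<in> G \<Longrightarrow> inv f (f x) = x"
  by (simp add: pgroup_bij)

lemma pgroup_inv_right [simp]: "pgroup G \<Longrightarrow> f \<in> G \<Longrightarrow> f (inv f x) = x"
  by (simp add: pgroup_bij)

lemma pgroup_eq_iff: "pgroup G \<Longrightarrow> f \<in> G \<Longrightarrow> f x = f y \<longleftrightarrow> x = y"
  by (metis pgroup_inv_left)

lemma inv_Sym: "bij f \<Longrightarrow> m_inv Sym f = inv f"
  by (rule group.inv_equality[OF group_Sym])
     (auto simp: Sym_def Self_def bij_imp_bij_inv inv_bij_comp_right)

lemma subgroup_Sym_iff: "subgroup G Sym \<longleftrightarrow> pgroup G"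
proof
  assume G: "subgroup G Sym"
  have sub: "G \<subseteq> Collect bij" using subgroup.subset[OF G] by (simp add: Sym_def)
  then show "pgroup G"
    using subgroup.one_closed[OF G] subgroup.m_closed[OF G] subgroup.m_inv_closed[OF G]
    by (auto simp: pgroup_def inv_Sym subset_iff) (auto simp: Sym_def Self_def)
next
  assume G: "pgroup G"
  then show "subgroup G Sym"
    by (intro subgroup.intro) (auto simp: pgroup_def inv_Sym subset_iff, auto simp: Sym_def Self_def)
qed

lemma pgroup_gen: "X \<subseteq> Collect bij \<Longrightarrow> pgroup (gen X)"
  unfolding subgroup_Sym_iff[symmetric]
  by (rule group.generate_is_subgroup[OF group_Sym]) (simp add: Sym_def)

lemma gen_incl: "x \<in> X \<Longrightarrow> x \<in> gen X"
  by (rule generate.incl)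

lemma gen_least: "pgroup K \<Longrightarrow> X \<subseteq> K \<Longrightarrow> gen X \<subseteq> K"
  by (rule group.generate_subgroup_incl[OF group_Sym]) (auto simp: subgroup_Sym_iff)

lemma gen_mono: "X \<subseteq> Y \<Longrightarrow> gen X \<subseteq> gen Y"
  by (rule group.mono_generate[OF group_Sym])

text \<open>
  On groups, \<open>\<approx>\<^sub>S\<close> is \<open>\<preceq>\<close> in both directions: take the union of the two finite sets.
\<close>

definition below :: "('a \<Rightarrow> 'a) set \<Rightarrow> ('a \<Rightarrow> 'a) set \<Rightarrow> bool" (infix "\<preceq>" 50) where
  "H \<preceq> K \<longleftrightarrow> (\<exists>U. finite U \<and> U \<subseteq> Collect bij \<and> H \<subseteq> gen (K \<union> U))"

lemma belowI: "finite U \<Longrightarrow> U \<subseteq> Collect bij \<Longrightarrow> H \<subseteq> gen (K \<union> U) \<Longrightarrow> H \<preceq> K"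
  by (auto simp: below_def)

lemma below_subset: "H \<subseteq> K \<Longrightarrow> H \<preceq> K"
  by (rule belowI[of "{}"]) (auto intro: gen_incl)

lemma below_gen_trans:
  assumes "H \<subseteq> gen (H' \<union> V)" "finite V" "V \<subseteq> Collect bij" "H' \<preceq> K" "K \<subseteq> Collect bij"
  shows "H \<preceq> K"
proof -
  obtain U where U: "finite U" "U \<subseteq> Collect bij" "H' \<subseteq> gen (K \<union> U)"
    using assms(4) by (auto simp: below_def)
  have pg: "pgroup (gen (K \<union> (U \<union> V)))"
    by (rule pgroup_gen) (use U assms in auto)
  have "gen (K \<union> U) \<subseteq> gen (K \<union> (U \<union> V))" by (rule gen_mono) auto
  then have "H' \<union> V \<subseteq> gen (K \<union> (U \<union> V))" using U(3) by (auto intro: gen_incl)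
  then have "gen (H' \<union> V) \<subseteq> gen (K \<union> (U \<union> V))" by (rule gen_least[OF pg])
  then show ?thesis using assms U by (intro belowI[of "U \<union> V"]) auto
qed

lemma below_trans: "H \<preceq> K \<Longrightarrow> K \<preceq> L \<Longrightarrow> L \<subseteq> Collect bij \<Longrightarrow> H \<preceq> L"
  unfolding below_def[of H K] using below_gen_trans[of H K _ L] by blast

lemma below_Un:
  assumes "H \<preceq> K" "H' \<preceq> K" shows "H \<union> H' \<preceq> K"
proof -
  obtain U V where U: "finite U" "U \<subseteq> Collect bij" "H \<subseteq> gen (K \<union> U)"
    and V: "finite V" "V \<subseteq> Collect bij" "H' \<subseteq> gen (K \<union> V)"
    using assms by (auto simp: below_def)
  have "gen (K \<union> U) \<subseteq> gen (K \<union> (U \<union> V))" "gen (K \<union> V) \<subseteq> gen (K \<union> (U \<union> V))"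
    by (rule gen_mono; auto)+
  then show ?thesis using U V by (intro belowI[of "U \<union> V"]) auto
qed

lemma below_UN:
  assumes "finite I" "\<And>i. i \<in> I \<Longrightarrow> H i \<preceq> K" shows "(\<Union>i\<in>I. H i) \<preceq> K"
  using assms
proof (induction I rule: finite_induct)
  case empty then show ?case by (auto intro: below_subset)
next
  case (insert i I)
  then show ?case using below_Un[of "H i" K "\<Union>i\<in>I. H i"] by simp
qed

subsection \<open>Stabilizers, orbits and algebraic closure\<close>

definition stab :: "('a \<Rightarrow> 'a) set \<Rightarrow> 'a set \<Rightarrow> ('a \<Rightarrow> 'a) set" where
  "stab G F = {g \<in> G. \<forall>x\<in>F. g x = x}"

definition orb :: "('a \<Rightarrow> 'a) set \<Rightarrow> 'a set \<Rightarrow> 'a \<Rightarrow> 'a set" where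
  "orb G F a = (\<lambda>g. g a) ` stab G F"

lemma stab_subset: "stab G F \<subseteq> G"
  by (auto simp: stab_def)

lemma stab_in: "h \<in> stab G F \<Longrightarrow> h \<in> G"
  by (auto simp: stab_def)

lemma stab_fix: "h \<in> stab G F \<Longrightarrow> x \<in> F \<Longrightarrow> h x = x"
  by (auto simp: stab_def)

lemma stab_antimono: "F \<subseteq> F' \<Longrightarrow> stab G F' \<subseteq> stab G F"
  by (auto simp: stab_def)

lemma stab_stab: "stab (stab G F) F' = stab G (F \<union> F')"
  by (auto simp: stab_def)

lemma stab_empty [simp]: "stab G {} = G"
  by (auto simp: stab_def)

lemma inv_fix: "bij f \<Longrightarrow> f x = x \<Longrightarrow> inv f x = x"
  by (metis inv_bij_left)

lemma pgroup_stab: "pgroup G \<Longrightarrow> pgroup (stab G F)"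
  by (auto simp: pgroup_def stab_def subset_iff intro!: inv_fix)

lemma orbI: "h \<in> stab G F \<Longrightarrow> h a \<in> orb G F a"
  by (auto simp: orb_def)

lemma orb_orb: "orb (stab G F) F' a = orb G (F \<union> F') a"
  by (simp add: orb_def stab_stab)

lemma orb_antimono: "F \<subseteq> F' \<Longrightarrow> orb G F' a \<subseteq> orb G F a"
  unfolding orb_def using stab_antimono by blast

lemma orb_self: "pgroup G \<Longrightarrow> a \<in> orb G F a"
  by (auto simp: orb_def stab_def pgroup_id intro!: image_eqI[of _ _ id])

lemma stab_conj:
  assumes "pgroup G" "g \<in> G" "h \<in> stab G F"
  shows "g \<circ> h \<circ> inv g \<in> stab G (g ` F)"
  using assms by (auto simp: stab_def pgroup_comp pgroup_inv)

lemma stab_conj_inv: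
  assumes "pgroup G" "g \<in> G" "h \<in> stab G (g ` F)"
  shows "inv g \<circ> h \<circ> g \<in> stab G F"
  using assms by (auto simp: stab_def pgroup_comp pgroup_inv)

lemma orb_conj:
  assumes "pgroup G" "g \<in> G"
  shows "orb G (g ` F) (g a) = g ` orb G F a"
proof
  show "g ` orb G F a \<subseteq> orb G (g ` F) (g a)"
  proof
    fix y assume "y \<in> g ` orb G F a"
    then obtain h where h: "h \<in> stab G F" "y = g (h a)" by (auto simp: orb_def)
    then have "y = (g \<circ> h \<circ> inv g) (g a)" using assms by simp
    then show "y \<in> orb G (g ` F) (g a)" using orbI[OF stab_conj[OF assms h(1)]] by metis
  qed
  show "orb G (g ` F) (g a) \<subseteq> g ` orb G F a"
  proof
    fix y assume "y \<in> orb G (g ` F) (g a)"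
    then obtain h where h: "h \<in> stab G (g ` F)" "y = h (g a)" by (auto simp: orb_def)
    then have "y = g ((inv g \<circ> h \<circ> g) a)" using assms by simp
    then show "y \<in> g ` orb G F a" using orbI[OF stab_conj_inv[OF assms h(1)]] by blast
  qed
qed

definition acl :: "('a \<Rightarrow> 'a) set \<Rightarrow> 'a set \<Rightarrow> 'a set" where
  "acl G F = {a. finite (orb G F a)}"

lemma acl_mono: "F \<subseteq> F' \<Longrightarrow> acl G F \<subseteq> acl G F'"
  unfolding acl_def using finite_subset[OF orb_antimono[of F F' G]] by auto

lemma acl_conj:
  "pgroup G \<Longrightarrow> g \<in> G \<Longrightarrow> a \<in> acl G F \<Longrightarrow> g a \<in> acl G (g ` F)"
  using orb_conj[of G g F a] unfolding acl_def by (metis finite_imageI mem_Collect_eq)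

text \<open>The points of F have finite orbits under \<open>stab G \<Gamma>\<close>, so its elements
  restrict to F in finitely many ways. Elements with the same restriction differ by one that fixes F
  as well, and these move a to finitely many places.\<close>

lemma acl_trans:
  assumes G: "pgroup G" and F: "finite F" "F \<subseteq> acl G \<Gamma>" and a: "a \<in> acl G (F \<union> \<Gamma>)"
  shows "a \<in> acl G \<Gamma>"
proof -
  let ?r = "\<lambda>h. restrict h F"
  let ?X = "?r ` stab G \<Gamma>"
  have "?X \<subseteq> PiE F (\<lambda>x. orb G \<Gamma> x)" by (auto simp: orb_def)
  moreover have "finite (PiE F (\<lambda>x. orb G \<Gamma> x))" using F by (intro finite_PiE) (auto simp: acl_def)
  ultimately have finX: "finite ?X" by (rule finite_subset)
  have "orb G \<Gamma> a \<subseteq> (\<Union>r\<in>?X. (inv_into (stab G \<Gamma>) ?r r) ` orb G (F \<union> \<Gamma>) a)"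
  proof
    fix y assume "y \<in> orb G \<Gamma> a"
    then obtain h where h: "h \<in> stab G \<Gamma>" "y = h a" by (auto simp: orb_def)
    define k where "k = inv_into (stab G \<Gamma>) ?r (?r h)"
    have k: "k \<in> stab G \<Gamma>" "?r k = ?r h"
      unfolding k_def using h by (auto intro: inv_into_into f_inv_into_f[of "?r h" ?r])
    have "inv k \<circ> h \<in> stab G (F \<union> \<Gamma>)"
    proof -
      have m: "inv k \<circ> h \<in> stab G \<Gamma>" using pgroup_stab[OF G] k h by (intro pgroup_comp pgroup_inv) auto
      have "(inv k \<circ> h) x = x" if "x \<in> F" for x
      proof -
        have "h x = k x" using k(2) that by (metis restrict_apply')
        then show ?thesis using G k(1) by (simp add: stab_in)
      qed
      then show ?thesis using m by (auto simp: stab_def)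
    qed
    then have "(inv k \<circ> h) a \<in> orb G (F \<union> \<Gamma>) a" by (rule orbI)
    moreover have "y = k ((inv k \<circ> h) a)" using G k(1) h by (simp add: stab_in)
    ultimately show "y \<in> (\<Union>r\<in>?X. (inv_into (stab G \<Gamma>) ?r r) ` orb G (F \<union> \<Gamma>) a)"
      using h k_def by blast
  qed
  moreover have "finite (\<Union>r\<in>?X. (inv_into (stab G \<Gamma>) ?r r) ` orb G (F \<union> \<Gamma>) a)"
    by (intro finite_UN_I finX finite_imageI) (use a in \<open>simp add: acl_def\<close>)
  ultimately show ?thesis by (auto simp: acl_def intro: finite_subset)
qed

subsection \<open>Closed groups and the diagonal argument\<close>

text \<open>Closedness relative to the permutations: only bijective limits have to belong to G.
  Every limit constructed below must therefore be shown surjective before closedness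
  applies.\<close>

definition fclosed :: "('a \<Rightarrow> 'a) set \<Rightarrow> bool" where
  "fclosed G \<longleftrightarrow> (\<forall>f. bij f \<longrightarrow> (\<forall>F. finite F \<longrightarrow> (\<exists>g\<in>G. \<forall>x\<in>F. g x = f x)) \<longrightarrow> f \<in> G)"

lemma fclosedD:
  assumes "fclosed G" "bij f" "\<And>F. finite F \<Longrightarrow> \<exists>g\<in>G. \<forall>x\<in>F. g x = f x"
  shows "f \<in> G"
  using assms by (auto simp: fclosed_def)

lemma generate_topology_nbhd:
  assumes "generate_topology_on {{f. f \<alpha> = \<beta>} |\<alpha> \<beta>. True} V" "f \<in> V"
  shows "\<exists>F. finite F \<and> (\<forall>g. (\<forall>x\<in>F. g x = f x) \<longrightarrow> g \<in> V)"
  using assms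
proof (induction arbitrary: f rule: generate_topology_on.induct)
  case Empty then show ?case by simp
next
  case (Int a b)
  then obtain A B where "finite A" "\<forall>g. (\<forall>x\<in>A. g x = f x) \<longrightarrow> g \<in> a"
    "finite B" "\<forall>g. (\<forall>x\<in>B. g x = f x) \<longrightarrow> g \<in> b"
    by (metis IntD1 IntD2)
  then show ?case by (intro exI[of _ "A \<union> B"]) auto
next
  case (UN K)
  then obtain k where k: "k \<in> K" "f \<in> k" by auto
  with UN.IH[OF this] show ?case by blast
next
  case (Basis s)
  then obtain \<alpha> \<beta> where "s = {f. f \<alpha> = \<beta>}" by auto
  then show ?case using Basis by (intro exI[of _ "{\<alpha>}"]) auto
qed

lemma closedin_imp_fclosed:
  assumes "closedin (subtopology function_topology (carrier Sym)) G"
  shows "fclosed G"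
  unfolding fclosed_def
proof (intro allI impI)
  fix f :: "'a \<Rightarrow> 'a"
  assume f: "bij f" and appr: "\<forall>F. finite F \<longrightarrow> (\<exists>g\<in>G. \<forall>x\<in>F. g x = f x)"
  obtain T where T: "closedin function_topology T" "G = T \<inter> carrier Sym"
    using assms by (auto simp: closedin_subtopology)
  show "f \<in> G"
  proof (rule ccontr)
    assume "f \<notin> G"
    then have fT: "f \<in> UNIV - T" using f T by (auto simp: Sym_def)
    have "openin function_topology (UNIV - T)"
      using T(1) by (simp add: closedin_def topspace_function_topology)
    then have "generate_topology_on {{f. f \<alpha> = \<beta>} |\<alpha> \<beta>. True} (UNIV - T)"
      unfolding function_topology_def by (simp add: openin_topology_generated_by)
    from generate_topology_nbhd[OF this fT]
    obtain F where F: "finite F" "\<forall>g. (\<forall>x\<in>F. g x = f x) \<longrightarrow> g \<in> UNIV - T" by blast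
    then show False using appr T by blast
  qed
qed

lemma fclosed_stab:
  assumes "fclosed G" shows "fclosed (stab G F)"
  unfolding fclosed_def
proof (intro allI impI)
  fix f :: "'a \<Rightarrow> 'a"
  assume f: "bij f" and appr: "\<forall>F'. finite F' \<longrightarrow> (\<exists>g\<in>stab G F. \<forall>x\<in>F'. g x = f x)"
  have "f \<in> G"
  proof (rule fclosedD[OF assms f])
    show "\<exists>g\<in>G. \<forall>x\<in>F'. g x = f x" if "finite F'" for F'
      using appr[rule_format, OF that] stab_in[of _ G F] by blast
  qed
  moreover have "f x = x" if "x \<in> F" for x
  proof -
    obtain g where "g \<in> stab G F" "g x = f x" using appr[rule_format, of "{x}"] by auto
    then show ?thesis using that by (simp add: stab_def)
  qed
  ultimately show "f \<in> stab G F" by (simp add: stab_def)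
qed

locale enumeration =
  fixes en :: "nat \<Rightarrow> 'a"
  assumes bij_en: "bij en"
begin

abbreviation code :: "'a \<Rightarrow> nat" where "code \<equiv> inv en"

lemma en_code [simp]: "en (code x) = x" and code_en [simp]: "code (en n) = n"
  using bij_en by simp_all

lemma countable_Omega: "countable (A :: 'a set)"
  by (rule countableI'[of code]) (metis en_code inj_onI)

lemma infinite_Omega: "infinite (UNIV :: 'a set)"
  using bij_en by (metis bij_betw_finite infinite_UNIV_nat)

text \<open>A pointwise limit of permutations is injective but may fail to be surjective. If the
  values of the inverses settle too, their limit is a two-sided inverse. The second conclusion
  evaluates g at any stage from which x stays put, which may come before the stage given by the
  numbering.\<close>

lemma limit_in_closed:
  fixes G :: "('a \<Rightarrow> 'a) set"
  assumes G: "pgroup G" "fclosed G" and s: "\<And>n. s n \<in> G"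
    and fwd: "\<And>n l. l < n \<Longrightarrow> s (Suc n) (en l) = s n (en l)"
    and bwd: "\<And>n l. l < n \<Longrightarrow> inv (s (Suc n)) (en l) = inv (s n) (en l)"
  obtains g where "g \<in> G" "\<And>x n. (\<And>m. m \<ge> n \<Longrightarrow> s (Suc m) x = s m x) \<Longrightarrow> g x = s n x"
proof -
  define g where "g x = s (Suc (code x)) x" for x
  define g' where "g' x = inv (s (Suc (code x))) x" for x
  have st: "s m x = g x" if "m \<ge> Suc (code x)" for m x
    using that
  proof (induction m rule: dec_induct)
    case base then show ?case by (simp add: g_def)
  next
    case (step m) then show ?case using fwd[of "code x" m] by simp
  qed
  have st': "inv (s m) x = g' x" if "m \<ge> Suc (code x)" for m x
    using that
  proof (induction m rule: dec_induct)
    case base then show ?case by (simp add: g'_def)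
  next
    case (step m) then show ?case using bwd[of "code x" m] by simp
  qed
  have "g (g' y) = y" for y
  proof -
    define m where "m = max (Suc (code y)) (Suc (code (g' y)))"
    have "g (g' y) = s m (g' y)" "g' y = inv (s m) y"
      using st[of "g' y" m] st'[of y m] by (simp_all add: m_def)
    then show ?thesis using G s by simp
  qed
  moreover have "g' (g y) = y" for y
  proof -
    define m where "m = max (Suc (code y)) (Suc (code (g y)))"
    have "g' (g y) = inv (s m) (g y)" "g y = s m y"
      using st'[of "g y" m] st[of y m] by (simp_all add: m_def)
    then show ?thesis using G s by simp
  qed
  ultimately have bij: "bij g" by (metis bijI')
  have "g \<in> G"
  proof (rule fclosedD[OF G(2) bij])
    fix F :: "'a set" assume F: "finite F"
    define m where "m = Suc (Max (insert 0 (code ` F)))"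
    have "s m x = g x" if "x \<in> F" for x
      using F that by (intro st) (auto simp: m_def)
    then show "\<exists>g'\<in>G. \<forall>x\<in>F. g' x = g x" using s by blast
  qed
  moreover have "g x = s n x" if "\<And>m. m \<ge> n \<Longrightarrow> s (Suc m) x = s m x" for x n
  proof -
    have "s m x = s n x" if "n \<le> m" for m
      using that
    proof (induction m rule: dec_induct)
      case (step m) then show ?case using \<open>\<And>m. m \<ge> n \<Longrightarrow> s (Suc m) x = s m x\<close>[of m] by simp
    qed simp
    from this[of "max n (Suc (code x))"] show ?thesis
      using st[of x "max n (Suc (code x))"] by simp
  qed
  ultimately show thesis by (rule that)
qed

text \<open>A Baire category argument. Stage n multiplies the current g on the right by an element
  of the current stabilizer that makes the value at some a differ from all values of
  \<open>W n\<close> at a. The possible new values are the images under g of an orbit, whence the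
  form of \<open>big\<close>.\<close>

lemma diagonal_avoidance:
  fixes G :: "('a \<Rightarrow> 'a) set" and W :: "nat \<Rightarrow> ('a \<Rightarrow> 'a) set"
  assumes G: "pgroup G" "fclosed G"
    and big: "\<And>n F. finite F \<Longrightarrow> \<exists>a. \<forall>g\<in>G. \<not> g ` orb G F a \<subseteq> (\<lambda>w. w a) ` W n"
  shows "\<not> G \<subseteq> (\<Union>n. W n)"
proof -
  define P where "P n p \<longleftrightarrow> fst p \<in> G \<and> finite (snd p)" for n :: nat and p :: "('a \<Rightarrow> 'a) \<times> 'a set"
  define Q where "Q n p q \<longleftrightarrow> (\<exists>h\<in>stab G (snd p). fst q = fst p \<circ> h) \<and> snd p \<subseteq> snd q
      \<and> en n \<in> snd q \<and> inv (fst q) (en n) \<in> snd q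
      \<and> (\<exists>a\<in>snd q. fst q a \<notin> (\<lambda>w. w a) ` W n)" for n and p q :: "('a \<Rightarrow> 'a) \<times> 'a set"
  have "\<exists>f. \<forall>n. P n (f n) \<and> Q n (f n) (f (Suc n))"
  proof (rule dependent_nat_choice)
    show "\<exists>p. P 0 p" using G by (intro exI[of _ "(id, {})"]) (auto simp: P_def pgroup_id)
  next
    fix p n assume p: "P n p"
    obtain g F where gF: "p = (g, F)" by force
    obtain a where a: "\<not> g ` orb G F a \<subseteq> (\<lambda>w. w a) ` W n"
      using big[of F n] p gF unfolding P_def by (metis fst_conv snd_conv)
    then obtain h where h: "h \<in> stab G F" "g (h a) \<notin> (\<lambda>w. w a) ` W n" by (auto simp: orb_def)
    \<comment> \<open>Freezing a keeps \<open>W n\<close> avoided; freezing the other two points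
      settles the image and the preimage of \<open>en n\<close>.\<close>
    define q where "q = (g \<circ> h, F \<union> {a, en n, inv (g \<circ> h) (en n)})"
    have "g \<in> G" "finite F" using p gF by (simp_all add: P_def)
    then have "P (Suc n) q" using h(1) G by (simp add: P_def q_def pgroup_comp stab_in)
    moreover have "\<exists>a\<in>snd q. fst q a \<notin> (\<lambda>w. w a) ` W n"
      by (rule bexI[of _ a]) (use h(2) in \<open>simp_all add: q_def\<close>)
    moreover have "\<exists>h\<in>stab G (snd p). fst q = fst p \<circ> h"
      by (rule bexI[of _ h]) (use h(1) in \<open>simp_all add: q_def gF\<close>)
    moreover have "snd p \<subseteq> snd q" "en n \<in> snd q" "inv (fst q) (en n) \<in> snd q"
      by (auto simp: q_def gF)
    ultimately show "\<exists>q. P (Suc n) q \<and> Q n p q" unfolding Q_def by blast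
  qed
  then obtain f where P: "\<And>n. P n (f n)" and Q: "\<And>n. Q n (f n) (f (Suc n))" by auto
  define s F where "s n = fst (f n)" and "F n = snd (f n)" for n
  have sG: "s n \<in> G" for n using P by (simp add: P_def s_def)
  have "\<exists>h. h \<in> stab G (F n) \<and> s (Suc n) = s n \<circ> h" for n
    using Q[of n] unfolding Q_def s_def F_def by blast
  then obtain h where h: "\<And>n. h n \<in> stab G (F n)" "\<And>n. s (Suc n) = s n \<circ> h n" by metis
  have step: "F n \<subseteq> F (Suc n)" "en n \<in> F (Suc n)" "inv (s (Suc n)) (en n) \<in> F (Suc n)" for n
    using Q[of n] unfolding Q_def s_def F_def by blast+
  have mono: "F n \<subseteq> F m" if "n \<le> m" for n m using lift_Suc_mono_le[of F, OF step(1) that] .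
  have fixF: "s (Suc n) x = s n x" if "x \<in> F n" for n x using h that by (simp add: stab_def)
  have inv_s: "inv (s (Suc n)) y = inv (s n) y" if "inv (s n) y \<in> F n" for n y
  proof -
    have "s (Suc n) (inv (s n) y) = y" using fixF[OF that] sG G by simp
    then show ?thesis by (metis G(1) pgroup_inv_left sG)
  qed
  have bwdF: "inv (s n) (en l) \<in> F n" if "Suc l \<le> n" for n l
    using that
  proof (induction n rule: dec_induct)
    case base then show ?case using step by simp
  next
    case (step n) then show ?case using inv_s[of n "en l"] mono[of n "Suc n"] by auto
  qed
  obtain g where g: "g \<in> G" "\<And>x n. (\<And>m. m \<ge> n \<Longrightarrow> s (Suc m) x = s m x) \<Longrightarrow> g x = s n x"
  proof (rule limit_in_closed[OF G sG])
    show "s (Suc n) (en l) = s n (en l)" if "l < n" for n l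
      by (rule fixF) (use that step(2)[of l] mono[of "Suc l" n] in auto)
    show "inv (s (Suc n)) (en l) = inv (s n) (en l)" if "l < n" for n l
      by (rule inv_s) (use that bwdF in auto)
  qed blast
  have "g \<notin> W n" for n
  proof -
    obtain a where a: "a \<in> F (Suc n)" "s (Suc n) a \<notin> (\<lambda>w. w a) ` W n"
      using Q[of n] unfolding Q_def s_def F_def by blast
    have "g a = s (Suc n) a"
    proof (rule g(2))
      show "s (Suc m) a = s m a" if "m \<ge> Suc n" for m
        using fixF[of a m] mono[OF that] a(1) by blast
    qed
    then show ?thesis using a(2) imageI[of g "W n" "\<lambda>w. w a"] by auto
  qed
  then show ?thesis using g(1) by blast
qed

end

section \<open>Classes of words and the monotonicity of orbit types\<close>

fun words :: "('a \<Rightarrow> 'a) set \<Rightarrow> ('a \<Rightarrow> 'a) list \<Rightarrow> ('a \<Rightarrow> 'a) set" where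
  "words H [] = {id}"
| "words H (q # l) = {q \<circ> h \<circ> w |h w. h \<in> H \<and> w \<in> words H l}"

lemma words_append: "w \<in> words H l \<Longrightarrow> w' \<in> words H l' \<Longrightarrow> w \<circ> w' \<in> words H (l @ l')"
proof (induction l arbitrary: w)
  case (Cons q l)
  then obtain h v where "w = q \<circ> h \<circ> v" "h \<in> H" "v \<in> words H l" by auto
  moreover have "v \<circ> w' \<in> words H (l @ l')" using Cons.IH Cons.prems(2) \<open>v \<in> words H l\<close> by blast
  moreover have "w \<circ> w' = q \<circ> h \<circ> (v \<circ> w')" using \<open>w = q \<circ> h \<circ> v\<close> by (simp add: comp_assoc)
  ultimately show ?case using \<open>h \<in> H\<close> unfolding append_Cons words.simps by blast
qed simp

lemma words_Cons_image: "(\<lambda>w. w a) ` words H (q # l) = (\<Union>y\<in>(\<lambda>w. w a) ` words H l. q ` orb H {} y)"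
  by (fastforce simp: orb_def image_iff)

lemma words_finite:
  assumes "\<And>a. finite (orb H {} a)"
  shows "finite ((\<lambda>w. w a) ` words H l)"
proof (induction l)
  case (Cons q l) then show ?case unfolding words_Cons_image using assms by blast
qed simp

lemma words_card:
  assumes "\<And>a. finite (orb H {} a)" "\<And>a. card (orb H {} a) \<le> N"
  shows "card ((\<lambda>w. w a) ` words H l) \<le> N ^ length l"
proof (induction l)
  case (Cons q l)
  have "card ((\<lambda>w. w a) ` words H (q # l)) \<le> (\<Sum>y\<in>(\<lambda>w. w a) ` words H l. card (q ` orb H {} y))"
    unfolding words_Cons_image by (rule card_UN_le[OF words_finite[OF assms(1)]])
  also have "\<dots> \<le> (\<Sum>y\<in>(\<lambda>w. w a) ` words H l. N)"
    by (rule sum_mono) (meson assms card_image_le le_trans)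
  also have "\<dots> \<le> N ^ length (q # l)" using Cons by simp
  finally show ?case .
qed simp

definition inf_orbs :: "('a \<Rightarrow> 'a) set \<Rightarrow> bool" where
  "inf_orbs G \<longleftrightarrow> (\<forall>F. finite F \<longrightarrow> (\<exists>a. infinite (orb G F a)))"

text \<open>The four kinds are: \<open>inf_orbs G\<close>; not \<open>inf_orbs G\<close>, but
  \<open>big_orbs G n\<close> for all n; \<open>big_orbs G 1\<close>, but not
  \<open>big_orbs G n\<close> for some n; not \<open>big_orbs G 1\<close>. Finiteness is demanded
  explicitly because \<open>card\<close> is 0 on infinite sets.\<close>

definition big_orbs :: "('a \<Rightarrow> 'a) set \<Rightarrow> nat \<Rightarrow> bool" where
  "big_orbs G n \<longleftrightarrow> (\<forall>F. finite F \<longrightarrow> (\<exists>a. \<not> (finite (orb G F a) \<and> card (orb G F a) \<le> n)))"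

context enumeration begin

text \<open>Elements that agree on F lie in one left coset of the stabilizer, and there are only
  countably many finite tuples of values.\<close>

lemma countable_cosets:
  fixes G :: "('a \<Rightarrow> 'a) set"
  assumes G: "pgroup G" and F: "finite F"
  obtains D where "countable D" "D \<subseteq> G" "\<And>g. g \<in> G \<Longrightarrow> \<exists>d\<in>D. \<exists>h\<in>stab G F. g = d \<circ> h"
proof -
  obtain xs where xs: "set xs = F" using finite_list[OF F] by blast
  let ?r = "\<lambda>g. map g xs"
  have "countable (UNIV :: 'a list set)"
    using countable_lists[OF countable_Omega[of UNIV]] by (simp add: lists_UNIV)
  then have "countable (?r ` G)" by (rule countable_subset[rotated]) simp
  then have c: "countable (inv_into G ?r ` (?r ` G))" by blast
  show thesis
  proof (rule that[OF c])
    show "inv_into G ?r ` (?r ` G) \<subseteq> G" by (auto intro: inv_into_into)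
    fix g assume g: "g \<in> G"
    define d where "d = inv_into G ?r (?r g)"
    have d: "d \<in> G" "?r d = ?r g" unfolding d_def using g by (auto intro!: inv_into_into f_inv_into_f[of "?r g" ?r G] simp del: map_eq_conv)
    have "inv d \<circ> g \<in> stab G F"
    proof -
      have "(inv d \<circ> g) x = x" if "x \<in> F" for x
      proof -
        have "g x = d x" using d(2) that xs by (metis map_eq_conv)
        then show ?thesis using G d(1) by simp
      qed
      then show ?thesis using G d g by (auto simp: stab_def pgroup_comp pgroup_inv)
    qed
    moreover have "g = d \<circ> (inv d \<circ> g)" using G d by (auto simp: fun_eq_iff)
    ultimately show "\<exists>d\<in>inv_into G ?r ` (?r ` G). \<exists>h\<in>stab G F. g = d \<circ> h"
      using g d_def by blast
  qed
qed

text \<open>The letters are coset representatives and elements of U. Each generator is a letter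
  times an element of the stabilizer, and concatenating lists multiplies classes; the letters being
  countable in number, so are the lists.\<close>

lemma submonoid_subset_words:
  fixes G2 U :: "('a \<Rightarrow> 'a) set"
  assumes G2: "pgroup G2" and F: "finite F" and U: "finite U"
  obtains L :: "nat \<Rightarrow> ('a \<Rightarrow> 'a) list"
  where "generate_submonoid Self (G2 \<union> U) \<subseteq> (\<Union>n. words (stab G2 F) (L n))"
proof -
  obtain D where D: "countable D" "D \<subseteq> G2" "\<And>g. g \<in> G2 \<Longrightarrow> \<exists>d\<in>D. \<exists>h\<in>stab G2 F. g = d \<circ> h"
    using countable_cosets[OF G2 F] by metis
  let ?H = "stab G2 F"
  let ?N = "\<Union>l\<in>lists (D \<union> U). words ?H l"
  have "submonoid ?N Self"
  proof
    show "?N \<subseteq> carrier Self" by (simp add: Self_def)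
    show "\<one>\<^bsub>Self\<^esub> \<in> ?N" by (auto simp: Self_def intro!: bexI[of _ "[]"])
    fix x y assume "x \<in> ?N" "y \<in> ?N"
    then obtain l l' where "l \<in> lists (D \<union> U)" "l' \<in> lists (D \<union> U)" "x \<in> words ?H l" "y \<in> words ?H l'"
      by blast
    \<comment> \<open>The product of \<open>Self\<close> applies its left factor first, so the lists
      are appended in reverse order.\<close>
    then have "y \<circ> x \<in> words ?H (l' @ l)" "l' @ l \<in> lists (D \<union> U)" using words_append by auto
    then show "x \<otimes>\<^bsub>Self\<^esub> y \<in> ?N" by (force simp: Self_def)
  qed
  moreover have "G2 \<union> U \<subseteq> ?N"
  proof
    fix g assume "g \<in> G2 \<union> U"
    then have "\<exists>d\<in>D \<union> U. \<exists>h\<in>?H. g = d \<circ> h"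
      using D(3) pgroup_id[OF pgroup_stab[OF G2]] by (metis UnCI UnE comp_id)
    then obtain d h where d: "d \<in> D \<union> U" "h \<in> ?H" "g = d \<circ> h" by blast
    then have "g \<in> words ?H [d]" by auto
    moreover have "[d] \<in> lists (D \<union> U)" using d by auto
    ultimately show "g \<in> ?N" by blast
  qed
  ultimately have sub: "generate_submonoid Self (G2 \<union> U) \<subseteq> ?N"
    unfolding generate_submonoid_def by blast
  have c: "countable (lists (D \<union> U))" using D U by (intro countable_lists) (auto intro: countable_finite)
  have "range (from_nat_into (lists (D \<union> U))) = lists (D \<union> U)"
    by (rule range_from_nat_into[OF _ c]) auto
  then have "?N = (\<Union>n. words ?H (from_nat_into (lists (D \<union> U)) n))" by (metis image_image)
  then show thesis using sub that by metis
qed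

lemma inf_orbs_mono:
  fixes G1 G2 :: "('a \<Rightarrow> 'a) set"
  assumes G1: "pgroup G1" "fclosed G1" and G2: "pgroup G2" and U: "finite U"
    and sub: "G1 \<subseteq> generate_submonoid Self (G2 \<union> U)" and big: "inf_orbs G1"
  shows "inf_orbs G2"
proof (rule ccontr)
  assume "\<not> inf_orbs G2"
  then obtain F where F: "finite F" "\<And>a. finite (orb (stab G2 F) {} a)" by (auto simp: inf_orbs_def orb_orb)
  obtain L :: "nat \<Rightarrow> ('a \<Rightarrow> 'a) list" where L: "generate_submonoid Self (G2 \<union> U) \<subseteq> (\<Union>n. words (stab G2 F) (L n))"
    by (rule submonoid_subset_words[OF G2 F(1) U])
  have "\<not> G1 \<subseteq> (\<Union>n. words (stab G2 F) (L n))"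
  proof (rule diagonal_avoidance[OF G1])
    fix n and F' :: "'a set" assume "finite F'"
    then obtain a where a: "infinite (orb G1 F' a)" using big by (auto simp: inf_orbs_def)
    have "\<not> g ` orb G1 F' a \<subseteq> (\<lambda>w. w a) ` words (stab G2 F) (L n)" if "g \<in> G1" for g
    proof -
      have "infinite (g ` orb G1 F' a)"
        using a that G1 by (metis bij_is_inj finite_imageD inj_on_subset pgroup_bij subset_UNIV)
      then show ?thesis using words_finite[OF F(2)] finite_subset by blast
    qed
    then show "\<exists>a. \<forall>g\<in>G1. \<not> g ` orb G1 F' a \<subseteq> (\<lambda>w. w a) ` words (stab G2 F) (L n)" by blast
  qed
  then show False using sub L by blast
qed

text \<open>A word with k letters moves a point to at most N ^ k places. Stating the hypothesis for
  all these powers covers two uses: unbounded orbits with arbitrary N, and nontrivial stabilizers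
  with N = 1.\<close>

lemma big_orbs_mono:
  fixes G1 G2 :: "('a \<Rightarrow> 'a) set"
  assumes G1: "pgroup G1" "fclosed G1" and G2: "pgroup G2" and U: "finite U"
    and sub: "G1 \<subseteq> generate_submonoid Self (G2 \<union> U)" and big: "\<And>k. big_orbs G1 (N ^ k)"
  shows "big_orbs G2 N"
proof (rule ccontr)
  assume "\<not> big_orbs G2 N"
  then obtain F where F: "finite F" "\<And>a. finite (orb (stab G2 F) {} a)"
    "\<And>a. card (orb (stab G2 F) {} a) \<le> N" by (auto simp: big_orbs_def orb_orb)
  obtain L :: "nat \<Rightarrow> ('a \<Rightarrow> 'a) list" where L: "generate_submonoid Self (G2 \<union> U) \<subseteq> (\<Union>n. words (stab G2 F) (L n))"
    by (rule submonoid_subset_words[OF G2 F(1) U])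
  have "\<not> G1 \<subseteq> (\<Union>n. words (stab G2 F) (L n))"
  proof (rule diagonal_avoidance[OF G1])
    fix n and F' :: "'a set" assume "finite F'"
    then obtain a where a: "\<not> (finite (orb G1 F' a) \<and> card (orb G1 F' a) \<le> N ^ length (L n))"
      using big by (auto simp: big_orbs_def)
    have "\<not> g ` orb G1 F' a \<subseteq> (\<lambda>w. w a) ` words (stab G2 F) (L n)" if "g \<in> G1" for g
    proof
      assume s: "g ` orb G1 F' a \<subseteq> (\<lambda>w. w a) ` words (stab G2 F) (L n)"
      have inj: "inj_on g (orb G1 F' a)"
        using that G1 by (metis bij_is_inj inj_on_subset pgroup_bij subset_UNIV)
      have "card (g ` orb G1 F' a) \<le> N ^ length (L n)"
        using card_mono[OF words_finite[OF F(2)] s] words_card[OF F(2,3)] by (meson le_trans)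
      moreover have "finite (orb G1 F' a)"
        using finite_subset[OF s words_finite[OF F(2)]] inj by (simp add: finite_image_iff)
      ultimately show False using a inj by (simp add: card_image)
    qed
    then show "\<exists>a. \<forall>g\<in>G1. \<not> g ` orb G1 F' a \<subseteq> (\<lambda>w. w a) ` words (stab G2 F) (L n)" by blast
  qed
  then show False using sub L by blast
qed

end

subsection \<open>Ideals of pairs\<close>

text \<open>
  \<open>(a, F) \<in> P\<close> reads ``\<open>a\<close> is small over \<open>F\<close>''; the least example is membership of \<open>a\<close> in
  \<open>acl G F\<close>.
\<close>

definition ideal_like :: "('a \<Rightarrow> 'a) set \<Rightarrow> ('a \<times> 'a set) set \<Rightarrow> bool" where
  "ideal_like G P \<longleftrightarrow>
     (\<forall>a F. (a, F) \<in> P \<longrightarrow> finite F) \<and>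
     (\<forall>a F F'. (a, F) \<in> P \<longrightarrow> F \<subseteq> F' \<longrightarrow> finite F' \<longrightarrow> (a, F') \<in> P) \<and>
     (\<forall>a F g. (a, F) \<in> P \<longrightarrow> g \<in> G \<longrightarrow> (g a, g ` F) \<in> P) \<and>
     (\<forall>a F D. finite F \<longrightarrow> finite D \<longrightarrow> (\<forall>d\<in>D. (d, F) \<in> P) \<longrightarrow> a \<in> acl G (D \<union> F) \<longrightarrow> (a, F) \<in> P) \<and>
     (\<forall>F. finite F \<longrightarrow> (\<exists>a. (a, F) \<notin> P))"

lemma ideal_likeD:
  assumes "ideal_like G P"
  shows "\<forall>a F. (a, F) \<in> P \<longrightarrow> finite F"
    and "\<forall>a F F'. (a, F) \<in> P \<longrightarrow> F \<subseteq> F' \<longrightarrow> finite F' \<longrightarrow> (a, F') \<in> P"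
    and "\<forall>a F g. (a, F) \<in> P \<longrightarrow> g \<in> G \<longrightarrow> (g a, g ` F) \<in> P"
    and "\<forall>a F D. finite F \<longrightarrow> finite D \<longrightarrow> (\<forall>d\<in>D. (d, F) \<in> P) \<longrightarrow> a \<in> acl G (D \<union> F) \<longrightarrow> (a, F) \<in> P"
    and "\<forall>F. finite F \<longrightarrow> (\<exists>a. (a, F) \<notin> P)"
  by (insert assms[unfolded ideal_like_def], (elim conjE, assumption)+)

lemmas ideal_like_finite = ideal_likeD(1)[rule_format]
lemmas ideal_like_mono = ideal_likeD(2)[rule_format]
lemmas ideal_like_conj = ideal_likeD(3)[rule_format]
lemmas ideal_like_acl = ideal_likeD(4)[rule_format]
lemmas ideal_like_proper = ideal_likeD(5)[rule_format]

definition orbit_union :: "('a \<Rightarrow> 'a) set \<Rightarrow> 'a set \<Rightarrow> 'a set" where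
  "orbit_union G F = (\<Union>x\<in>F. orb G {} x)"

lemma orbit_union_mono: "F \<subseteq> F' \<Longrightarrow> orbit_union G F \<subseteq> orbit_union G F'"
  by (auto simp: orbit_union_def)

lemma orbit_union_I: "g \<in> G \<Longrightarrow> x \<in> F \<Longrightarrow> g x \<in> orbit_union G F"
  by (auto simp: orbit_union_def orb_def stab_def)

lemma orbit_union_E: "y \<in> orbit_union G F \<Longrightarrow> \<exists>g\<in>G. \<exists>x\<in>F. y = g x"
  by (auto simp: orbit_union_def orb_def stab_def)

lemma orbit_union_idem:
  assumes "pgroup G" "F' \<subseteq> orbit_union G F" shows "orbit_union G F' \<subseteq> orbit_union G F"
proof
  fix y assume "y \<in> orbit_union G F'"
  then obtain g x where "g \<in> G" "x \<in> F'" "y = g x" using orbit_union_E by metis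
  moreover then obtain h z where "h \<in> G" "z \<in> F" "x = h z" using orbit_union_E assms(2) by (metis subsetD)
  ultimately have "y = (g \<circ> h) z" "g \<circ> h \<in> G" using assms by (simp_all add: pgroup_comp)
  then show "y \<in> orbit_union G F" using orbit_union_I \<open>z \<in> F\<close> by metis
qed

lemma orbit_union_self: "pgroup G \<Longrightarrow> F \<subseteq> orbit_union G F"
  by (auto simp: orbit_union_def orb_self)

text \<open>
  If \<open>spread\<close> fails for every finite set, unions of chains of ideals stay proper, and so does the
  derivative \<open>deriv_pairs\<close>; a maximal ideal is then a fixed point of the derivative. If it holds
  for some finite set, invariant sets bound everything that has to be avoided.
\<close>

definition spread :: "('a \<Rightarrow> 'a) set \<Rightarrow> 'a set \<Rightarrow> bool" where
  "spread G \<Gamma> \<longleftrightarrow> (\<forall>D. finite D \<longrightarrow> (\<exists>a. \<forall>F. finite F \<longrightarrow> F \<subseteq> orbit_union (stab G \<Gamma>) D \<longrightarrow> a \<notin> acl G (F \<union> \<Gamma>)))"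

lemma not_spreadD:
  assumes "\<not> spread G \<Gamma>"
  shows "\<exists>D. finite D \<and> (\<forall>a. \<exists>F. finite F \<and> F \<subseteq> orbit_union (stab G \<Gamma>) D \<and> a \<in> acl G (F \<union> \<Gamma>))"
  using assms unfolding spread_def by (simp only: not_all not_ex not_imp not_not simp_thms)

text \<open>The translates of D span everything over \<Gamma> by algebraic closure. If all of them
  were small over \<Gamma>', so would be every point, against properness.\<close>

lemma ideal_like_covered:
  assumes G: "pgroup G" and P: "ideal_like G P" and \<Gamma>: "finite \<Gamma>" "\<Gamma> \<subseteq> \<Gamma>'" "finite \<Gamma>'"
    and D: "\<forall>a. \<exists>F. finite F \<and> F \<subseteq> orbit_union (stab G \<Gamma>) D \<and> a \<in> acl G (F \<union> \<Gamma>)"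
    and DP: "\<And>d z. d \<in> D \<Longrightarrow> z \<in> stab G \<Gamma> \<Longrightarrow> (z d, \<Gamma>') \<in> P"
  shows False
proof -
  obtain a where a: "(a, \<Gamma>') \<notin> P" using ideal_like_proper[OF P \<Gamma>(3)] by blast
  obtain F where F: "finite F" "F \<subseteq> orbit_union (stab G \<Gamma>) D" "a \<in> acl G (F \<union> \<Gamma>)" using D by blast
  have "(a, \<Gamma>') \<in> P"
  proof (rule ideal_like_acl[OF P \<Gamma>(3) F(1)])
    show "(d, \<Gamma>') \<in> P" if "d \<in> F" for d
      using orbit_union_E[of d "stab G \<Gamma>" D] F(2) that DP by auto
    show "a \<in> acl G (F \<union> \<Gamma>')" using F(3) \<Gamma>(2) acl_mono[of "F \<union> \<Gamma>" "F \<union> \<Gamma>'" G] by auto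
  qed
  then show False using a by simp
qed

text \<open>Designed for its complement: if (a, F) is outside, then over every larger finite F' some
  translate of a under \<open>stab G F\<close> is still not small. For a fixed point of the
  derivative this is the last condition on a reservoir.\<close>

definition deriv_pairs :: "('a \<Rightarrow> 'a) set \<Rightarrow> ('a \<times> 'a set) set \<Rightarrow> ('a \<times> 'a set) set" where
  "deriv_pairs G P = {(a, F). finite F \<and> (\<exists>F'. F \<subseteq> F' \<and> finite F' \<and> (\<forall>z\<in>stab G F. (z a, F') \<in> P))}"

lemma stab_image: "z \<in> stab G F \<Longrightarrow> z ` F = F"
  by (auto simp: stab_def image_iff)

lemma subset_deriv_pairs:
  assumes "ideal_like G P" shows "P \<subseteq> deriv_pairs G P"
proof clarify
  fix a F assume P: "(a, F) \<in> P"
  then have "(z a, F) \<in> P" if "z \<in> stab G F" for z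
    using ideal_like_conj[OF assms P stab_in[OF that]] stab_image[OF that] by simp
  then show "(a, F) \<in> deriv_pairs G P"
    using ideal_like_finite[OF assms P] by (auto simp: deriv_pairs_def)
qed

text \<open>Properness is where the failure of \<open>spread\<close> enters: if all points were
  small in the derived sense over F, the witnesses for the finitely many points of a spanning D
  would combine into one F' over which all translates of D are small.\<close>

lemma ideal_like_deriv_pairs:
  assumes G: "pgroup G" and P: "ideal_like G P" and ns: "\<And>\<Gamma>. finite \<Gamma> \<Longrightarrow> \<not> spread G \<Gamma>"
  shows "ideal_like G (deriv_pairs G P)"
  unfolding ideal_like_def
proof (intro conjI allI impI)
  show "finite F" if "(a, F) \<in> deriv_pairs G P" for a F using that by (simp add: deriv_pairs_def)
next
  fix a F F1 assume aF: "(a, F) \<in> deriv_pairs G P" "F \<subseteq> F1" "finite F1"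
  then obtain F' where F': "F \<subseteq> F'" "finite F'" "\<And>z. z \<in> stab G F \<Longrightarrow> (z a, F') \<in> P"
    by (auto simp: deriv_pairs_def)
  have "(z a, F' \<union> F1) \<in> P" if "z \<in> stab G F1" for z
    by (rule ideal_like_mono[OF P, of _ F']) (use F' aF that stab_antimono in blast)+
  then show "(a, F1) \<in> deriv_pairs G P" using F' aF by (auto simp: deriv_pairs_def intro!: exI[of _ "F' \<union> F1"])
next
  fix a F g assume aF: "(a, F) \<in> deriv_pairs G P" and g: "g \<in> G"
  then obtain F' where F': "F \<subseteq> F'" "finite F'" "\<And>z. z \<in> stab G F \<Longrightarrow> (z a, F') \<in> P" "finite F"
    by (auto simp: deriv_pairs_def)
  have "(z (g a), g ` F') \<in> P" if z: "z \<in> stab G (g ` F)" for z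
  proof -
    have "((inv g \<circ> z \<circ> g) a, F') \<in> P" by (rule F'(3)) (rule stab_conj_inv[OF G g z])
    from ideal_like_conj[OF P this g] show ?thesis using G g by simp
  qed
  then show "(g a, g ` F) \<in> deriv_pairs G P"
    using F' by (auto simp: deriv_pairs_def intro!: exI[of _ "g ` F'"])
next
  fix a F D assume F: "finite F" and D: "finite D" "\<forall>d\<in>D. (d, F) \<in> deriv_pairs G P" and a: "a \<in> acl G (D \<union> F)"
  then have "\<forall>d\<in>D. \<exists>F'. F \<subseteq> F' \<and> finite F' \<and> (\<forall>z\<in>stab G F. (z d, F') \<in> P)"
    by (auto simp: deriv_pairs_def)
  then obtain f where f: "\<And>d. d \<in> D \<Longrightarrow> F \<subseteq> f d" "\<And>d. d \<in> D \<Longrightarrow> finite (f d)"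
    "\<And>d z. d \<in> D \<Longrightarrow> z \<in> stab G F \<Longrightarrow> (z d, f d) \<in> P" by metis
  define F' where "F' = F \<union> (\<Union>d\<in>D. f d)"
  have F': "F \<subseteq> F'" "finite F'" using F D f by (auto simp: F'_def)
  have "(z a, F') \<in> P" if z: "z \<in> stab G F" for z
  proof (rule ideal_like_acl[OF P F'(2)])
    show "finite (z ` D)" using D by simp
    show "(d, F') \<in> P" if dz: "d \<in> z ` D" for d
    proof -
      obtain d' where d': "d' \<in> D" "d = z d'" using dz by auto
      then show ?thesis using ideal_like_mono[OF P f(3)[OF d'(1) z] _ F'(2)] by (auto simp: F'_def)
    qed
    have "z a \<in> acl G (z ` (D \<union> F))" by (rule acl_conj[OF G stab_in[OF z] a])
    then show "z a \<in> acl G (z ` D \<union> F')"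
      using acl_mono[of "z ` D \<union> F" "z ` D \<union> F'" G] F'(1) stab_image[OF z] by (auto simp: image_Un)
  qed
  then show "(a, F) \<in> deriv_pairs G P" using F F' by (auto simp: deriv_pairs_def)
next
  fix F :: "'a set" assume F: "finite F"
  show "\<exists>a. (a, F) \<notin> deriv_pairs G P"
  proof (rule ccontr)
    assume "\<nexists>a. (a, F) \<notin> deriv_pairs G P"
    then have "\<forall>d. (d, F) \<in> deriv_pairs G P" by blast
    then have "\<forall>d. \<exists>F'. F \<subseteq> F' \<and> finite F' \<and> (\<forall>z\<in>stab G F. (z d, F') \<in> P)"
      unfolding deriv_pairs_def by simp
    then obtain f where f: "\<And>d. F \<subseteq> f d" "\<And>d. finite (f d)"
      "\<And>d z. z \<in> stab G F \<Longrightarrow> (z d, f d) \<in> P" by metis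
    obtain D where D: "finite D" "\<forall>a. \<exists>F'. finite F' \<and> F' \<subseteq> orbit_union (stab G F) D \<and> a \<in> acl G (F' \<union> F)"
      using not_spreadD[OF ns[OF F]] by (elim exE conjE)
    define F' where "F' = F \<union> (\<Union>d\<in>D. f d)"
    have F': "F \<subseteq> F'" "finite F'" using F D f by (auto simp: F'_def)
    show False
    proof (rule ideal_like_covered[OF G P F F' D(2)])
      show "(z d, F') \<in> P" if "d \<in> D" "z \<in> stab G F" for d z
        using ideal_like_mono[OF P f(3)[OF that(2)] _ F'(2)] that(1) by (auto simp: F'_def)
    qed
  qed
qed

lemma exists_stable_ideal:
  assumes G: "pgroup G" and inf: "inf_orbs G" and ns: "\<And>\<Gamma>. finite \<Gamma> \<Longrightarrow> \<not> spread G \<Gamma>"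
  obtains P where "ideal_like G P" "deriv_pairs G P = P"
proof -
  \<comment> \<open>The least candidate; \<open>inf_orbs\<close> says exactly that it is
    proper.\<close>
  define P0 where "P0 = {(a, F). finite F \<and> a \<in> acl G F}"
  have "ideal_like G P0"
    unfolding ideal_like_def
  proof (intro conjI allI impI)
    show "\<exists>a. (a, F) \<notin> P0" if "finite F" for F
      using inf that by (auto simp: P0_def inf_orbs_def acl_def)
    show "(a, F) \<in> P0" if "finite F" "finite D" "\<forall>d\<in>D. (d, F) \<in> P0" "a \<in> acl G (D \<union> F)" for a F D
      using acl_trans[OF G that(2) _ that(4)] that by (auto simp: P0_def)
    show "(a, F') \<in> P0" if "(a, F) \<in> P0" "F \<subseteq> F'" "finite F'" for a F F'
      using that acl_mono[of F F' G] by (auto simp: P0_def)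
  qed (auto simp: P0_def acl_conj[OF G])
  then have ne: "Collect (ideal_like G) \<noteq> {}" by blast
  have "\<exists>M\<in>Collect (ideal_like G). \<forall>X\<in>Collect (ideal_like G). M \<subseteq> X \<longrightarrow> X = M"
  proof (rule subset_Zorn_nonempty[OF ne])
    fix C assume C: "C \<noteq> {}" "subset.chain (Collect (ideal_like G)) C"
    then have il: "ideal_like G P" if "P \<in> C" for P using that by (auto simp: subset.chain_def)
    have common: "\<exists>P\<in>C. X \<subseteq> P" if "finite X" "X \<subseteq> \<Union>C" for X
      using finite_subset_Union_chain[OF that C] by blast
    have "ideal_like G (\<Union>C)"
      unfolding ideal_like_def
    proof (intro conjI allI impI)
      show "finite F" if aF: "(a, F) \<in> \<Union>C" for a F
      proof -
        obtain P where "P \<in> C" "(a, F) \<in> P" using aF by blast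
        then show ?thesis using ideal_like_finite[OF il] by blast
      qed
      show "(a, F') \<in> \<Union>C" if aF: "(a, F) \<in> \<Union>C" and F': "F \<subseteq> F'" "finite F'" for a F F'
      proof -
        obtain P where "P \<in> C" "(a, F) \<in> P" using aF by blast
        then show ?thesis using ideal_like_mono[OF il _ F'] by blast
      qed
      show "(g a, g ` F) \<in> \<Union>C" if aF: "(a, F) \<in> \<Union>C" and g: "g \<in> G" for a F g
      proof -
        obtain P where "P \<in> C" "(a, F) \<in> P" using aF by blast
        then show ?thesis using ideal_like_conj[OF il _ g] by blast
      qed
      show "(a, F) \<in> \<Union>C"
        if F: "finite F" and D: "finite D" and DC: "\<forall>d\<in>D. (d, F) \<in> \<Union>C" and a: "a \<in> acl G (D \<union> F)" for a F D
      proof -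
        have "finite ((\<lambda>d. (d, F)) ` D)" "(\<lambda>d. (d, F)) ` D \<subseteq> \<Union>C" using D DC by auto
        from common[OF this] obtain P where P: "P \<in> C" "(\<lambda>d. (d, F)) ` D \<subseteq> P" ..
        have "(a, F) \<in> P"
          by (rule ideal_like_acl[OF il[OF P(1)] F D _ a]) (use P(2) in auto)
        then show ?thesis using P(1) by (rule UnionI[rotated])
      qed
      fix F :: "'a set" assume F: "finite F"
      show "\<exists>a. (a, F) \<notin> \<Union>C"
      proof (rule ccontr)
        assume all: "\<nexists>a. (a, F) \<notin> \<Union>C"
        obtain D where D: "finite D" "\<forall>a. \<exists>F'. finite F' \<and> F' \<subseteq> orbit_union (stab G F) D \<and> a \<in> acl G (F' \<union> F)"
          using not_spreadD[OF ns[OF F]] by (elim exE conjE)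
        have "finite ((\<lambda>d. (d, F)) ` D)" "(\<lambda>d. (d, F)) ` D \<subseteq> \<Union>C" using D(1) all by auto
        from common[OF this] obtain P where P: "P \<in> C" "(\<lambda>d. (d, F)) ` D \<subseteq> P" ..
        show False
        proof (rule ideal_like_covered[OF G il[OF P(1)] F _ F D(2)])
          show "(z d, F) \<in> P" if "d \<in> D" "z \<in> stab G F" for d z
          proof -
            have "(d, F) \<in> P" using P(2) that(1) by auto
            from ideal_like_conj[OF il[OF P(1)] this stab_in[OF that(2)]]
            show ?thesis by (simp add: stab_image[OF that(2)])
          qed
        qed simp
      qed
    qed
    then show "\<Union>C \<in> Collect (ideal_like G)" by simp
  qed
  then obtain P where P: "ideal_like G P" "\<And>X. ideal_like G X \<Longrightarrow> P \<subseteq> X \<Longrightarrow> X = P" by auto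
  have "deriv_pairs G P = P"
    using P(2)[OF ideal_like_deriv_pairs[OF G P(1) ns] subset_deriv_pairs[OF P(1)]] .
  then show thesis using that P(1) by blast
qed

subsection \<open>Reservoirs\<close>

text \<open>
  \<open>B m a F\<close> says that \<open>a\<close> may serve as the point \<open>\<alpha> m\<close> when \<open>F\<close> has to stay fixed. The last
  condition is what allows \<open>F\<close> to be enlarged by a point after \<open>a\<close> has been chosen.
\<close>

definition reservoir :: "('a \<Rightarrow> 'a) set \<Rightarrow> (nat \<Rightarrow> 'a \<Rightarrow> 'a set \<Rightarrow> bool) \<Rightarrow> bool" where
  "reservoir G B \<longleftrightarrow>
     (\<forall>m F. finite F \<longrightarrow> (\<exists>a. B m a F)) \<and>
     (\<forall>m a F F'. B m a F' \<longrightarrow> F \<subseteq> F' \<longrightarrow> finite F' \<longrightarrow> B m a F) \<and>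
     (\<forall>m a F g. B m a F \<longrightarrow> finite F \<longrightarrow> g \<in> G \<longrightarrow> B m (g a) (g ` F)) \<and>
     (\<forall>m a F F'. B m a F \<longrightarrow> F \<subseteq> F' \<longrightarrow> finite F' \<longrightarrow> F' \<subseteq> orbit_union G F \<longrightarrow> (\<exists>z\<in>stab G F. B m (z a) F'))"

text \<open>Goodness over D is tested on the finite subsets of the invariant set
  \<open>orbit_union G D\<close>. Enlarging D inside that set leaves the test unchanged, so the
  identity serves as z in the last condition. The predicate \<open>sm\<close> stays abstract to
  cover both finiteness and cardinality bounds.\<close>

lemma reservoir_spread:
  assumes G: "pgroup G"
    and ex: "\<And>m D. finite D \<Longrightarrow> \<exists>a. \<forall>F. finite F \<longrightarrow> F \<subseteq> orbit_union G D \<longrightarrow> \<not> sm m (orb G F a)"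
    and sm: "\<And>m X g. sm m (g ` X) \<Longrightarrow> g \<in> G \<Longrightarrow> sm m X"
  shows "reservoir G (\<lambda>m a D. \<forall>F. finite F \<longrightarrow> F \<subseteq> orbit_union G D \<longrightarrow> \<not> sm m (orb G F a))"
  unfolding reservoir_def
proof (intro conjI allI impI ex)
  show "\<not> sm m (orb G K a)"
    if "\<forall>K. finite K \<longrightarrow> K \<subseteq> orbit_union G F' \<longrightarrow> \<not> sm m (orb G K a)" "F \<subseteq> F'" "finite K" "K \<subseteq> orbit_union G F" for m a F F' K
    using that orbit_union_mono[of F F' G] by blast
  show "\<not> sm m (orb G K (g a))"
    if a: "\<forall>K. finite K \<longrightarrow> K \<subseteq> orbit_union G F \<longrightarrow> \<not> sm m (orb G K a)" and g: "g \<in> G" and K: "finite K" "K \<subseteq> orbit_union G (g ` F)"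
    for m a F g K
  proof -
    have "inv g ` K \<subseteq> orbit_union G F"
    proof -
      have "g ` F \<subseteq> orbit_union G F" using g by (auto intro: orbit_union_I)
      then have KF: "K \<subseteq> orbit_union G F" using K(2) orbit_union_idem[OF G] by blast
      then have "inv g ` K \<subseteq> orbit_union G K" using orbit_union_I[OF pgroup_inv[OF G g]] by blast
      then show ?thesis using orbit_union_idem[OF G KF] by blast
    qed
    then have "\<not> sm m (orb G (inv g ` K) a)" using a K by blast
    moreover have "orb G K (g a) = g ` orb G (inv g ` K) a"
      using orb_conj[OF G g, of "inv g ` K" a] G g by (simp add: image_image)
    ultimately show ?thesis using sm g by metis
  qed
  show "\<exists>z\<in>stab G F. \<forall>K. finite K \<longrightarrow> K \<subseteq> orbit_union G F' \<longrightarrow> \<not> sm m (orb G K (z a))"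
    if a: "\<forall>K. finite K \<longrightarrow> K \<subseteq> orbit_union G F \<longrightarrow> \<not> sm m (orb G K a)" and F': "F' \<subseteq> orbit_union G F" for m a F F'
    using a orbit_union_idem[OF G F'] pgroup_id[OF pgroup_stab[OF G, of F]] by (intro bexI[of _ id]) auto
qed

text \<open>If \<open>spread\<close> holds for some \<Gamma>, the reservoir comes from invariant
  sets of the stabilizer of \<Gamma>. Otherwise it is the complement of a stable ideal; orbits are
  then infinite since the ideal contains all algebraic pairs, by its closure condition with D
  empty.\<close>

lemma inf_orbs_reservoir:
  assumes G: "pgroup G" and inf: "inf_orbs G"
  obtains \<Gamma> B where "finite \<Gamma>" "reservoir (stab G \<Gamma>) B"
    "\<And>m a F. B m a F \<Longrightarrow> finite F \<Longrightarrow> infinite (orb (stab G \<Gamma>) F a)"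
proof (cases "\<exists>\<Gamma>. finite \<Gamma> \<and> spread G \<Gamma>")
  case True
  then obtain \<Gamma> where \<Gamma>: "finite \<Gamma>" "spread G \<Gamma>" by blast
  let ?H = "stab G \<Gamma>"
  let ?B = "\<lambda>m a D. \<forall>F. finite F \<longrightarrow> F \<subseteq> orbit_union ?H D \<longrightarrow> \<not> finite (orb ?H F a)"
  have "reservoir ?H ?B"
  proof (rule reservoir_spread[OF pgroup_stab[OF G]])
    show "\<exists>a. \<forall>F. finite F \<longrightarrow> F \<subseteq> orbit_union ?H D \<longrightarrow> infinite (orb ?H F a)" if "finite D" for D
      using \<Gamma>(2) that unfolding spread_def acl_def by (auto simp: orb_orb Un_commute)
    show "finite X" if "finite (g ` X)" "g \<in> ?H" for X g
      using that G by (metis bij_is_inj finite_imageD inj_on_subset pgroup_bij stab_in subset_UNIV)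
  qed
  then show thesis
    by (rule that[OF \<Gamma>(1)]) (use orbit_union_self[OF pgroup_stab[OF G]] in blast)
next
  case False
  then obtain P where P: "ideal_like G P" "deriv_pairs G P = P"
    using exists_stable_ideal[OF G inf] by metis
  let ?B = "\<lambda>m a F. finite F \<and> (a, F) \<notin> P"
  have "reservoir G (\<lambda>m::nat. ?B m)"
    unfolding reservoir_def
  proof (intro conjI allI impI)
    show "\<exists>a. ?B m a F" if "finite F" for m F using ideal_like_proper[OF P(1) that] that by blast
    show "finite F" if "?B m a F'" "F \<subseteq> F'" for m a F F' using that finite_subset by blast
    show "(a, F) \<notin> P" if "?B m a F'" "F \<subseteq> F'" "finite F'" for m a F F'
      using that ideal_like_mono[OF P(1)] by blast
    show "finite (g ` F)" if "finite F" for g F using that by simp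
    show "(g a, g ` F) \<notin> P" if "?B m a F" "g \<in> G" for m a F g
    proof
      assume "(g a, g ` F) \<in> P"
      from ideal_like_conj[OF P(1) this pgroup_inv[OF G that(2)]]
      show False using that G by (simp add: image_image)
    qed
    show "\<exists>z\<in>stab G F. finite F' \<and> (z a, F') \<notin> P"
      if "?B m a F" "F \<subseteq> F'" "finite F'" for m a F F'
    proof -
      have "(a, F) \<notin> deriv_pairs G P" using that P(2) by simp
      then show ?thesis using that by (auto simp: deriv_pairs_def)
    qed
  qed
  moreover have "infinite (orb G F a)" if "?B m a F" for m a F
    using ideal_like_acl[OF P(1), of F "{}" a] that by (auto simp: acl_def)
  ultimately show thesis by (intro that[of "{}" "\<lambda>m. ?B m"]) auto
qed

text \<open>Finite orbits make \<open>orbit_union G D\<close> finite, so it can be fixed as a whole;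
  an orbit that is large over it is large over each of its subsets.\<close>

lemma big_orbs_reservoir:
  assumes G: "pgroup G" and fin: "\<And>a. finite (orb G {} a)" and big: "\<And>n. big_orbs G n"
  shows "\<exists>B. reservoir G B \<and> (\<forall>m a F. B m a F \<longrightarrow> finite F \<longrightarrow> card (orb G F a) > c m)"
proof -
  let ?sm = "\<lambda>m X. finite X \<and> card X \<le> c m"
  let ?B = "\<lambda>m a D. \<forall>F. finite F \<longrightarrow> F \<subseteq> orbit_union G D \<longrightarrow> \<not> ?sm m (orb G F a)"
  have finF: "finite (orb G F a)" for F a
    by (rule finite_subset[OF orb_antimono fin]) simp
  have "reservoir G ?B"
  proof (rule reservoir_spread[OF G])
    fix m and D :: "'a set" assume D: "finite D"
    have W: "finite (orbit_union G D)" unfolding orbit_union_def using D fin by blast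
    obtain a where a: "\<not> (finite (orb G (orbit_union G D) a) \<and> card (orb G (orbit_union G D) a) \<le> c m)"
      using big W unfolding big_orbs_def by metis
    have "\<not> ?sm m (orb G F a)" if "F \<subseteq> orbit_union G D" for F
      using a card_mono[OF finF orb_antimono[OF that, of G a]] finF by (metis le_trans)
    then show "\<exists>a. \<forall>F. finite F \<longrightarrow> F \<subseteq> orbit_union G D \<longrightarrow> \<not> ?sm m (orb G F a)" by blast
  next
    fix m X g assume "?sm m (g ` X)" "g \<in> G"
    moreover have "inj_on g X" using \<open>g \<in> G\<close> G by (metis bij_is_inj inj_on_subset pgroup_bij subset_UNIV)
    ultimately show "?sm m X" by (simp add: finite_image_iff card_image)
  qed
  moreover have "card (orb G F a) > c m" if "?B m a F" "finite F" for m a F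
    using that finF orbit_union_self[OF G, of F] by (meson not_le)
  ultimately show ?thesis by blast
qed

subsection \<open>Trees of group elements\<close>

text \<open>The tree of finite sequences of naturals, numbered by the pairing function. The
  successor in \<open>child\<close> reserves 0 for the root and makes parents smaller than their
  children.\<close>

definition parent :: "nat \<Rightarrow> nat" where "parent i = fst (prod_decode (i - 1))"

definition child :: "nat \<Rightarrow> nat \<Rightarrow> nat" where "child p c = Suc (prod_encode (p, c))"

lemma parent_child [simp]: "parent (child p c) = p"
  by (simp add: parent_def child_def)

lemma child_neq_0 [simp]: "child p c \<noteq> 0"
  by (simp add: child_def)

lemma child_inject [simp]: "child p c = child p' c' \<longleftrightarrow> p = p' \<and> c = c'"
  by (simp add: child_def)

lemma parent_less: "i \<noteq> 0 \<Longrightarrow> parent i < i"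
  using le_prod_encode_1[of "fst (prod_decode (i - 1))" "snd (prod_decode (i - 1))"]
  by (simp add: parent_def)

function depth :: "nat \<Rightarrow> nat" where
  "depth i = (if i = 0 then 0 else Suc (depth (parent i)))"
  by auto
termination by (relation "measure id") (auto simp: parent_less)

declare depth.simps [simp del]

lemma depth_0 [simp]: "depth 0 = 0"
  by (simp add: depth.simps)

lemma depth_parent: "i \<noteq> 0 \<Longrightarrow> depth i = Suc (depth (parent i))"
  by (subst depth.simps) simp

lemma depth_child [simp]: "depth (child p c) = Suc (depth p)"
  by (simp add: depth_parent)

lemma depth_le: "depth i \<le> i"
proof (induction i rule: less_induct)
  case (less i)
  show ?case
  proof (cases "i = 0")
    case False
    then show ?thesis using less[OF parent_less[OF False]] parent_less[OF False] by (simp add: depth_parent)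
  qed simp
qed

lemma reservoirD:
  assumes "reservoir G B"
  shows "\<forall>m F. finite F \<longrightarrow> (\<exists>a. B m a F)"
    and "\<forall>m a F F'. B m a F' \<longrightarrow> F \<subseteq> F' \<longrightarrow> finite F' \<longrightarrow> B m a F"
    and "\<forall>m a F g. B m a F \<longrightarrow> finite F \<longrightarrow> g \<in> G \<longrightarrow> B m (g a) (g ` F)"
    and "\<forall>m a F F'. B m a F \<longrightarrow> F \<subseteq> F' \<longrightarrow> finite F' \<longrightarrow> F' \<subseteq> orbit_union G F \<longrightarrow> (\<exists>z\<in>stab G F. B m (z a) F')"
  by (insert assms[unfolded reservoir_def], (elim conjE, assumption)+)

lemmas reservoir_ex = reservoirD(1)[rule_format]
lemmas reservoir_antimono = reservoirD(2)[rule_format]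
lemmas reservoir_conj = reservoirD(3)[rule_format]
lemmas reservoir_move = reservoirD(4)[rule_format]

context enumeration begin

definition frozen :: "(nat \<Rightarrow> 'a) \<Rightarrow> nat \<Rightarrow> 'a set" where
  "frozen \<alpha> m = en ` {..<m} \<union> \<alpha> ` {..<m}"

definition frozen_back :: "('a \<Rightarrow> 'a) \<Rightarrow> nat \<Rightarrow> 'a set" where
  "frozen_back g n = (\<lambda>l. inv g (en l)) ` {..<n}"

lemma finite_frozen [simp]: "finite (frozen \<alpha> m)" and finite_frozen_back [simp]: "finite (frozen_back g m)"
  by (simp_all add: frozen_def frozen_back_def)

lemma frozen_mono: "m \<le> n \<Longrightarrow> frozen \<alpha> m \<subseteq> frozen \<alpha> n"
  by (auto simp: frozen_def)

lemma frozen_I: "l < m \<Longrightarrow> en l \<in> frozen \<alpha> m" "l < m \<Longrightarrow> \<alpha> l \<in> frozen \<alpha> m"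
  by (auto simp: frozen_def)

text \<open>Freezing the preimage \<delta> of \<open>en n\<close> adds a point to the sets over
  which the points already chosen must be good. The repair treats one index M at a time: replacing h
  by h \<circ> z replaces \<delta> by \<open>inv z \<delta>\<close>, and goodness of
  \<open>z (\<alpha> M)\<close> over \<delta> pulls back along z to goodness of \<alpha> M over
  \<open>inv z \<delta>\<close>. As z fixes \<open>frozen \<alpha> M\<close>, the smaller indices
  and the value at \<alpha> n are not disturbed.\<close>

lemma reservoir_extend:
  fixes G :: "('a \<Rightarrow> 'a) set"
  assumes G: "pgroup G" and B: "reservoir G B" and gp: "gp \<in> G" and \<Delta>: "finite \<Delta>"
    and h0: "h0 \<in> stab G (\<Delta> \<union> frozen \<alpha> n)" and M: "Suc n \<le> M"
    and IH: "\<And>m. n \<le> m \<Longrightarrow> m < M \<Longrightarrow> B m (\<alpha> m) (\<Delta> \<union> frozen \<alpha> m)"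
  shows "\<exists>h\<in>stab G (\<Delta> \<union> frozen \<alpha> n). h (\<alpha> n) = h0 (\<alpha> n) \<and>
    (\<forall>m. Suc n \<le> m \<longrightarrow> m < M \<longrightarrow> B m (\<alpha> m) (insert (inv (gp \<circ> h) (en n)) (\<Delta> \<union> frozen \<alpha> m)))"
  using M IH
proof (induction M rule: dec_induct)
  case base
  then show ?case using h0 by (intro bexI[of _ h0]) auto
next
  case (step M)
  have "\<exists>h\<in>stab G (\<Delta> \<union> frozen \<alpha> n). h (\<alpha> n) = h0 (\<alpha> n) \<and>
    (\<forall>m. Suc n \<le> m \<longrightarrow> m < M \<longrightarrow> B m (\<alpha> m) (insert (inv (gp \<circ> h) (en n)) (\<Delta> \<union> frozen \<alpha> m)))"
    by (rule step.IH) (use step.prems in simp)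
  then obtain h where h: "h \<in> stab G (\<Delta> \<union> frozen \<alpha> n)" "h (\<alpha> n) = h0 (\<alpha> n)"
    and h_all: "\<forall>m. Suc n \<le> m \<longrightarrow> m < M \<longrightarrow> B m (\<alpha> m) (insert (inv (gp \<circ> h) (en n)) (\<Delta> \<union> frozen \<alpha> m))"
    by (elim bexE conjE)
  note h3 = h_all[rule_format]
  define \<delta> where "\<delta> = inv (gp \<circ> h) (en n)"
  let ?F = "\<Delta> \<union> frozen \<alpha> M"
  have gh: "gp \<circ> h \<in> G" using gp h(1) G by (simp add: pgroup_comp stab_in)
  \<comment> \<open>The point \<delta> is a translate of \<open>en n\<close>, which is frozen at M
    since n < M. This is what the last condition on a reservoir asks of a new point.\<close>
  have "\<delta> \<in> orbit_union G ?F"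
    unfolding \<delta>_def by (rule orbit_union_I[OF pgroup_inv[OF G gh]]) (use frozen_I(1)[of n M \<alpha>] step.hyps in auto)
  then have sub: "insert \<delta> ?F \<subseteq> orbit_union G ?F" using orbit_union_self[OF G, of ?F] by auto
  have BM: "B M (\<alpha> M) ?F" using step.prems[of M] step.hyps by simp
  obtain z where z: "z \<in> stab G ?F" "B M (z (\<alpha> M)) (insert \<delta> ?F)"
    using reservoir_move[OF B BM _ _ sub] \<Delta> by auto
  have zG: "z \<in> G" "inv z \<in> G" using z(1) G by (auto simp: stab_in pgroup_inv)
  have zfix: "inv z x = x" if "x \<in> ?F" for x
    using stab_fix[OF z(1) that] zG(1) G by (metis pgroup_inv_left)
  have \<delta>': "inv (gp \<circ> (h \<circ> z)) (en n) = inv z \<delta>"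
  proof -
    have "(gp \<circ> (h \<circ> z)) (inv z \<delta>) = (gp \<circ> h) \<delta>" using zG(1) G by simp
    also have "\<dots> = en n" unfolding \<delta>_def using gh G by (metis pgroup_inv_right)
    finally show ?thesis
      using pgroup_inv_left[OF G, of "gp \<circ> (h \<circ> z)"] gp h(1) zG(1) G by (metis pgroup_comp stab_in)
  qed
  have "h \<circ> z \<in> stab G (\<Delta> \<union> frozen \<alpha> n)"
  proof (rule pgroup_comp[OF pgroup_stab[OF G] h(1)])
    have "\<Delta> \<union> frozen \<alpha> n \<subseteq> ?F" using frozen_mono[of n M \<alpha>] step.hyps by auto
    then show "z \<in> stab G (\<Delta> \<union> frozen \<alpha> n)" using z(1) stab_antimono by blast
  qed
  moreover have "(h \<circ> z) (\<alpha> n) = h0 (\<alpha> n)"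
    using stab_fix[OF z(1), of "\<alpha> n"] frozen_I(2)[of n M \<alpha>] step.hyps h(2) by simp
  moreover have "B m (\<alpha> m) (insert (inv (gp \<circ> (h \<circ> z)) (en n)) (\<Delta> \<union> frozen \<alpha> m))" if m: "Suc n \<le> m" "m < Suc M" for m
  proof (cases "m = M")
    case True
    have "B M (inv z (z (\<alpha> M))) (inv z ` (insert \<delta> ?F))"
      by (rule reservoir_conj[OF B z(2) _ zG(2)]) (use \<Delta> in simp)
    moreover have "inv z ` ?F = ?F" using zfix by force
    ultimately show ?thesis using True zG G by (simp add: \<delta>')
  next
    case False
    then have mM: "m < M" using m by simp
    have "B m (inv z (\<alpha> m)) (inv z ` (insert \<delta> (\<Delta> \<union> frozen \<alpha> m)))"
      by (rule reservoir_conj[OF B _ _ zG(2)]) (use \<Delta> h3[OF m(1) mM] in \<open>simp_all add: \<delta>_def\<close>)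
    moreover have "inv z ` (\<Delta> \<union> frozen \<alpha> m) = \<Delta> \<union> frozen \<alpha> m" using zfix frozen_mono[of m M \<alpha>] mM by force
    moreover have "inv z (\<alpha> m) = \<alpha> m" using zfix frozen_I(2)[OF mM] by simp
    ultimately show ?thesis by (simp add: \<delta>')
  qed
  ultimately show ?case by blast
qed

text \<open>
  Nodes are numbered so that parents come first, and step \<open>i\<close> chooses the group element of node \<open>i\<close>
  before the point \<open>\<alpha> i\<close>. Thus only finitely many elements exist when \<open>\<alpha> i\<close> is chosen, although
  a node may have infinitely many children. Fixing \<open>frozen\<close> preserves the images of the points listed so
  far and fixing \<open>frozen_back\<close> their preimages, so branches converge to permutations.
\<close>

definition tree_inv ::
  "('a \<Rightarrow> 'a) set \<Rightarrow> (nat \<Rightarrow> 'a \<Rightarrow> 'a set \<Rightarrow> bool) \<Rightarrow> nat set \<Rightarrow> nat \<Rightarrow> (nat \<Rightarrow> 'a) \<Rightarrow> (nat \<Rightarrow> 'a \<Rightarrow> 'a) \<Rightarrow> bool"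
where
  "tree_inv G B T i \<alpha> g \<longleftrightarrow>
     g 0 = id \<and>
     (\<forall>j\<le>i. g j \<in> G) \<and>
     (\<forall>j\<le>i. \<forall>m. depth j \<le> m \<longrightarrow> m \<le> i \<longrightarrow> B m (\<alpha> m) (frozen_back (g j) (depth j) \<union> frozen \<alpha> m)) \<and>
     (\<forall>j\<le>i. j \<noteq> 0 \<longrightarrow>
        (\<exists>h\<in>stab G (frozen_back (g (parent j)) (depth (parent j)) \<union> frozen \<alpha> (depth (parent j))). g j = g (parent j) \<circ> h)) \<and>
     (\<forall>j\<le>i. \<forall>j'<j. j' \<noteq> 0 \<longrightarrow> j \<in> T \<longrightarrow> g j (\<alpha> (depth (parent j))) \<noteq> g j' (\<alpha> (depth (parent j'))))"

lemma tree_inv_cong: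
  assumes inv: "tree_inv G B T i \<alpha> g" and eq: "\<And>j. j \<le> i \<Longrightarrow> \<alpha> j = \<alpha>' j" "\<And>j. j \<le> i \<Longrightarrow> g j = g' j"
  shows "tree_inv G B T i \<alpha>' g'"
proof -
  have \<Gamma>: "frozen \<alpha>' m = frozen \<alpha> m" if "m \<le> i" for m
    using eq(1) that by (auto simp: frozen_def image_iff)
  have pj: "parent j \<le> i" "depth (parent j) \<le> i" if "j \<le> i" "j \<noteq> 0" for j
    using parent_less[OF that(2)] depth_le[of "parent j"] that(1) by auto
  have g: "g' j = g j" and \<alpha>: "\<alpha>' j = \<alpha> j" if "j \<le> i" for j using eq that by simp_all
  have 1: "g' 0 = id" using inv g[of 0] by (simp add: tree_inv_def)
  have 2: "g' j \<in> G" if "j \<le> i" for j using inv g[OF that] that by (simp add: tree_inv_def)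
  have 3: "B m (\<alpha>' m) (frozen_back (g' j) (depth j) \<union> frozen \<alpha>' m)" if "j \<le> i" "depth j \<le> m" "m \<le> i" for j m
    using inv that unfolding g[OF that(1)] \<alpha>[OF that(3)] \<Gamma>[OF that(3)] by (simp add: tree_inv_def)
  have 4: "\<exists>h\<in>stab G (frozen_back (g' (parent j)) (depth (parent j)) \<union> frozen \<alpha>' (depth (parent j))). g' j = g' (parent j) \<circ> h"
    if "j \<le> i" "j \<noteq> 0" for j
    using inv that unfolding g[OF that(1)] g[OF pj(1)[OF that]] \<Gamma>[OF pj(2)[OF that]] by (simp add: tree_inv_def)
  have 5: "g' j (\<alpha>' (depth (parent j))) \<noteq> g' j' (\<alpha>' (depth (parent j')))" if "j \<le> i" "j' < j" "j' \<noteq> 0" "j \<in> T" for j j'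
  proof -
    have j: "j \<noteq> 0" "j' \<le> i" using that by auto
    show ?thesis
      using inv that unfolding g[OF that(1)] g[OF j(2)] \<alpha>[OF pj(2)[OF that(1) j(1)]] \<alpha>[OF pj(2)[OF j(2) that(3)]]
      by (simp add: tree_inv_def)
  qed
  show ?thesis unfolding tree_inv_def using 1 2 3 4 5 by blast
qed

text \<open>The label of the new node, its value at the point of its parent's level, is fixed first
  by h0. The correction of \<open>reservoir_extend\<close> keeps that value while freezing one more
  preimage, and only then is the next point chosen.\<close>

lemma tree_inv_step:
  fixes G :: "('a \<Rightarrow> 'a) set"
  assumes G: "pgroup G" and B: "reservoir G B"
    and big: "\<forall>m a F i. B m a F \<longrightarrow> finite F \<longrightarrow> i \<in> T \<longrightarrow> depth i = Suc m \<longrightarrow>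
                \<not> (finite (orb G F a) \<and> card (orb G F a) \<le> i)"
    and inv: "tree_inv G B T i \<alpha> g"
  shows "\<exists>a k. tree_inv G B T (Suc i) (\<alpha>(Suc i := a)) (g(Suc i := k))"
proof -
  define p n where "p = parent (Suc i)" and "n = depth p"
  have p: "p \<le> i" using parent_less[of "Suc i"] by (simp add: p_def)
  have n: "n \<le> i" using depth_le[of p] p by (simp add: n_def)
  have gG: "g j \<in> G" if "j \<le> i" for j using inv that by (simp add: tree_inv_def)
  have BI: "B m (\<alpha> m) (frozen_back (g j) (depth j) \<union> frozen \<alpha> m)" if "j \<le> i" "depth j \<le> m" "m \<le> i" for j m
    using inv that by (simp add: tree_inv_def)
  let ?\<Delta> = "frozen_back (g p) n"
  \<comment> \<open>The labels in use number at most \<open>Suc i\<close>, the number of the new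
    node; this is the reason for comparing orbits with node numbers in \<open>big\<close>.\<close>
  define V where "V = (\<lambda>j. g j (\<alpha> (depth (parent j)))) ` {..i}"
  have V: "finite V" "card V \<le> Suc i" unfolding V_def using card_image_le[of "{..i}"] by auto
  have "\<exists>h\<in>stab G (?\<Delta> \<union> frozen \<alpha> n). Suc i \<in> T \<longrightarrow> g p (h (\<alpha> n)) \<notin> V"
  proof (cases "Suc i \<in> T")
    case True
    let ?O = "orb G (?\<Delta> \<union> frozen \<alpha> n) (\<alpha> n)"
    have "B n (\<alpha> n) (?\<Delta> \<union> frozen \<alpha> n)" using BI[OF p] n by (simp add: n_def)
    then have O: "\<not> (finite ?O \<and> card ?O \<le> Suc i)"
      by (rule big[rule_format]) (use True in \<open>simp_all add: depth_parent p_def n_def\<close>)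
    have inj: "inj_on (g p) ?O" using gG[OF p] G by (metis bij_is_inj inj_on_subset pgroup_bij subset_UNIV)
    have "\<not> g p ` ?O \<subseteq> V"
    proof
      assume s: "g p ` ?O \<subseteq> V"
      have "finite ?O" using finite_subset[OF s V(1)] inj by (simp add: finite_image_iff)
      moreover have "card ?O \<le> Suc i" using card_mono[OF V(1) s] V(2) inj by (simp add: card_image)
      ultimately show False using O by simp
    qed
    then show ?thesis by (auto simp: orb_def)
  next
    case False
    then show ?thesis using pgroup_id[OF pgroup_stab[OF G]] by blast
  qed
  then obtain h0 where h0: "h0 \<in> stab G (?\<Delta> \<union> frozen \<alpha> n)" "Suc i \<in> T \<Longrightarrow> g p (h0 (\<alpha> n)) \<notin> V" by blast
  have "\<exists>h\<in>stab G (?\<Delta> \<union> frozen \<alpha> n). h (\<alpha> n) = h0 (\<alpha> n) \<and>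
    (\<forall>m. Suc n \<le> m \<longrightarrow> m < Suc i \<longrightarrow> B m (\<alpha> m) (insert (inv (g p \<circ> h) (en n)) (?\<Delta> \<union> frozen \<alpha> m)))"
    by (rule reservoir_extend[OF G B gG[OF p] _ h0(1)]) (use n BI[OF p] in \<open>auto simp: n_def\<close>)
  then obtain h where h: "h \<in> stab G (?\<Delta> \<union> frozen \<alpha> n)" "h (\<alpha> n) = h0 (\<alpha> n)"
    and h3: "\<forall>m. Suc n \<le> m \<longrightarrow> m < Suc i \<longrightarrow> B m (\<alpha> m) (insert (inv (g p \<circ> h) (en n)) (?\<Delta> \<union> frozen \<alpha> m))"
    by (elim bexE conjE)
  define k where "k = g p \<circ> h"
  have kG: "k \<in> G" using gG[OF p] h(1) G by (simp add: k_def pgroup_comp stab_in)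
  have levi: "depth (Suc i) = Suc n" by (simp add: depth_parent p_def n_def)
  \<comment> \<open>Since h fixes the earlier frozen preimages, only the preimage of
    \<open>en n\<close> is new.\<close>
  have \<Delta>k: "frozen_back k (Suc n) = insert (inv k (en n)) ?\<Delta>"
  proof -
    have "inv k (en l) = inv (g p) (en l)" if "l < n" for l
    proof -
      have "h (inv (g p) (en l)) = inv (g p) (en l)"
        by (rule stab_fix[OF h(1)]) (use that in \<open>auto simp: frozen_back_def\<close>)
      then have "k (inv (g p) (en l)) = en l" using gG[OF p] G by (simp add: k_def)
      then show ?thesis using kG G by (metis pgroup_inv_left)
    qed
    then have "(\<lambda>l. inv k (en l)) ` {..<n} = ?\<Delta>" unfolding frozen_back_def by (intro image_cong) auto
    then show ?thesis by (simp add: frozen_back_def lessThan_Suc)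
  qed
  define g' where "g' = g(Suc i := k)"
  have g': "g' j = g j" if "j \<le> i" for j using that by (simp add: g'_def)
  have g'i: "g' (Suc i) = k" by (simp add: g'_def)
  \<comment> \<open>Any node present so far may later have descendants that use this point, so it is
    taken good over all their frozen preimages at once.\<close>
  obtain a where a: "B (Suc i) a ((\<Union>j\<le>Suc i. frozen_back (g' j) (depth j)) \<union> frozen \<alpha> (Suc i))"
    using reservoir_ex[OF B, of "(\<Union>j\<le>Suc i. frozen_back (g' j) (depth j)) \<union> frozen \<alpha> (Suc i)"] by auto
  define \<alpha>' where "\<alpha>' = \<alpha>(Suc i := a)"
  have \<alpha>': "\<alpha>' j = \<alpha> j" if "j \<le> i" for j using that by (simp add: \<alpha>'_def)
  have \<Gamma>': "frozen \<alpha>' m = frozen \<alpha> m" if "m \<le> Suc i" for m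
    using that by (auto simp: frozen_def \<alpha>'_def)
  have old: "tree_inv G B T i \<alpha>' g'" by (rule tree_inv_cong[OF inv]) (simp_all add: g' \<alpha>')
  have "B m (\<alpha>' m) (frozen_back (g' j) (depth j) \<union> frozen \<alpha>' m)" if j: "j \<le> Suc i" and m: "depth j \<le> m" "m \<le> Suc i" for j m
  proof (cases "m = Suc i")
    case True
    show ?thesis
      unfolding True \<Gamma>'[OF order_refl]
      by (rule reservoir_antimono[OF B, of _ _ "(\<Union>j\<le>Suc i. frozen_back (g' j) (depth j)) \<union> frozen \<alpha> (Suc i)"])
        (use a j in \<open>auto simp: \<alpha>'_def\<close>)
  next
    case False
    then have mi: "m \<le> i" using m by simp
    show ?thesis
    proof (cases "j = Suc i")
      case True
      then show ?thesis
        using h3[rule_format, of m] mi m(1) \<Delta>k by (simp add: \<alpha>' \<Gamma>' g'i levi k_def[symmetric])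
    next
      case False
      then show ?thesis using old j m mi by (simp add: tree_inv_def)
    qed
  qed
  moreover have "\<exists>h\<in>stab G (frozen_back (g' (parent j)) (depth (parent j)) \<union> frozen \<alpha>' (depth (parent j))). g' j = g' (parent j) \<circ> h"
    if j: "j \<le> Suc i" "j \<noteq> 0" for j
  proof (cases "j = Suc i")
    case True
    have "g' (Suc i) = g' p \<circ> h" "g' p = g p" "frozen \<alpha>' n = frozen \<alpha> n"
      using g'[OF p] g'i n by (simp_all add: k_def \<Gamma>')
    then show ?thesis using h(1) unfolding True p_def[symmetric] n_def[symmetric] by auto
  next
    case False
    then show ?thesis using old j by (simp add: tree_inv_def)
  qed
  moreover have "g' j (\<alpha>' (depth (parent j))) \<noteq> g' j' (\<alpha>' (depth (parent j')))"
    if j: "j \<le> Suc i" "j' < j" "j' \<noteq> 0" "j \<in> T" for j j'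
  proof (cases "j = Suc i")
    case True
    have "g' (Suc i) (\<alpha>' n) = g p (h0 (\<alpha> n))" using g'i h(2) \<alpha>'[OF n] by (simp add: k_def)
    moreover have "g' j' (\<alpha>' (depth (parent j'))) \<in> V"
    proof -
      have "j' \<le> i" using j True by simp
      moreover have "depth (parent j') \<le> i" using depth_le[of "parent j'"] parent_less[OF j(3)] \<open>j' \<le> i\<close> by simp
      ultimately show ?thesis by (simp add: V_def g' \<alpha>')
    qed
    ultimately show ?thesis using h0(2) j(4) unfolding True p_def[symmetric] n_def[symmetric] by auto
  next
    case False
    then show ?thesis using old j by (simp add: tree_inv_def)
  qed
  moreover have "g' 0 = id" using old by (simp add: tree_inv_def)
  moreover have "g' j \<in> G" if "j \<le> Suc i" for j using that gG kG by (cases "j = Suc i") (simp_all add: g'i g')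
  ultimately have "tree_inv G B T (Suc i) \<alpha>' g'" unfolding tree_inv_def by blast
  then show ?thesis unfolding \<alpha>'_def g'_def by blast
qed

text \<open>The set T limits the demand for distinct labels. When orbits are finite, only finitely
  many labels are possible on a level, so the nodes of the full tree could not all be told
  apart.\<close>

lemma tree_exists:
  fixes G :: "('a \<Rightarrow> 'a) set"
  assumes G: "pgroup G" "fclosed G" and B: "reservoir G B"
    and big: "\<forall>m a F i. B m a F \<longrightarrow> finite F \<longrightarrow> i \<in> T \<longrightarrow> depth i = Suc m \<longrightarrow>
                \<not> (finite (orb G F a) \<and> card (orb G F a) \<le> i)"
  obtains \<alpha> \<beta> :: "nat \<Rightarrow> 'a"
  where "inj_on \<beta> (T - {0})"
    "\<And>\<pi>. \<pi> 0 = 0 \<Longrightarrow> (\<And>r. \<pi> (Suc r) \<noteq> 0 \<and> parent (\<pi> (Suc r)) = \<pi> r) \<Longrightarrow> \<exists>g\<in>G. \<forall>n. g (\<alpha> n) = \<beta> (\<pi> (Suc n))"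
proof -
  define P where "P i p = tree_inv G B T i (fst p) (snd p)" for i and p :: "(nat \<Rightarrow> 'a) \<times> (nat \<Rightarrow> 'a \<Rightarrow> 'a)"
  define Q where "Q i p q \<longleftrightarrow> (\<forall>j\<le>i. fst q j = fst p j \<and> snd q j = snd p j)"
    for i :: nat and p q :: "(nat \<Rightarrow> 'a) \<times> (nat \<Rightarrow> 'a \<Rightarrow> 'a)"
  have "\<exists>f. \<forall>i. P i (f i) \<and> Q i (f i) (f (Suc i))"
  proof (rule dependent_nat_choice)
    obtain a where "B 0 a {}" using reservoir_ex[OF B, of "{}"] by auto
    then have "P 0 (\<lambda>_. a, \<lambda>_. id)"
      using G by (simp add: P_def tree_inv_def frozen_back_def frozen_def pgroup_id)
    then show "\<exists>p. P 0 p" by blast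
  next
    fix p i assume "P i p"
    then have "tree_inv G B T i (fst p) (snd p)" by (simp add: P_def)
    from tree_inv_step[OF G(1) B big this]
    obtain a k where "tree_inv G B T (Suc i) ((fst p)(Suc i := a)) ((snd p)(Suc i := k))"
      by (elim exE)
    then show "\<exists>q. P (Suc i) q \<and> Q i p q"
      by (intro exI[of _ "((fst p)(Suc i := a), (snd p)(Suc i := k))"]) (simp add: P_def Q_def)
  qed
  then obtain f where f: "\<And>i. P i (f i)" "\<And>i. Q i (f i) (f (Suc i))" by blast
  define \<alpha> g where "\<alpha> n = fst (f n) n" and "g n = snd (f n) n" for n
  have stable: "fst (f i) j = \<alpha> j \<and> snd (f i) j = g j" if "j \<le> i" for i j
    using that
  proof (induction i rule: dec_induct)
    case (step i) then show ?case using f(2)[of i] by (simp add: Q_def)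
  qed (simp add: \<alpha>_def g_def)
  have inv: "tree_inv G B T i \<alpha> g" for i
    by (rule tree_inv_cong[of _ _ _ _ "fst (f i)" "snd (f i)"]) (use f(1) stable in \<open>auto simp: P_def\<close>)
  define \<beta> where "\<beta> j = g j (\<alpha> (depth (parent j)))" for j
  have neq: "\<beta> j \<noteq> \<beta> j'" if "j' < j" "j' \<noteq> 0" "j \<in> T" for j j'
    using inv[of j] that by (simp add: tree_inv_def \<beta>_def)
  have inj: "inj_on \<beta> (T - {0})"
  proof (rule inj_onI)
    show "x = y" if "x \<in> T - {0}" "y \<in> T - {0}" "\<beta> x = \<beta> y" for x y
      using that neq[of x y] neq[of y x] by (cases x y rule: linorder_cases) auto
  qed
  have path: "\<exists>k\<in>G. \<forall>n. k (\<alpha> n) = \<beta> (\<pi> (Suc n))"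
    if \<pi>: "\<pi> 0 = 0" "\<And>r. \<pi> (Suc r) \<noteq> 0 \<and> parent (\<pi> (Suc r)) = \<pi> r" for \<pi>
  proof -
    have depth: "depth (\<pi> r) = r" for r
      using \<pi> by (induction r) (simp_all add: depth_parent)
    define s where "s r = g (\<pi> r)" for r
    have sG: "s r \<in> G" for r using inv[of "\<pi> r"] by (simp add: tree_inv_def s_def)
    have "\<exists>h. h \<in> stab G (frozen_back (s r) r \<union> frozen \<alpha> r) \<and> s (Suc r) = s r \<circ> h" for r
    proof -
      have "\<exists>h\<in>stab G (frozen_back (g (parent (\<pi> (Suc r)))) (depth (parent (\<pi> (Suc r)))) \<union> frozen \<alpha> (depth (parent (\<pi> (Suc r))))).
          g (\<pi> (Suc r)) = g (parent (\<pi> (Suc r))) \<circ> h"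
        using inv[of "\<pi> (Suc r)"] \<pi>(2)[of r] unfolding tree_inv_def by blast
      then show ?thesis using \<pi>(2)[of r] depth[of r] by (auto simp: s_def)
    qed
    then obtain h where h: "\<And>r. h r \<in> stab G (frozen_back (s r) r \<union> frozen \<alpha> r)" "\<And>r. s (Suc r) = s r \<circ> h r"
      by metis
    have fixF: "s (Suc r) x = s r x" if "x \<in> frozen_back (s r) r \<union> frozen \<alpha> r" for r x
      using stab_fix[OF h(1) that] by (simp add: h(2))
    obtain k where k: "k \<in> G" "\<And>x n. (\<And>m. m \<ge> n \<Longrightarrow> s (Suc m) x = s m x) \<Longrightarrow> k x = s n x"
    proof (rule limit_in_closed[OF G sG])
      show "s (Suc n) (en l) = s n (en l)" if "l < n" for n l
        by (rule fixF) (use that in \<open>simp add: frozen_I\<close>)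
      show "inv (s (Suc n)) (en l) = inv (s n) (en l)" if "l < n" for n l
      proof -
        have "s (Suc n) (inv (s n) (en l)) = s n (inv (s n) (en l))"
          by (rule fixF) (use that in \<open>auto simp: frozen_back_def\<close>)
        also have "\<dots> = en l" using sG G(1) by simp
        finally show ?thesis using sG[of "Suc n"] G(1) by (metis pgroup_inv_left)
      qed
    qed blast
    have "k (\<alpha> n) = \<beta> (\<pi> (Suc n))" for n
    proof -
      have "k (\<alpha> n) = s (Suc n) (\<alpha> n)"
      proof (rule k(2))
        show "s (Suc m) (\<alpha> n) = s m (\<alpha> n)" if "m \<ge> Suc n" for m
          by (rule fixF) (use that in \<open>simp add: frozen_I\<close>)
      qed
      then show ?thesis using \<pi>(2)[of n] depth[of n] by (simp add: \<beta>_def s_def)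
    qed
    then show ?thesis using k(1) by blast
  qed
  show thesis by (rule that[OF inj path])
qed

end

subsection \<open>Permutations of the natural numbers with invariant initial segments\<close>

definition cut :: "(nat \<Rightarrow> nat) \<Rightarrow> nat \<Rightarrow> bool" where
  "cut \<phi> m \<longleftrightarrow> (\<forall>x. \<phi> x < m \<longleftrightarrow> x < m)"

text \<open>Equivalently, \<phi> permutes each interval of some division of the naturals into finite
  intervals.\<close>

definition cutting :: "(nat \<Rightarrow> nat) \<Rightarrow> bool" where
  "cutting \<phi> \<longleftrightarrow> bij \<phi> \<and> (\<forall>n. \<exists>m>n. cut \<phi> m)"

definition nextcut :: "(nat \<Rightarrow> nat) \<Rightarrow> nat \<Rightarrow> nat" where
  "nextcut \<phi> n = (LEAST m. n < m \<and> cut \<phi> m)"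

lemma cutI:
  assumes "inj \<phi>" "\<And>x. x < m \<Longrightarrow> \<phi> x < m" shows "cut \<phi> m"
proof -
  have "\<phi> ` {..<m} = {..<m}"
    by (rule endo_inj_surj) (use assms in \<open>auto intro: inj_on_subset\<close>)
  then have "x < m" if "\<phi> x < m" for x
    using that assms(1) by (metis imageE inj_eq lessThan_iff)
  then show ?thesis using assms(2) unfolding cut_def by blast
qed

lemma nextcut:
  assumes "cutting \<phi>" shows "n < nextcut \<phi> n" "cut \<phi> (nextcut \<phi> n)"
  using LeastI_ex[of "\<lambda>m. n < m \<and> cut \<phi> m"] assms by (auto simp: nextcut_def cutting_def)

lemma nextcut_le: "n < m \<Longrightarrow> cut \<phi> m \<Longrightarrow> nextcut \<phi> n \<le> m"
  unfolding nextcut_def by (rule Least_le) simp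

lemma cut_inv: "bij \<phi> \<Longrightarrow> cut (inv \<phi>) m \<longleftrightarrow> cut \<phi> m"
  unfolding cut_def by (metis inv_bij_left inv_bij_right)

lemma cutting_inv: "cutting \<phi> \<Longrightarrow> cutting (inv \<phi>)"
  by (simp add: cutting_def cut_inv bij_imp_bij_inv)

text \<open>
  The code at \<open>n\<close> determines \<open>\<phi>\<close> up to the next cut after \<open>n\<close>; hence it determines \<open>\<phi> n\<close> and the
  codes of \<open>inv \<phi>\<close> up to \<open>\<phi> n\<close>. Without the cut this would be circular.
\<close>

definition segment_code :: "(nat \<Rightarrow> nat) \<Rightarrow> nat \<Rightarrow> nat" where
  "segment_code \<phi> n = list_encode (map \<phi> [0..<nextcut \<phi> n])"

fun code_path :: "(nat \<Rightarrow> nat) \<Rightarrow> nat \<Rightarrow> nat" where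
  "code_path \<phi> 0 = 0"
| "code_path \<phi> (Suc n) = child (code_path \<phi> n) (segment_code \<phi> n)"

lemma depth_code_path [simp]: "depth (code_path \<phi> n) = n"
  by (induction n) simp_all

lemma segment_code_eqD:
  assumes "segment_code \<phi> n = segment_code \<psi> n"
  shows "nextcut \<phi> n = nextcut \<psi> n" "\<And>x. x < nextcut \<phi> n \<Longrightarrow> \<phi> x = \<psi> x"
proof -
  have eq: "map \<phi> [0..<nextcut \<phi> n] = map \<psi> [0..<nextcut \<psi> n]"
    using assms injD[OF inj_list_encode] unfolding segment_code_def by blast
  show 1: "nextcut \<phi> n = nextcut \<psi> n" using arg_cong[OF eq, of length] by simp
  show "\<phi> x = \<psi> x" if "x < nextcut \<phi> n" for x using eq that unfolding 1[symmetric] by simp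
qed

text \<open>Below a common cut e the inverses agree too and have the same cuts, and their codes at n
  < e record segments that end no later than e.\<close>

lemma code_path_inv_cong:
  assumes \<phi>: "cutting \<phi>" and \<psi>: "cutting \<psi>" and e: "cut \<phi> e" "cut \<psi> e"
    and eq: "\<And>x. x < e \<Longrightarrow> \<phi> x = \<psi> x"
  shows "n \<le> e \<Longrightarrow> code_path (inv \<phi>) n = code_path (inv \<psi>) n"
proof (induction n)
  case (Suc n)
  have b: "bij \<phi>" "bij \<psi>" using \<phi> \<psi> by (simp_all add: cutting_def)
  have inv_eq: "inv \<phi> y = inv \<psi> y" if "y < e" for y
  proof -
    have "inv \<phi> y < e" using e(1) b that by (metis cut_def inv_bij_right)
    then have "\<psi> (inv \<phi> y) = y" using eq b by (metis inv_bij_right)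
    then show ?thesis using b by (metis inv_bij_left)
  qed
  have cuts: "cut \<phi> m \<longleftrightarrow> cut \<psi> m" if "m \<le> e" for m
  proof -
    have "(\<forall>x<m. \<phi> x < m) \<longleftrightarrow> (\<forall>x<m. \<psi> x < m)" using eq that by (metis less_le_trans)
    moreover have "cut \<chi> m \<longleftrightarrow> (\<forall>x<m. \<chi> x < m)" if "bij \<chi>" for \<chi>
      using cutI[of \<chi> m] that by (auto simp: cut_def bij_is_inj)
    ultimately show ?thesis using b by simp
  qed
  have ci: "cutting (inv \<phi>)" "cutting (inv \<psi>)" using \<phi> \<psi> cutting_inv by auto
  have ce: "cut (inv \<phi>) e" "cut (inv \<psi>) e" using e b by (simp_all add: cut_inv)
  have n: "n < e" using Suc.prems by simp
  have le: "nextcut (inv \<phi>) n \<le> e" "nextcut (inv \<psi>) n \<le> e"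
    using nextcut_le[OF n ce(1)] nextcut_le[OF n ce(2)] by auto
  have "nextcut (inv \<phi>) n = nextcut (inv \<psi>) n"
  proof (rule antisym)
    have "cut (inv \<phi>) (nextcut (inv \<psi>) n)"
      using nextcut(2)[OF ci(2), of n] cuts[OF le(2)] b by (simp add: cut_inv)
    then show "nextcut (inv \<phi>) n \<le> nextcut (inv \<psi>) n"
      by (rule nextcut_le[OF nextcut(1)[OF ci(2)]])
    have "cut (inv \<psi>) (nextcut (inv \<phi>) n)"
      using nextcut(2)[OF ci(1), of n] cuts[OF le(1)] b by (simp add: cut_inv)
    then show "nextcut (inv \<psi>) n \<le> nextcut (inv \<phi>) n"
      by (rule nextcut_le[OF nextcut(1)[OF ci(1)]])
  qed
  then have "segment_code (inv \<phi>) n = segment_code (inv \<psi>) n"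
    using inv_eq le unfolding segment_code_def by (auto intro!: arg_cong[of _ _ list_encode] map_cong)
  then show ?case using Suc by simp
qed simp

lemma swap_exists:
  assumes "finite A" "finite A'" "card A = card A'" "A \<inter> A' = {}"
  shows "\<exists>\<sigma>. (\<forall>x. \<sigma> (\<sigma> x) = x) \<and> (\<forall>x\<in>A. \<sigma> x \<in> A') \<and> (\<forall>x\<in>A'. \<sigma> x \<in> A) \<and> (\<forall>x. x \<notin> A \<union> A' \<longrightarrow> \<sigma> x = x)"
proof -
  obtain s where s: "bij_betw s A A'" using finite_same_card_bij assms by blast
  define \<sigma> where "\<sigma> x = (if x \<in> A then s x else if x \<in> A' then inv_into A s x else x)" for x
  have 1: "s x \<in> A'" "inv_into A s (s x) = x" if "x \<in> A" for x
    using s that by (auto simp: bij_betw_def)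
  have 2: "inv_into A s x \<in> A" "s (inv_into A s x) = x" if "x \<in> A'" for x
    using s that by (auto simp: bij_betw_def inv_into_into f_inv_into_f)
  have \<sigma>A: "\<sigma> x = s x" if "x \<in> A" for x using that by (simp add: \<sigma>_def)
  have \<sigma>A': "\<sigma> x = inv_into A s x" if "x \<in> A'" for x using that assms(4) by (auto simp: \<sigma>_def)
  have \<sigma>0: "\<sigma> x = x" if "x \<notin> A \<union> A'" for x using that by (simp add: \<sigma>_def)
  have "\<sigma> (\<sigma> x) = x" for x
  proof -
    consider "x \<in> A" | "x \<in> A'" | "x \<notin> A \<union> A'" by blast
    then show ?thesis
      by cases (simp_all add: \<sigma>A \<sigma>A' \<sigma>0 1 2 del: Un_iff)
  qed
  then show ?thesis using \<sigma>A \<sigma>A' \<sigma>0 1(1) 2(1) by (intro exI[of _ \<sigma>]) auto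
qed

text \<open>
  Along a fast growing sequence \<open>N\<close>, the points that cross an odd-numbered \<open>N r\<close> in either direction
  are equinumerous and lie between its neighbours. Swapping them gives cuts at the even \<open>N r\<close>,
  and undoing the swap leaves cuts at the odd ones.
\<close>

lemma bij_eq_comp_cutting:
  fixes \<phi> :: "nat \<Rightarrow> nat"
  assumes \<phi>: "bij \<phi>"
  obtains \<phi>1 \<phi>2 where "cutting \<phi>1" "cutting \<phi>2" "\<phi> = \<phi>2 \<circ> \<phi>1"
proof -
  \<comment> \<open>Each term exceeds all images and preimages of the numbers up to the previous
    term, so neither \<phi> nor its inverse can jump over a whole gap.\<close>
  define N where "N = rec_nat 0 (\<lambda>_ n. Suc (Max (insert n (\<phi> ` {..n} \<union> inv \<phi> ` {..n}))))"
  have N0: "N 0 = 0" by (simp add: N_def)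
  have NS: "N (Suc r) = Suc (Max (insert (N r) (\<phi> ` {..N r} \<union> inv \<phi> ` {..N r})))" for r
    by (simp add: N_def)
  have N_less: "N r < N (Suc r)" for r by (simp add: NS less_Suc_eq_le)
  have N_fwd: "\<phi> x < N (Suc r)" "inv \<phi> x < N (Suc r)" if "x < N r" for x r
    unfolding NS less_Suc_eq_le by (rule Max_ge; use that in auto)+
  have smN: "strict_mono N" using N_less by (rule strict_mono_Suc_iff[THEN iffD2, rule_format])
  define M where "M r = N (Suc (2 * r))" for r
  define A A' where "A r = {x. x < M r \<and> M r \<le> \<phi> x}" and "A' r = {x. M r \<le> x \<and> \<phi> x < M r}" for r
  have "\<exists>\<sigma>. (\<forall>x. \<sigma> (\<sigma> x) = x) \<and> (\<forall>x\<in>A r. \<sigma> x \<in> A' r) \<and> (\<forall>x\<in>A' r. \<sigma> x \<in> A r)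
     \<and> (\<forall>x. x \<notin> A r \<union> A' r \<longrightarrow> \<sigma> x = x)" for r
  proof (rule swap_exists)
    \<comment> \<open>The segment below \<open>M r\<close> and its preimage have the same size and
      share \<open>?K\<close>, so their remainders \<open>A r\<close> and \<open>A' r\<close> are
      equinumerous.\<close>
    let ?K = "{x. x < M r \<and> \<phi> x < M r}"
    have pre: "{x. \<phi> x < M r} = inv \<phi> ` {..<M r}"
      using \<phi> by (auto simp: image_iff intro!: bexI[of _ "\<phi> _"])
    have fin: "finite {x. \<phi> x < M r}" by (simp add: pre)
    show "finite (A r)" by (simp add: A_def)
    show "finite (A' r)" by (rule finite_subset[OF _ fin]) (auto simp: A'_def)
    have "card {..<M r} = card (?K \<union> A r)" by (rule arg_cong[of _ _ card]) (auto simp: A_def)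
    also have "\<dots> = card ?K + card (A r)" by (rule card_Un_disjoint) (auto simp: A_def)
    finally have 1: "M r = card ?K + card (A r)" by simp
    have "card {x. \<phi> x < M r} = card (?K \<union> A' r)" by (rule arg_cong[of _ _ card]) (auto simp: A'_def)
    also have "\<dots> = card ?K + card (A' r)"
      by (rule card_Un_disjoint) (use \<open>finite (A' r)\<close> in \<open>auto simp: A'_def\<close>)
    finally have 2: "card {x. \<phi> x < M r} = card ?K + card (A' r)" .
    have "inj (inv \<phi>)" using \<phi> by (simp add: bij_imp_bij_inv bij_is_inj)
    then have "card {x. \<phi> x < M r} = M r" unfolding pre by (simp add: card_image inj_on_subset)
    then show "card (A r) = card (A' r)" using 1 2 by simp
    show "A r \<inter> A' r = {}" by (auto simp: A_def A'_def)
  qed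
  then obtain \<sigma> where \<sigma>: "\<And>r x. \<sigma> r (\<sigma> r x) = x" "\<And>r x. x \<in> A r \<Longrightarrow> \<sigma> r x \<in> A' r"
    "\<And>r x. x \<in> A' r \<Longrightarrow> \<sigma> r x \<in> A r" "\<And>r x. x \<notin> A r \<union> A' r \<Longrightarrow> \<sigma> r x = x" by metis
  have block: "N (2 * r) \<le> x \<and> x < N (Suc (Suc (2 * r)))" if "x \<in> A r \<union> A' r" for r x
  proof -
    have "x \<in> A r \<or> x \<in> A' r" using that by blast
    then show ?thesis
    proof
      assume "x \<in> A r"
      then have "x < N (Suc (2 * r))" "N (Suc (2 * r)) \<le> \<phi> x" by (auto simp: A_def M_def)
      then show ?thesis using N_fwd(1)[of x "2 * r"] N_less[of "Suc (2 * r)"] by (meson leI leD less_trans)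
    next
      assume "x \<in> A' r"
      then have "N (Suc (2 * r)) \<le> x" "\<phi> x < N (Suc (2 * r))" by (auto simp: A'_def M_def)
      then show ?thesis using N_fwd(2)[of "\<phi> x" "Suc (2 * r)"] N_less[of "2 * r"] \<phi> by simp
    qed
  qed
  \<comment> \<open>The number of the block between consecutive even terms that contains x. The swap
    at \<open>M r\<close> stays inside block r, so all swaps combine into one involution.\<close>
  define b where "b x = (LEAST r. x < N (Suc (Suc (2 * r))))" for x
  have N_ge: "r \<le> N r" for r using smN by (rule strict_mono_imp_increasing)
  have b1: "x < N (Suc (Suc (2 * b x)))" for x
    unfolding b_def by (rule LeastI[of _ x]) (use N_ge[of "Suc (Suc (2 * x))"] in simp)
  have b2: "N (2 * b x) \<le> x" for x
  proof (cases "b x")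
    case (Suc r)
    then have "\<not> x < N (Suc (Suc (2 * r)))" using not_less_Least[of r "\<lambda>r. x < N (Suc (Suc (2 * r)))"] unfolding b_def by linarith
    then show ?thesis using Suc by simp
  qed (simp add: N0)
  have Nmono: "N i \<le> N j" if "i \<le> j" for i j using smN that by (simp add: strict_mono_less_eq)
  have b_iff: "b x = r \<longleftrightarrow> N (2 * r) \<le> x \<and> x < N (Suc (Suc (2 * r)))" for x r
  proof
    show "b x = r \<Longrightarrow> N (2 * r) \<le> x \<and> x < N (Suc (Suc (2 * r)))" using b1 b2 by blast
    assume *: "N (2 * r) \<le> x \<and> x < N (Suc (Suc (2 * r)))"
    show "b x = r"
    proof (rule ccontr)
      assume "b x \<noteq> r"
      then have "b x < r \<or> r < b x" by auto
      then show False
      proof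
        assume "b x < r"
        then have "N (Suc (Suc (2 * b x))) \<le> N (2 * r)" by (intro Nmono) simp
        then show False using * b1[of x] by simp
      next
        assume "r < b x"
        then have "N (Suc (Suc (2 * r))) \<le> N (2 * b x)" by (intro Nmono) simp
        then show False using * b2[of x] by simp
      qed
    qed
  qed
  have b_less: "x < N (2 * r) \<longleftrightarrow> b x < r" for x r
  proof
    assume "x < N (2 * r)"
    then have "N (2 * b x) < N (2 * r)" using b2[of x] by simp
    then show "b x < r" using smN by (simp add: strict_mono_less)
  next
    assume "b x < r"
    then have "N (Suc (Suc (2 * b x))) \<le> N (2 * r)" by (intro Nmono) simp
    then show "x < N (2 * r)" using b1[of x] by simp
  qed
  define \<phi>1 where "\<phi>1 x = \<sigma> (b x) x" for x
  have b_\<phi>1: "b (\<phi>1 x) = b x" for x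
  proof (cases "x \<in> A (b x) \<union> A' (b x)")
    case True
    then have "\<phi>1 x \<in> A (b x) \<union> A' (b x)" using \<sigma>(2,3) by (auto simp: \<phi>1_def)
    then show ?thesis using block b_iff by blast
  next
    case False then show ?thesis using \<sigma>(4) by (simp add: \<phi>1_def)
  qed
  have invol: "\<phi>1 (\<phi>1 x) = x" for x
    unfolding \<phi>1_def[of "\<phi>1 x"] b_\<phi>1 unfolding \<phi>1_def by (rule \<sigma>(1))
  then have bij1: "bij \<phi>1" by (metis bijI')
  have "cut \<phi>1 (N (2 * r))" for r unfolding cut_def b_less b_\<phi>1 by simp
  moreover have "n < N (2 * Suc n)" for n using N_ge[of "2 * Suc n"] by simp
  ultimately have c1: "cutting \<phi>1" unfolding cutting_def using bij1 by blast
  define \<phi>2 where "\<phi>2 = \<phi> \<circ> \<phi>1"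
  have bij2: "bij \<phi>2" using \<phi> bij1 by (simp add: \<phi>2_def bij_comp)
  \<comment> \<open>Points of lower blocks stay below \<open>M r\<close> by the growth of N; in
    block r the swap has exchanged exactly the points that \<phi> carries across
    \<open>M r\<close>.\<close>
  have "cut \<phi>2 (M r)" for r
  proof (rule cutI)
    show "inj \<phi>2" using bij2 by (rule bij_is_inj)
    fix x assume x: "x < M r"
    have "x < N (2 * Suc r)" using x N_less[of "Suc (2 * r)"] by (simp add: M_def)
    then have "b x < r \<or> b x = r" using b_less[of x "Suc r"] by auto
    then show "\<phi>2 x < M r"
    proof
      assume "b x < r"
      then have "\<phi>1 x < N (2 * r)" by (simp add: b_less b_\<phi>1)
      then show ?thesis using N_fwd(1) by (simp add: \<phi>2_def M_def)
    next
      assume br: "b x = r"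
      show ?thesis
      proof (cases "x \<in> A r")
        case True
        then have "\<phi>1 x \<in> A' r" using \<sigma>(2) br by (simp add: \<phi>1_def)
        then show ?thesis by (simp add: \<phi>2_def A'_def)
      next
        case False
        then have "x \<notin> A r \<union> A' r" "\<phi> x < M r" using x by (auto simp: A_def A'_def)
        then show ?thesis using \<sigma>(4) br by (simp add: \<phi>2_def \<phi>1_def)
      qed
    qed
  qed
  moreover have "n < M n" for n using N_ge[of "Suc (2 * n)"] by (simp add: M_def)
  ultimately have c2: "cutting \<phi>2" unfolding cutting_def using bij2 by blast
  have "\<phi> = \<phi>2 \<circ> \<phi>1" by (simp add: \<phi>2_def fun_eq_iff invol)
  then show thesis using that c1 c2 by blast
qed

subsection \<open>Transporting permutations\<close>

text \<open>With equal images for p and q the partial bijection extends by the identity, so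
  complements need not be compared.\<close>

lemma ex_bij_transport:
  fixes p q :: "'i \<Rightarrow> 'a"
  assumes eq: "\<And>i j. i \<in> I \<Longrightarrow> j \<in> I \<Longrightarrow> p i = p j \<longleftrightarrow> q i = q j" and im: "p ` I = q ` I"
  shows "\<exists>t. bij t \<and> (\<forall>i\<in>I. t (p i) = q i) \<and> (\<forall>y. y \<notin> p ` I \<longrightarrow> t y = y)"
proof -
  define t where "t y = (if y \<in> p ` I then q (inv_into I p y) else y)" for y
  have t: "t (p i) = q i" if "i \<in> I" for i
    using that eq[of i "inv_into I p (p i)"] f_inv_into_f[of "p i" p I] inv_into_into[of "p i" p I]
    by (auto simp: t_def)
  have t': "t y = y" if "y \<notin> p ` I" for y using that by (simp add: t_def)
  have "inj t"
  proof (rule injI)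
    fix x y assume xy: "t x = t y"
    consider "x \<in> p ` I" "y \<in> p ` I" | "x \<in> p ` I" "y \<notin> p ` I" | "x \<notin> p ` I" "y \<in> p ` I"
      | "x \<notin> p ` I" "y \<notin> p ` I" by blast
    then show "x = y"
    proof cases
      case 1
      then obtain i j where "i \<in> I" "x = p i" "j \<in> I" "y = p j" by blast
      then show ?thesis using xy t eq by metis
    next
      case 2
      then obtain i where "i \<in> I" "x = p i" by blast
      then show ?thesis using xy t t'[OF 2(2)] 2(2) im by (metis imageI)
    next
      case 3
      then obtain i where "i \<in> I" "y = p i" by blast
      then show ?thesis using xy t t'[OF 3(1)] 3(1) im by (metis imageI)
    next
      case 4 then show ?thesis using xy t' by simp
    qed
  qed
  moreover have "surj t"
  proof (rule surjI[of t "\<lambda>y. if y \<in> q ` I then p (inv_into I q y) else y"])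
    fix y
    show "t (if y \<in> q ` I then p (inv_into I q y) else y) = y"
    proof (cases "y \<in> q ` I")
      case True
      then show ?thesis using t[OF inv_into_into[OF True]] f_inv_into_f[OF True] by simp
    next
      case False then show ?thesis using t' im by simp
    qed
  qed
  ultimately show ?thesis using t t' unfolding bij_def by blast
qed

lemma conj_in_gen:
  assumes "G \<subseteq> Collect bij" "bij t" "g \<in> G" "h \<in> G"
  shows "inv h \<circ> t \<circ> g \<in> gen (G \<union> {t})"
proof -
  have pg: "pgroup (gen (G \<union> {t}))" by (rule pgroup_gen) (use assms in auto)
  show ?thesis
    by (intro pgroup_comp[OF pg] pgroup_inv[OF pg] gen_incl) (use assms in auto)
qed

context enumeration begin

text \<open>The label of (\<phi>, n) is the image of \<alpha> n under the limit
  \<open>k \<phi>\<close> of the branch coding \<phi>. The permutation t exchanges the labels of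
  (\<phi>, n) and of (\<open>inv \<phi>\<close>, \<phi> n); following \<open>k \<phi>\<close>, then
  t, then the inverse of \<open>k (inv \<phi>)\<close> carries \<alpha> n to \<alpha> (\<phi> n).
  One t serves all \<phi> because a label determines the label it is exchanged with.\<close>

lemma tree_transport:
  fixes G :: "('a \<Rightarrow> 'a) set"
  assumes G: "pgroup G" "fclosed G" and B: "reservoir G B"
    and \<Phi>: "id \<in> \<Phi>" "\<And>\<phi>. \<phi> \<in> \<Phi> \<Longrightarrow> cutting \<phi>" "\<And>\<phi>. \<phi> \<in> \<Phi> \<Longrightarrow> inv \<phi> \<in> \<Phi>"
    and big: "\<And>m a F \<phi>. B m a F \<Longrightarrow> finite F \<Longrightarrow> \<phi> \<in> \<Phi> \<Longrightarrow>
                \<not> (finite (orb G F a) \<and> card (orb G F a) \<le> code_path \<phi> (Suc m))"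
  shows "\<exists>(\<alpha> :: nat \<Rightarrow> 'a) t. inj \<alpha> \<and> bij t \<and> (\<forall>\<phi>\<in>\<Phi>. \<exists>u\<in>gen (G \<union> {t}). \<forall>n. u (\<alpha> n) = \<alpha> (\<phi> n))"
proof -
  define T where "T = {code_path \<phi> (Suc n) |\<phi> n. \<phi> \<in> \<Phi>}"
  have big': "\<forall>m a F i. B m a F \<longrightarrow> finite F \<longrightarrow> i \<in> T \<longrightarrow> depth i = Suc m \<longrightarrow>
                \<not> (finite (orb G F a) \<and> card (orb G F a) \<le> i)"
  proof (intro allI impI)
    fix m a F i assume BF: "B m a F" "finite F" and "i \<in> T" and "depth i = Suc m"
    then obtain \<phi> n where \<phi>: "i = code_path \<phi> (Suc n)" "\<phi> \<in> \<Phi>" by (auto simp: T_def)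
    have "n = m" using \<open>depth i = Suc m\<close> unfolding \<phi>(1) depth_code_path by simp
    then show "\<not> (finite (orb G F a) \<and> card (orb G F a) \<le> i)" using big[OF BF \<phi>(2)] \<phi>(1) by blast
  qed
  obtain \<alpha> \<beta> :: "nat \<Rightarrow> 'a" where inj: "inj_on \<beta> (T - {0})"
    and path: "\<And>\<pi>. \<pi> 0 = 0 \<Longrightarrow> (\<And>r. \<pi> (Suc r) \<noteq> 0 \<and> parent (\<pi> (Suc r)) = \<pi> r) \<Longrightarrow>
                 \<exists>g\<in>G. \<forall>n. g (\<alpha> n) = \<beta> (\<pi> (Suc n))"
    using tree_exists[OF G B big'] by metis
  have "\<exists>g\<in>G. \<forall>n. g (\<alpha> n) = \<beta> (code_path \<phi> (Suc n))" for \<phi>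
    by (rule path) simp_all
  then obtain k where k: "\<And>\<phi>. k \<phi> \<in> G" "\<And>\<phi> n. k \<phi> (\<alpha> n) = \<beta> (code_path \<phi> (Suc n))" by metis
  have \<beta>_eq: "n = m \<and> segment_code \<phi> n = segment_code \<psi> n"
    if "\<beta> (code_path \<phi> (Suc n)) = \<beta> (code_path \<psi> (Suc m))" "\<phi> \<in> \<Phi>" "\<psi> \<in> \<Phi>" for \<phi> \<psi> n m
  proof -
    have "code_path \<phi> (Suc n) = code_path \<psi> (Suc m)"
      by (rule inj_onD[OF inj that(1)]) (use that in \<open>auto simp: T_def child_def simp del: code_path.simps, auto simp: child_def\<close>)
    then have *: "code_path \<phi> n = code_path \<psi> m" "segment_code \<phi> n = segment_code \<psi> m" by simp_all
    from arg_cong[OF *(1), of depth] have "n = m" by simp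
    then show ?thesis using * by simp
  qed
  have inj_\<alpha>: "inj \<alpha>"
  proof (rule injI)
    fix n m assume "\<alpha> n = \<alpha> m"
    then have "\<beta> (code_path id (Suc n)) = \<beta> (code_path id (Suc m))" using k(2)[of id n] k(2)[of id m] by simp
    then show "n = m" using \<beta>_eq \<Phi>(1) by blast
  qed
  define p where "p = (\<lambda>(\<phi>, n). \<beta> (code_path \<phi> (Suc n)))"
  \<comment> \<open>Being an involution on the pairs, it yields equal images for
    \<open>ex_bij_transport\<close> and reduces the required equivalence to one implication.\<close>
  define \<iota> where "\<iota> i = (inv (fst i), fst i (snd i))" for i :: "(nat \<Rightarrow> nat) \<times> nat"
  let ?I = "\<Phi> \<times> (UNIV :: nat set)"
  have \<iota>I: "\<iota> i \<in> ?I" if "i \<in> ?I" for i using that \<Phi>(3) by (auto simp: \<iota>_def)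
  have \<iota>\<iota>: "\<iota> (\<iota> i) = i" if "i \<in> ?I" for i
    using that \<Phi>(2) by (auto simp: cutting_def inv_inv_eq \<iota>_def)
  have imp: "p (\<iota> i) = p (\<iota> j)" if ij: "i \<in> ?I" "j \<in> ?I" "p i = p j" for i j
  proof -
    obtain \<phi> n \<psi> m where i: "i = (\<phi>, n)" "j = (\<psi>, m)" by force
    have in\<Phi>: "\<phi> \<in> \<Phi>" "\<psi> \<in> \<Phi>" using ij i by auto
    have nm: "n = m" and kc: "segment_code \<phi> n = segment_code \<psi> n"
      using \<beta>_eq[of \<phi> n \<psi> m] ij(3) in\<Phi> unfolding p_def i by auto
    define e where "e = nextcut \<phi> n"
    have e: "n < e" "cut \<phi> e" "cut \<psi> e" "\<And>x. x < e \<Longrightarrow> \<phi> x = \<psi> x"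
      using nextcut[OF \<Phi>(2)[OF in\<Phi>(1)], of n] nextcut[OF \<Phi>(2)[OF in\<Phi>(2)], of n] segment_code_eqD[OF kc]
      by (simp_all add: e_def)
    have "\<phi> n < e" using e(1,2) by (simp add: cut_def)
    then have "code_path (inv \<phi>) (Suc (\<phi> n)) = code_path (inv \<psi>) (Suc (\<phi> n))"
      by (intro code_path_inv_cong[OF \<Phi>(2)[OF in\<Phi>(1)] \<Phi>(2)[OF in\<Phi>(2)] e(2,3,4)]) auto
    \<comment> \<open>Equal labels force agreement of \<phi> and \<psi> below the cut e > n, so the
      second components \<phi> n and \<psi> n agree as well.\<close>
    then show ?thesis using nm e(1,4) unfolding p_def i \<iota>_def by simp
  qed
  have "\<exists>t. bij t \<and> (\<forall>i\<in>?I. t (p i) = p (\<iota> i)) \<and> (\<forall>y. y \<notin> p ` ?I \<longrightarrow> t y = y)"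
  proof (rule ex_bij_transport)
    show "p i = p j \<longleftrightarrow> p (\<iota> i) = p (\<iota> j)" if ij: "i \<in> ?I" "j \<in> ?I" for i j
      using imp[OF ij] imp[OF \<iota>I[OF ij(1)] \<iota>I[OF ij(2)]] unfolding \<iota>\<iota>[OF ij(1)] \<iota>\<iota>[OF ij(2)] by blast
    show "p ` ?I = (\<lambda>i. p (\<iota> i)) ` ?I"
    proof
      show "(\<lambda>i. p (\<iota> i)) ` ?I \<subseteq> p ` ?I" using \<iota>I by blast
      show "p ` ?I \<subseteq> (\<lambda>i. p (\<iota> i)) ` ?I"
      proof
        fix y assume "y \<in> p ` ?I"
        then obtain i where i: "i \<in> ?I" "y = p i" by blast
        then have "y = p (\<iota> (\<iota> i))" using \<iota>\<iota> by simp
        then show "y \<in> (\<lambda>i. p (\<iota> i)) ` ?I" using \<iota>I[OF i(1)] by (rule image_eqI)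
      qed
    qed
  qed
  then obtain t where t: "bij t" "\<And>i. i \<in> ?I \<Longrightarrow> t (p i) = p (\<iota> i)" by blast
  have "\<exists>u\<in>gen (G \<union> {t}). \<forall>n. u (\<alpha> n) = \<alpha> (\<phi> n)" if "\<phi> \<in> \<Phi>" for \<phi>
  proof (rule bexI)
    show "inv (k (inv \<phi>)) \<circ> t \<circ> k \<phi> \<in> gen (G \<union> {t})"
      by (rule conj_in_gen) (use G t k in \<open>auto simp: pgroup_def\<close>)
    have "t (k \<phi> (\<alpha> n)) = k (inv \<phi>) (\<alpha> (\<phi> n))" for n
      using t(2)[of "(\<phi>, n)"] that unfolding p_def \<iota>_def k(2) by simp
    then show "\<forall>n. (inv (k (inv \<phi>)) \<circ> t \<circ> k \<phi>) (\<alpha> n) = \<alpha> (\<phi> n)"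
      using G k(1)[of "inv \<phi>"] by simp
  qed
  then show ?thesis using inj_\<alpha> t(1) by blast
qed

text \<open>Infinite orbits exceed every node number, so all cutting permutations can be coded at
  once, and two of them compose to any permutation.\<close>

lemma inf_orbs_transport:
  fixes G :: "('a \<Rightarrow> 'a) set"
  assumes G: "pgroup G" "fclosed G" and inf: "inf_orbs G"
  shows "\<exists>(\<alpha> :: nat \<Rightarrow> 'a) t. inj \<alpha> \<and> bij t \<and> (\<forall>\<phi>. bij \<phi> \<longrightarrow> (\<exists>u\<in>gen (G \<union> {t}). \<forall>n. u (\<alpha> n) = \<alpha> (\<phi> n)))"
proof -
  obtain \<Gamma> B where \<Gamma>: "finite \<Gamma>" "reservoir (stab G \<Gamma>) B"
    and B: "\<And>m a F. B m a F \<Longrightarrow> finite F \<Longrightarrow> infinite (orb (stab G \<Gamma>) F a)"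
    using inf_orbs_reservoir[OF G(1) inf] by metis
  have "\<exists>(\<alpha> :: nat \<Rightarrow> 'a) t. inj \<alpha> \<and> bij t \<and>
      (\<forall>\<phi>\<in>Collect cutting. \<exists>u\<in>gen (stab G \<Gamma> \<union> {t}). \<forall>n. u (\<alpha> n) = \<alpha> (\<phi> n))"
  proof (rule tree_transport[OF pgroup_stab[OF G(1)] fclosed_stab[OF G(2)] \<Gamma>(2)])
    show "id \<in> Collect cutting" by (auto simp: cutting_def cut_def)
  qed (use B cutting_inv in auto)
  then obtain \<alpha> :: "nat \<Rightarrow> 'a" and t where \<alpha>: "inj \<alpha>" "bij t"
    and u: "\<And>\<phi>. cutting \<phi> \<Longrightarrow> \<exists>u\<in>gen (stab G \<Gamma> \<union> {t}). \<forall>n. u (\<alpha> n) = \<alpha> (\<phi> n)" by blast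
  have pg: "pgroup (gen (G \<union> {t}))" by (rule pgroup_gen) (use G \<alpha> in \<open>auto simp: pgroup_def\<close>)
  have sub: "gen (stab G \<Gamma> \<union> {t}) \<subseteq> gen (G \<union> {t})" by (rule gen_mono) (use stab_subset in blast)
  have "\<exists>u\<in>gen (G \<union> {t}). \<forall>n. u (\<alpha> n) = \<alpha> (\<phi> n)" if \<phi>: "bij \<phi>" for \<phi>
  proof -
    obtain \<phi>1 \<phi>2 where c: "cutting \<phi>1" "cutting \<phi>2" "\<phi> = \<phi>2 \<circ> \<phi>1" by (rule bij_eq_comp_cutting[OF \<phi>])
    obtain u1 u2 where u1: "u1 \<in> gen (G \<union> {t})" "\<And>n. u1 (\<alpha> n) = \<alpha> (\<phi>1 n)"
      and u2: "u2 \<in> gen (G \<union> {t})" "\<And>n. u2 (\<alpha> n) = \<alpha> (\<phi>2 n)"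
      using u[OF c(1)] u[OF c(2)] sub by blast
    show ?thesis
      by (rule bexI[of _ "u2 \<circ> u1"]) (use u1 u2 c(3) pgroup_comp[OF pg] in auto)
  qed
  then show ?thesis using \<alpha> by blast
qed

text \<open>Common cuts in C bound the length and the entries of the coded segments, so each level
  carries finitely many codes. Their maximum on a level is the orbit size that the reservoir has to
  guarantee there.\<close>

lemma big_orbs_transport:
  fixes G :: "('a \<Rightarrow> 'a) set"
  assumes G: "pgroup G" "fclosed G" and fin: "\<And>a. finite (orb G {} a)" and big: "\<And>n. big_orbs G n"
    and C: "\<And>n. \<exists>m>n. m \<in> C"
  shows "\<exists>(\<alpha> :: nat \<Rightarrow> 'a) t. inj \<alpha> \<and> bij t \<and>
    (\<forall>\<phi>. bij \<phi> \<longrightarrow> (\<forall>m\<in>C. cut \<phi> m) \<longrightarrow> (\<exists>u\<in>gen (G \<union> {t}). \<forall>n. u (\<alpha> n) = \<alpha> (\<phi> n)))"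
proof -
  define \<Phi> where "\<Phi> = {\<phi>. bij \<phi> \<and> (\<forall>m\<in>C. cut \<phi> m)}"
  have cutting: "cutting \<phi>" if "\<phi> \<in> \<Phi>" for \<phi> using that C unfolding \<Phi>_def cutting_def by blast
  have finK: "finite ((\<lambda>\<phi>. segment_code \<phi> n) ` \<Phi>)" for n
  proof -
    obtain m where m: "m > n" "m \<in> C" using C by blast
    have "(\<lambda>\<phi>. segment_code \<phi> n) ` \<Phi> \<subseteq> list_encode ` {xs. set xs \<subseteq> {..<m} \<and> length xs \<le> m}"
    proof
      fix y assume "y \<in> (\<lambda>\<phi>. segment_code \<phi> n) ` \<Phi>"
      then obtain \<phi> where \<phi>: "\<phi> \<in> \<Phi>" "y = segment_code \<phi> n" by blast
      have cm: "cut \<phi> m" using \<phi>(1) m by (simp add: \<Phi>_def)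
      have le: "nextcut \<phi> n \<le> m" by (rule nextcut_le[OF m(1) cm])
      have "\<phi> x < m" if "x < nextcut \<phi> n" for x
        using cm le that unfolding cut_def by (meson less_le_trans)
      with le have "map \<phi> [0..<nextcut \<phi> n] \<in> {xs. set xs \<subseteq> {..<m} \<and> length xs \<le> m}"
        by auto
      then show "y \<in> list_encode ` {xs. set xs \<subseteq> {..<m} \<and> length xs \<le> m}"
        unfolding \<phi>(2) segment_code_def by (rule imageI)
    qed
    then show ?thesis by (rule finite_subset) (intro finite_imageI finite_lists_length_le finite_lessThan)
  qed
  have finT: "finite ((\<lambda>\<phi>. code_path \<phi> n) ` \<Phi>)" for n
  proof (induction n)
    case (Suc n)
    have "(\<lambda>\<phi>. code_path \<phi> (Suc n)) ` \<Phi> \<subseteq> (\<lambda>(p, k). child p k) ` ((\<lambda>\<phi>. code_path \<phi> n) ` \<Phi> \<times> (\<lambda>\<phi>. segment_code \<phi> n) ` \<Phi>)"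
      by auto
    then show ?case by (rule finite_subset) (intro finite_imageI finite_cartesian_product Suc finK)
  qed (auto intro: finite_subset[of _ "{0}"])
  define c where "c m = Max ((\<lambda>\<phi>. code_path \<phi> (Suc m)) ` \<Phi>)" for m
  obtain B where B: "reservoir G B" "\<And>m a F. B m a F \<Longrightarrow> finite F \<Longrightarrow> card (orb G F a) > c m"
    using big_orbs_reservoir[OF G(1) fin big, of c] by blast
  have "\<exists>(\<alpha> :: nat \<Rightarrow> 'a) t. inj \<alpha> \<and> bij t \<and> (\<forall>\<phi>\<in>\<Phi>. \<exists>u\<in>gen (G \<union> {t}). \<forall>n. u (\<alpha> n) = \<alpha> (\<phi> n))"
  proof (rule tree_transport[OF G B(1)])
    show "id \<in> \<Phi>" by (auto simp: \<Phi>_def cut_def)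
    show "cutting \<phi>" if "\<phi> \<in> \<Phi>" for \<phi> using cutting[OF that] .
    show "inv \<phi> \<in> \<Phi>" if "\<phi> \<in> \<Phi>" for \<phi> using that by (auto simp: \<Phi>_def cut_inv bij_imp_bij_inv)
    fix m a F \<phi> assume BF: "B m a F" "finite F" and \<phi>: "\<phi> \<in> \<Phi>"
    have "code_path \<phi> (Suc m) \<le> c m" unfolding c_def by (rule Max_ge[OF finT]) (use \<phi> in blast)
    then show "\<not> (finite (orb G F a) \<and> card (orb G F a) \<le> code_path \<phi> (Suc m))" using B(2)[OF BF] by simp
  qed
  then show ?thesis unfolding \<Phi>_def by blast
qed

end

subsection \<open>Copies of permutations\<close>

definition push :: "('i \<Rightarrow> 'a) \<Rightarrow> ('i \<Rightarrow> 'i) \<Rightarrow> 'a \<Rightarrow> 'a" where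
  "push a F y = (if y \<in> range a then a (F (inv a y)) else y)"

lemma push_apply [simp]: "inj a \<Longrightarrow> push a F (a i) = a (F i)"
  by (simp add: push_def)

lemma push_outside: "y \<notin> range a \<Longrightarrow> push a F y = y"
  by (simp add: push_def)

lemma push_comp: "inj a \<Longrightarrow> push a (F \<circ> F') = push a F \<circ> push a F'"
proof (rule ext)
  fix y assume "inj a"
  then show "push a (F \<circ> F') y = (push a F \<circ> push a F') y"
    by (cases "y \<in> range a") (auto simp: push_outside)
qed

lemma push_id: "inj a \<Longrightarrow> push a id = id"
  by (rule ext) (auto simp: push_def)

lemma push_bij:
  assumes "inj a" "bij F" shows "bij (push a F)"
proof (rule o_bij[of "push a (inv F)"])
  show "push a (inv F) \<circ> push a F = id" "push a F \<circ> push a (inv F) = id"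
    using assms by (simp_all add: push_comp[symmetric] push_id inv_bij_comp_left inv_bij_comp_right)
qed

definition half_copy :: "('a \<Rightarrow> 'a) \<Rightarrow> 'a \<times> int \<Rightarrow> 'a \<times> int" where
  "half_copy f p = (if snd p \<ge> 0 then f (fst p) else fst p, snd p)"

lemma bij_half_copy:
  assumes "bij f" shows "bij (half_copy f)"
proof (rule o_bij[of "half_copy (inv f)"])
  show "half_copy (inv f) \<circ> half_copy f = id" "half_copy f \<circ> half_copy (inv f) = id"
    using assms by (auto simp: half_copy_def fun_eq_iff)
qed

text \<open>
  The commutator of the shift along the integer coordinate with a permutation acting as \<open>f\<close> on the
  nonnegative levels is supported on level 0, whatever the permutation does outside the copies.
\<close>

lemma shift_commutator:
  fixes a :: "'a \<times> int \<Rightarrow> 'a"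
  assumes a: "inj a"
  obtains y where "bij y" "\<And>f u. bij f \<Longrightarrow> bij u \<Longrightarrow> (\<And>p. u (a p) = a (half_copy f p)) \<Longrightarrow>
     push (\<lambda>x. a (x, 0)) f = u \<circ> y \<circ> inv u \<circ> inv y"
proof -
  let ?q = "\<lambda>p. a (fst p, snd p + 1)"
  have "\<exists>t. bij t \<and> (\<forall>p\<in>UNIV. t (a p) = ?q p) \<and> (\<forall>y. y \<notin> a ` UNIV \<longrightarrow> t y = y)"
  proof (rule ex_bij_transport)
    show "a i = a j \<longleftrightarrow> ?q i = ?q j" for i j using a by (auto simp: inj_eq prod_eq_iff)
    have "a p = ?q (fst p, snd p - 1)" for p by simp
    then show "range a = range ?q" by (metis (no_types, lifting) rangeI image_subsetI subset_antisym)
  qed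
  then obtain y where y: "bij y" "\<And>x s. y (a (x, s)) = a (x, s + 1)" "\<And>z. z \<notin> range a \<Longrightarrow> y z = z"
    by auto
  have inv_y: "inv y (a (x, s)) = a (x, s - 1)" for x s
    using y(2)[of x "s - 1"] y(1) by (metis diff_add_cancel inv_bij_left)
  have inv_y': "inv y z = z" if "z \<notin> range a" for z using y(1) y(3)[OF that] by (rule inv_fix)
  have \<iota>: "inj (\<lambda>x. a (x, 0))" using a by (auto simp: inj_def)
  have "push (\<lambda>x. a (x, 0)) f = u \<circ> y \<circ> inv u \<circ> inv y"
    if f: "bij f" and u: "bij u" "\<And>p. u (a p) = a (half_copy f p)" for f u
  proof (rule ext)
    fix z
    have inv_u: "inv u (a p) = a (half_copy (inv f) p)" for p
    proof -
      have "u (a (half_copy (inv f) p)) = a p" using f by (simp add: u(2) half_copy_def)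
      then show ?thesis using u(1) by (metis inv_bij_left)
    qed
    show "push (\<lambda>x. a (x, 0)) f z = (u \<circ> y \<circ> inv u \<circ> inv y) z"
    proof (cases "z \<in> range a")
      case True
      then obtain x s where z: "z = a (x, s)" by auto
      have "push (\<lambda>x. a (x, 0)) f z = (if s = 0 then a (f x, 0) else z)"
      proof (cases "s = 0")
        case True then show ?thesis using push_apply[OF \<iota>, of f x] z by simp
      next
        case False
        then have "z \<notin> range (\<lambda>x. a (x, 0))" using a z by (auto simp: inj_eq)
        then show ?thesis using False by (simp add: push_outside)
      qed
      moreover have "(u \<circ> y \<circ> inv u \<circ> inv y) z = (if s = 0 then a (f x, 0) else z)"
        using f by (auto simp: z inv_y inv_u u(2) y(2) half_copy_def)
      ultimately show ?thesis by simp
    next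
      case False
      \<comment> \<open>Off the copies y is the identity, and \<open>inv u\<close> does not lead
        back into them, so u cancels against its inverse.\<close>
      have "inv u z \<notin> range a"
      proof
        assume "inv u z \<in> range a"
        then obtain p where "inv u z = a p" by auto
        then have "z = a (half_copy f p)" using u by (metis inv_bij_right)
        then show False using False by simp
      qed
      moreover have "z \<notin> range (\<lambda>x. a (x, 0))" using False by auto
      ultimately show ?thesis using False u(1) by (simp add: push_outside inv_y' y(3))
    qed
  qed
  then show thesis using that y(1) by blast
qed

definition symm :: "'a set \<Rightarrow> ('a \<Rightarrow> 'a) set" where
  "symm A = {f. bij f \<and> (\<forall>x. x \<notin> A \<longrightarrow> f x = x)}"

text \<open>Both remainders in A are countably infinite, so any bijection between them completes
  j.\<close>

lemma ex_bij_extend: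
  fixes A :: "'a set"
  assumes c: "countable A" and B: "B \<subseteq> A" "inj_on j B" "j ` B \<subseteq> A"
    and inf: "infinite (A - B)" "infinite (A - j ` B)"
  obtains z where "z \<in> symm A" "\<And>x. x \<in> B \<Longrightarrow> z x = j x"
proof -
  let ?X = "A - B" and ?Y = "A - j ` B"
  have "bij_betw (to_nat_on ?X) ?X UNIV" "bij_betw (from_nat_into ?Y) UNIV ?Y"
    using c inf by (auto intro!: to_nat_on_infinite bij_betw_from_nat_into)
  from bij_betw_trans[OF this] obtain k where k: "bij_betw k ?X ?Y" by blast
  define z where "z x = (if x \<in> B then j x else if x \<in> A then k x else x)" for x
  have 1: "bij_betw z B (j ` B)"
    using B(2) by (auto simp: bij_betw_def z_def inj_on_def)
  have "bij_betw z ?X ?Y \<longleftrightarrow> bij_betw k ?X ?Y" by (rule bij_betw_cong) (auto simp: z_def)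
  then have 2: "bij_betw z ?X ?Y" using k by simp
  have "bij_betw z (- A) (- A) \<longleftrightarrow> bij_betw id (- A) (- A)"
    by (rule bij_betw_cong) (use B in \<open>auto simp: z_def\<close>)
  then have 3: "bij_betw z (- A) (- A)" by simp
  have "bij_betw z (B \<union> ?X) (j ` B \<union> ?Y)" by (rule bij_betw_combine[OF 1 2]) auto
  then have "bij_betw z (B \<union> ?X \<union> - A) (j ` B \<union> ?Y \<union> - A)"
    by (rule bij_betw_combine[OF _ 3]) (use B in auto)
  moreover have "B \<union> ?X \<union> - A = UNIV" "j ` B \<union> ?Y \<union> - A = UNIV" using B by auto
  ultimately have "bij z" by simp
  moreover have "z x = x" if "x \<notin> A" for x using that B(1) by (auto simp: z_def)
  moreover have "z x = j x" if "x \<in> B" for x using that by (simp add: z_def)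
  ultimately show thesis using that[of z] by (simp add: symm_def)
qed

lemma infinite_halves:
  assumes "infinite S"
  obtains A B where "A \<inter> B = {}" "infinite A" "infinite B" "S = A \<union> B"
proof -
  obtain A B where AB: "A \<subseteq> S" "B \<subseteq> S" "infinite A" "infinite B" "A \<inter> B = {}"
    by (rule infinite_split[OF assms])
  have "infinite (S - A)"
  proof -
    have "B \<subseteq> S - A" using AB by blast
    then show ?thesis using AB(4) finite_subset by blast
  qed
  then show thesis using AB by (intro that[of A "S - A"]) auto
qed

text \<open>
  Two elements collect \<open>f ` X\<close> in one of the three sets and a third moves it back to \<open>X\<close> pointwise;
  what remains of \<open>f\<close> lies in \<open>symm (Y \<union> Z)\<close>.
\<close>

lemma gen_symm3:
  fixes X Y Z :: "'a set"
  assumes c: "countable (UNIV :: 'a set)" and inf: "infinite X" "infinite Y" "infinite Z"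
    and disj: "X \<inter> Y = {}" "X \<inter> Z = {}" "Y \<inter> Z = {}" and un: "X \<union> Y \<union> Z = UNIV"
  shows "Collect bij \<subseteq> gen (symm (X \<union> Y) \<union> symm (Y \<union> Z) \<union> symm (X \<union> Z))" (is "_ \<subseteq> ?G")
proof
  fix f :: "'a \<Rightarrow> 'a" assume "f \<in> Collect bij"
  then have f: "bij f" by simp
  have cA: "countable A" for A :: "'a set" by (rule countable_subset[OF subset_UNIV c])
  have pg: "pgroup ?G" by (rule pgroup_gen) (auto simp: symm_def)
  let ?S = "{X, Y, Z}"
  have symm_in: "symm (V \<union> V') \<subseteq> ?G" if "V \<in> ?S" "V' \<in> ?S" "V \<noteq> V'" for V V'
    using that by (auto intro!: gen_incl simp: Un_commute)
  have infS: "infinite V" if "V \<in> ?S" for V using that inf by auto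
  have disjS: "V \<inter> V' = {}" if "V \<in> ?S" "V' \<in> ?S" "V \<noteq> V'" for V V' using that disj by auto
  \<comment> \<open>The part of P in V \<union> V' is squeezed into one infinite half of V; the
    other half stays free for the next use. The infinite rest of V outside P makes room for the
    remaining points.\<close>
  have collect: "\<exists>\<tau>\<in>?G. infinite (V - \<tau> ` P) \<and> \<tau> ` P \<inter> V' = {} \<and> (\<forall>x. x \<notin> V \<union> V' \<longrightarrow> \<tau> x = x)"
    if V: "V \<in> ?S" "V' \<in> ?S" "V \<noteq> V'" and P: "infinite (V - P)" for V V' P
  proof -
    let ?A = "V \<union> V'" and ?B = "P \<inter> (V \<union> V')"
    obtain V1 V2 where V12: "V1 \<inter> V2 = {}" "infinite V1" "infinite V2" "V = V1 \<union> V2"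
      by (rule infinite_halves[OF infS[OF V(1)]])
    define j where "j = from_nat_into V1 \<circ> to_nat_on (UNIV :: 'a set)"
    have jV1: "j x \<in> V1" for x using V12(2) by (auto simp: j_def intro!: from_nat_into)
    have "inj_on (from_nat_into V1) UNIV"
      using bij_betw_from_nat_into[OF cA V12(2)] by (simp add: bij_betw_def)
    then have "inj j" unfolding j_def using inj_on_to_nat_on[OF c] by (intro inj_compose) auto
    obtain \<tau> where \<tau>: "\<tau> \<in> symm ?A" "\<And>x. x \<in> ?B \<Longrightarrow> \<tau> x = j x"
    proof (rule ex_bij_extend[OF cA, of ?B ?A j])
      show "inj_on j ?B" using \<open>inj j\<close> inj_on_subset by blast
      show "j ` ?B \<subseteq> ?A" using jV1 V12 by blast
      have "V - P \<subseteq> ?A - ?B" by auto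
      then show "infinite (?A - ?B)" using P finite_subset by blast
      have "V2 \<subseteq> ?A - j ` ?B" using jV1 V12 by blast
      then show "infinite (?A - j ` ?B)" using V12(3) finite_subset by blast
    qed auto
    have out: "\<tau> x = x" if "x \<notin> ?A" for x using \<tau>(1) that by (simp add: symm_def)
    have im: "\<tau> x \<in> V1 \<or> \<tau> x \<notin> ?A" if "x \<in> P" for x
      using \<tau>(2)[of x] out[of x] jV1 that by (cases "x \<in> ?A") auto
    have "V2 \<subseteq> V - \<tau> ` P" using im V12 by blast
    then have "infinite (V - \<tau> ` P)" using V12(3) finite_subset by blast
    moreover have "\<tau> ` P \<inter> V' = {}" using im V12(4) disjS[OF V] by blast
    moreover have "\<tau> \<in> ?G" using \<tau>(1) symm_in[OF V] by blast
    ultimately show ?thesis using out by blast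
  qed
  have "infinite (- f ` X)"
  proof -
    have "f ` Y \<subseteq> - f ` X" using disj(1) bij_is_inj[OF f] by (auto simp: inj_eq)
    moreover have "infinite (f ` Y)" using inf(2) bij_is_inj[OF f] by (metis finite_imageD inj_on_subset subset_UNIV)
    ultimately show ?thesis using finite_subset by blast
  qed
  \<comment> \<open>The infinite complement of the image of X meets one of the three sets infinitely
    often; that set becomes V.\<close>
  moreover have "- f ` X = (X - f ` X) \<union> (Y - f ` X) \<union> (Z - f ` X)" using un by blast
  ultimately have "\<exists>V\<in>?S. infinite (V - f ` X)" by auto
  then obtain V where V: "V \<in> ?S" "infinite (V - f ` X)" by blast
  obtain V' V'' where V': "V' \<in> ?S" "V'' \<in> ?S" "V \<noteq> V'" "V \<noteq> V''" "V' \<noteq> V''"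
  proof -
    have neq: "X \<noteq> Y" "X \<noteq> Z" "Y \<noteq> Z" using inf disj by auto
    consider "V = X" | "V = Y" | "V = Z" using V(1) by blast
    then show thesis
    proof cases
      case 1 then show thesis using that[of Y Z] neq by simp
    next
      case 2 then show thesis using that[of X Z] neq by simp
    next
      case 3 then show thesis using that[of X Y] neq by simp
    qed
  qed
  have VVV: "V \<union> V' \<union> V'' = UNIV" using V(1) V' un by auto
  obtain \<tau>1 where \<tau>1: "\<tau>1 \<in> ?G" "infinite (V - \<tau>1 ` f ` X)" "\<tau>1 ` f ` X \<inter> V' = {}"
    using collect[OF V(1) V'(1,3) V(2)] by blast
  obtain \<tau>2 where \<tau>2: "\<tau>2 \<in> ?G" "infinite (V - \<tau>2 ` \<tau>1 ` f ` X)" "\<tau>2 ` \<tau>1 ` f ` X \<inter> V'' = {}"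
    "\<And>x. x \<notin> V \<union> V'' \<Longrightarrow> \<tau>2 x = x"
    using collect[OF V(1) V'(2,4) \<tau>1(2)] by blast
  define g where "g = \<tau>2 \<circ> \<tau>1 \<circ> f"
  have gX: "g ` X = \<tau>2 ` \<tau>1 ` f ` X" by (auto simp: g_def)
  have bg: "bij g" using f pgroup_bij[OF pg \<tau>1(1)] pgroup_bij[OF pg \<tau>2(1)] unfolding g_def by (intro bij_comp)
  \<comment> \<open>The second collection fixes V' pointwise, so it cannot bring back what the first
    one removed from there.\<close>
  have gV: "g ` X \<subseteq> V"
  proof -
    have "g x \<notin> V'" if "x \<in> X" for x
    proof
      assume "g x \<in> V'"
      then have "g x \<notin> V \<union> V''" using disjS V(1) V' by blast
      moreover have "g x = \<tau>2 (\<tau>1 (f x))" by (simp add: g_def)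
      ultimately have "\<tau>2 (g x) = \<tau>2 (\<tau>1 (f x))" using \<tau>2(4) by metis
      then have "g x = \<tau>1 (f x)" using pgroup_eq_iff[OF pg \<tau>2(1)] by blast
      then show False using \<tau>1(3) \<open>g x \<in> V'\<close> that by auto
    qed
    then have "g ` X \<inter> V' = {}" by blast
    then show ?thesis using \<tau>2(3) VVV unfolding gX by blast
  qed
  have invol: "infinite (V - g ` X)" using \<tau>2(2) gX by simp
  obtain W where W: "W \<in> ?S" "W \<noteq> X" "V \<subseteq> X \<union> W"
  proof (cases "V = X")
    case True
    have "Y \<noteq> X" using inf(1) disj(1) by auto
    then show thesis using that[of Y] True by auto
  next
    case False then show thesis using that[of V] V(1) by auto
  qed
  obtain \<sigma> where \<sigma>: "\<sigma> \<in> symm (X \<union> W)" "\<And>y. y \<in> g ` X \<Longrightarrow> \<sigma> y = inv g y"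
  proof (rule ex_bij_extend[OF cA, of "g ` X" "X \<union> W" "inv g"])
    show "g ` X \<subseteq> X \<union> W" using gV W(3) by blast
    show "inj_on (inv g) (g ` X)" using bg by (intro inj_on_inv_into) (simp add: bij_is_surj image_mono)
    have igX: "inv g ` g ` X = X" using bg by (simp add: image_image)
    show "inv g ` g ` X \<subseteq> X \<union> W" unfolding igX by blast
    have "V - g ` X \<subseteq> X \<union> W - g ` X" using W(3) by blast
    then show "infinite (X \<union> W - g ` X)" using invol finite_subset by blast
    have "X \<union> W - X = W" using disjS[OF _ W(1), of X] W(2) by auto
    then show "infinite (X \<union> W - inv g ` g ` X)" unfolding igX using infS[OF W(1)] by simp
  qed auto
  have \<sigma>G: "\<sigma> \<in> ?G" using symm_in[of X W] W \<sigma>(1) by auto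
  have "\<sigma> \<circ> g \<in> symm (Y \<union> Z)"
  proof -
    have "(\<sigma> \<circ> g) x = x" if "x \<notin> Y \<union> Z" for x
    proof -
      have "x \<in> X" using that un by blast
      then show ?thesis using \<sigma>(2)[of "g x"] bg by simp
    qed
    moreover have "bij (\<sigma> \<circ> g)" using bg \<sigma>(1) by (intro bij_comp) (auto simp: symm_def)
    ultimately show ?thesis by (simp add: symm_def)
  qed
  then have k: "\<sigma> \<circ> g \<in> ?G" by (intro gen_incl) blast
  have "f = inv \<tau>1 \<circ> inv \<tau>2 \<circ> inv \<sigma> \<circ> (\<sigma> \<circ> g)"
    using pg \<sigma>G \<tau>1(1) \<tau>2(1) by (auto simp: fun_eq_iff g_def)
  then show "f \<in> ?G"
    using pgroup_comp[OF pg] pgroup_inv[OF pg] k \<sigma>G \<tau>1(1) \<tau>2(1) by metis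
qed

lemma gen_finite_support:
  assumes "f \<in> gen X" shows "\<exists>F. finite F \<and> F \<subseteq> X \<and> f \<in> gen F"
  using assms
proof (induction rule: generate.induct)
  case one then show ?case by (intro exI[of _ "{}"]) (auto intro: generate.one)
next
  case (incl h) then show ?case by (intro exI[of _ "{h}"]) (auto intro: generate.incl)
next
  case (inv h) then show ?case by (intro exI[of _ "{h}"]) (auto intro: generate.inv)
next
  case (eng h1 h2)
  then obtain F1 F2 where F: "finite F1" "F1 \<subseteq> X" "h1 \<in> gen F1" "finite F2" "F2 \<subseteq> X" "h2 \<in> gen F2"
    by blast
  then have "h1 \<in> gen (F1 \<union> F2)" "h2 \<in> gen (F1 \<union> F2)"
    using gen_mono[of F1 "F1 \<union> F2"] gen_mono[of F2 "F1 \<union> F2"] by auto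
  then show ?case using F by (intro exI[of _ "F1 \<union> F2"]) (auto intro: generate.eng)
qed

text \<open>Conjugating a copy back to the original needs an extension of \<iota> to a permutation,
  which may not exist. For maps supported in a coinfinite M only \<iota> on M matters, and that
  restriction extends.\<close>

lemma below_of_push:
  fixes \<iota> :: "'a \<Rightarrow> 'a"
  assumes c: "countable (UNIV :: 'a set)" and \<iota>: "inj \<iota>" and M: "infinite (- M)"
    and H: "H \<subseteq> symm M" and below: "push \<iota> ` H \<preceq> K" and K: "K \<subseteq> Collect bij"
  shows "H \<preceq> K"
proof -
  obtain z where z: "z \<in> symm UNIV" "\<And>x. x \<in> M \<Longrightarrow> z x = \<iota> x"
  proof (rule ex_bij_extend[OF c, of M \<iota>])
    show "inj_on \<iota> M" using \<iota> inj_on_subset by blast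
    show "infinite (UNIV - M)" using M by (simp add: Compl_eq_Diff_UNIV)
    have "\<iota> ` (- M) \<subseteq> UNIV - \<iota> ` M" using \<iota> by (auto simp: inj_eq)
    moreover have "infinite (\<iota> ` (- M))" using M \<iota> by (metis finite_imageD inj_on_subset subset_UNIV)
    ultimately show "infinite (UNIV - \<iota> ` M)" using finite_subset by blast
  qed auto
  have bz: "bij z" using z(1) by (simp add: symm_def)
  have eq: "f = inv z \<circ> push \<iota> f \<circ> z" if "f \<in> H" for f
  proof -
    have f: "bij f" "\<And>x. x \<notin> M \<Longrightarrow> f x = x" using that H by (auto simp: symm_def)
    have fM: "f x \<in> M" if "x \<in> M" for x
    proof (rule ccontr)
      assume "f x \<notin> M"
      then have "f (f x) = f x" using f(2) by blast
      then have "f x = x" using f(1) by (metis inv_bij_left)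
      then show False using that \<open>f x \<notin> M\<close> by simp
    qed
    have "push \<iota> f (z x) = z (f x)" for x
    proof (cases "x \<in> M")
      case True then show ?thesis using z(2) fM \<iota> by simp
    next
      case False
      have "push \<iota> f (z x) = z x"
      proof (cases "z x \<in> range \<iota>")
        case True
        then obtain w where w: "z x = \<iota> w" by blast
        have "w \<notin> M"
        proof
          assume "w \<in> M"
          then have "z x = z w" using w z(2) by simp
          then have "x = w" using bz by (metis inv_bij_left)
          then show False using False \<open>w \<in> M\<close> by simp
        qed
        then show ?thesis using w \<iota> f(2) by simp
      qed (simp add: push_outside)
      then show ?thesis using f(2)[OF False] by simp
    qed
    then show ?thesis using bz by (auto simp: fun_eq_iff)
  qed
  have pg: "pgroup (gen (push \<iota> ` H \<union> {z}))"
    by (rule pgroup_gen) (use H \<iota> bz in \<open>auto simp: symm_def intro!: push_bij\<close>)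
  have "H \<subseteq> gen (push \<iota> ` H \<union> {z})"
  proof
    fix f assume "f \<in> H"
    then have "push \<iota> f \<in> gen (push \<iota> ` H \<union> {z})" "z \<in> gen (push \<iota> ` H \<union> {z})"
      by (auto intro: gen_incl)
    then show "f \<in> gen (push \<iota> ` H \<union> {z})"
      using eq[OF \<open>f \<in> H\<close>] pgroup_comp[OF pg] pgroup_inv[OF pg] by metis
  qed
  then show ?thesis by (rule below_gen_trans) (use bz below K in auto)
qed

section \<open>Generating all permutations and absorbing countable sets\<close>

context enumeration begin

lemma three_coinfinite_generate:
  obtains M1 M2 M3 :: "'a set" where "infinite (- M1)" "infinite (- M2)" "infinite (- M3)"
    "Collect bij \<subseteq> gen (symm M1 \<union> symm M2 \<union> symm M3)"
proof -
  obtain X W :: "'a set" where X: "X \<inter> W = {}" "infinite X" "infinite W" "UNIV = X \<union> W"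
    by (rule infinite_halves[OF infinite_Omega])
  obtain Y Z where YZ: "Y \<inter> Z = {}" "infinite Y" "infinite Z" "W = Y \<union> Z"
    by (rule infinite_halves[OF X(3)])
  have d: "X \<inter> Y = {}" "X \<inter> Z = {}" "X \<union> Y \<union> Z = UNIV" using X YZ by auto
  have "- (X \<union> Y) = Z" "- (Y \<union> Z) = X" "- (X \<union> Z) = Y" using d YZ(1) by auto
  then show thesis
    using that[of "X \<union> Y" "Y \<union> Z" "X \<union> Z"] X(2) YZ(2,3)
      gen_symm3[OF countable_Omega X(2) YZ(2,3) d(1,2) YZ(1) d(3)] by simp
qed

end

context enumeration begin

text \<open>The injection \<kappa> lays out copies of \<Omega> along the indices of \<alpha>. Its
  choice decides which index permutations are needed: arbitrary ones, or ones with prescribed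
  cuts.\<close>

lemma push_half_copy_below:
  fixes \<alpha> :: "nat \<Rightarrow> 'a" and \<kappa> :: "'a \<times> int \<Rightarrow> nat"
  assumes G: "G \<subseteq> Collect bij" and \<alpha>: "inj \<alpha>" and t: "bij t" and \<kappa>: "inj \<kappa>"
    and tr: "\<And>\<phi>. \<phi> \<in> \<Phi> \<Longrightarrow> \<exists>u\<in>gen (G \<union> {t}). \<forall>n. u (\<alpha> n) = \<alpha> (\<phi> n)"
    and H: "H \<subseteq> Collect bij" "\<And>f. f \<in> H \<Longrightarrow> push \<kappa> (half_copy f) \<in> \<Phi>"
  shows "\<exists>\<iota>::'a \<Rightarrow> 'a. inj \<iota> \<and> push \<iota> ` H \<preceq> G"
proof -
  define a where "a p = \<alpha> (\<kappa> p)" for p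
  have a: "inj a" by (rule injI) (simp add: a_def inj_eq[OF \<alpha>] inj_eq[OF \<kappa>])
  obtain y where y: "bij y" "\<And>f u. bij f \<Longrightarrow> bij u \<Longrightarrow> (\<And>p. u (a p) = a (half_copy f p)) \<Longrightarrow>
     push (\<lambda>x. a (x, 0)) f = u \<circ> y \<circ> inv u \<circ> inv y" by (rule shift_commutator[OF a]) blast
  let ?K = "gen (G \<union> {t, y})"
  have pg: "pgroup ?K" by (rule pgroup_gen) (use G t y(1) in auto)
  have sub: "gen (G \<union> {t}) \<subseteq> ?K" by (rule gen_mono) auto
  have "push (\<lambda>x. a (x, 0)) f \<in> ?K" if f: "f \<in> H" for f
  proof -
    obtain u where u: "u \<in> ?K" "\<And>n. u (\<alpha> n) = \<alpha> (push \<kappa> (half_copy f) n)" using tr[OF H(2)[OF f]] sub by blast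
    have "u (a p) = a (half_copy f p)" for p using u(2)[of "\<kappa> p"] \<kappa> by (simp add: a_def)
    then have eq: "push (\<lambda>x. a (x, 0)) f = u \<circ> y \<circ> inv u \<circ> inv y"
      using f H(1) pgroup_bij[OF pg u(1)] by (intro y(2)) auto
    have "y \<in> ?K" by (rule gen_incl) simp
    then show ?thesis unfolding eq by (intro pgroup_comp[OF pg] pgroup_inv[OF pg] u(1))
  qed
  then have "push (\<lambda>x. a (x, 0)) ` H \<preceq> G"
    by (intro belowI[of "{t, y}"]) (use t y(1) in auto)
  moreover have "inj (\<lambda>x. a (x, 0))" using a by (auto simp: inj_def)
  ultimately show ?thesis by blast
qed

definition level_code :: "'a \<times> int \<Rightarrow> nat" where
  "level_code p = prod_encode (code (fst p), int_encode (snd p))"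

lemma inj_level_code: "inj level_code"
proof (rule injI)
  fix p q assume "level_code p = level_code q"
  then have "code (fst p) = code (fst q)" "snd p = snd q" by (simp_all add: level_code_def int_encode_eq)
  then show "p = q" by (metis en_code prod_eqI)
qed

lemma Collect_bij_below:
  fixes G :: "('a \<Rightarrow> 'a) set"
  assumes G: "pgroup G" "fclosed G" and inf: "inf_orbs G"
  shows "Collect bij \<preceq> G"
proof -
  have Gb: "G \<subseteq> Collect bij" using G by (simp add: pgroup_def)
  obtain \<alpha> :: "nat \<Rightarrow> 'a" and t where \<alpha>: "inj \<alpha>" "bij t"
    and u: "\<And>\<phi>. bij \<phi> \<Longrightarrow> \<exists>u\<in>gen (G \<union> {t}). \<forall>n. u (\<alpha> n) = \<alpha> (\<phi> n)"
    using inf_orbs_transport[OF G inf] by blast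
  have "\<exists>\<iota>::'a \<Rightarrow> 'a. inj \<iota> \<and> push \<iota> ` Collect bij \<preceq> G"
  proof (rule push_half_copy_below[OF Gb \<alpha> inj_level_code])
    show "\<exists>u\<in>gen (G \<union> {t}). \<forall>n. u (\<alpha> n) = \<alpha> (\<phi> n)" if "\<phi> \<in> Collect bij" for \<phi>
      by (rule u) (use that in simp)
    show "push level_code (half_copy f) \<in> Collect bij" if "f \<in> Collect bij" for f :: "'a \<Rightarrow> 'a"
      using push_bij[OF inj_level_code bij_half_copy] that by simp
  qed simp
  then obtain \<iota> :: "'a \<Rightarrow> 'a" where \<iota>: "inj \<iota>" "push \<iota> ` Collect bij \<preceq> G" by blast
  have b: "symm M \<preceq> G" if "infinite (- M)" for M
  proof (rule below_of_push[OF countable_Omega \<iota>(1) that subset_refl _ Gb])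
    have "push \<iota> ` symm M \<subseteq> push \<iota> ` Collect bij" by (rule image_mono) (auto simp: symm_def)
    then show "push \<iota> ` symm M \<preceq> G" using below_trans[OF below_subset \<iota>(2) Gb] by blast
  qed
  obtain M1 M2 M3 :: "'a set" where M: "infinite (- M1)" "infinite (- M2)" "infinite (- M3)"
    and gen: "Collect bij \<subseteq> gen (symm M1 \<union> symm M2 \<union> symm M3)"
    by (rule three_coinfinite_generate)
  have "symm M1 \<union> symm M2 \<union> symm M3 \<preceq> G" by (intro below_Un b M)
  then show ?thesis
    using below_gen_trans[of "Collect bij" "symm M1 \<union> symm M2 \<union> symm M3" "{}" G] gen Gb by simp
qed

text \<open>All members of D are stored in one permutation w, side by side; shifts and a commutator
  extract any one of them, so three generators suffice.\<close>

lemma countable_push_below: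
  fixes D :: "('a \<Rightarrow> 'a) set"
  assumes D: "countable D" "D \<subseteq> Collect bij"
  shows "\<exists>\<iota>::'a \<Rightarrow> 'a. inj \<iota> \<and> push \<iota> ` D \<preceq> {}"
proof (cases "D = {}")
  case True
  then show ?thesis by (intro exI[of _ id]) (auto intro: below_subset)
next
  case False
  define d where "d = from_nat_into D"
  have rd: "range d = D" unfolding d_def using False D(1) by (rule range_from_nat_into)
  have db: "bij (d k)" for k using rd D(2) by auto
  define a :: "'a \<times> int \<times> int \<Rightarrow> 'a"
    where "a = (\<lambda>(x, s, n). en (prod_encode (code x, prod_encode (int_encode s, int_encode n))))"
  have a: "inj a"
  proof (rule injI)
    fix p q assume *: "a p = a q"
    obtain x s n x' s' n' where pq: "p = (x, s, n)" "q = (x', s', n')" by (metis prod_cases3)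
    have "prod_encode (code x, prod_encode (int_encode s, int_encode n))
        = prod_encode (code x', prod_encode (int_encode s', int_encode n'))"
      using * bij_is_inj[OF bij_en] unfolding a_def pq by (simp only: prod.case inj_eq)
    then have "code x = code x'" "s = s'" "n = n'" by (simp_all add: int_encode_eq)
    then show "p = q" unfolding pq by (metis en_code)
  qed
  \<comment> \<open>The coordinates are a point, a level s and a column n. Column n \<ge> 0 of w
    carries the n-th member of D on its nonnegative levels, v moves columns, and q shifts the levels
    of column 0 only.\<close>
  define w :: "'a \<times> int \<times> int \<Rightarrow> 'a \<times> int \<times> int"
    where "w = (\<lambda>(x, s, n). (if s \<ge> 0 \<and> n \<ge> 0 then d (nat n) x else x, s, n))"
  define q :: "'a \<times> int \<times> int \<Rightarrow> 'a \<times> int \<times> int"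
    where "q = (\<lambda>(x, s, n). (x, if n = 0 then s + 1 else s, n))"
  define v :: "int \<Rightarrow> 'a \<times> int \<times> int \<Rightarrow> 'a \<times> int \<times> int" where "v k = (\<lambda>(x, s, n). (x, s, n + k))" for k
  have bw: "bij w"
    by (rule o_bij[of "\<lambda>(x, s, n). (if s \<ge> 0 \<and> n \<ge> 0 then inv (d (nat n)) x else x, s, n)"])
      (use db in \<open>auto simp: w_def fun_eq_iff\<close>)
  have bq: "bij q"
    by (rule o_bij[of "\<lambda>(x, s, n). (x, if n = 0 then s - 1 else s, n)"]) (auto simp: q_def fun_eq_iff)
  have bv: "bij (v k)" for k
    by (rule o_bij[of "v (- k)"]) (auto simp: v_def fun_eq_iff)
  let ?U = "{push a w, push a q, push a (v 1)}"
  let ?K = "gen ({} \<union> ?U)"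
  have Ub: "?U \<subseteq> Collect bij" using push_bij[OF a] bw bq bv by simp
  have pg: "pgroup ?K" by (rule pgroup_gen) (use Ub in simp)
  have inK: "push a w \<in> ?K" "push a q \<in> ?K" "push a (v 1) \<in> ?K" by (auto intro: gen_incl)
  have vK: "push a (v (int k)) \<in> ?K" for k
  proof (induction k)
    case 0
    have v0: "v (int 0) = id" by (auto simp: v_def)
    show ?case unfolding v0 push_id[OF a] by (rule pgroup_id[OF pg])
  next
    case (Suc k)
    have "v (int (Suc k)) = v 1 \<circ> v (int k)" by (auto simp: v_def fun_eq_iff)
    then show ?case using pgroup_comp[OF pg inK(3) Suc] by (simp only: push_comp[OF a])
  qed
  define \<iota> where "\<iota> x = a (x, 0, 0)" for x
  have \<iota>: "inj \<iota>" using a by (auto simp: inj_def \<iota>_def)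
  have "push \<iota> (d k) \<in> ?K" for k
  proof -
    \<comment> \<open>The conjugate of w by \<open>v (int k)\<close>, which brings
      \<open>d k\<close> into column 0.\<close>
    define wk where "wk = (\<lambda>(x, s, n). (if s \<ge> (0::int) \<and> n + int k \<ge> 0 then d (nat (n + int k)) x else x, s, n))"
    have "v (int k) \<circ> wk = w \<circ> v (int k)" by (auto simp: v_def wk_def w_def fun_eq_iff)
    then have eq: "push a (v (int k)) \<circ> push a wk = push a w \<circ> push a (v (int k))"
      by (simp only: push_comp[OF a, symmetric])
    have "inv (push a (v (int k))) \<circ> (push a (v (int k)) \<circ> push a wk) = push a wk"
      using pgroup_inv_left[OF pg vK] by (simp add: fun_eq_iff)
    then have wkK: "push a wk \<in> ?K"
      using pgroup_comp[OF pg pgroup_inv[OF pg vK] pgroup_comp[OF pg inK(1) vK], of k k]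
      unfolding eq by simp
    \<comment> \<open>The commutator of wk and q. Other columns cancel because q fixes them; in
      column 0 the nonnegative levels and their shift differ in level 0 only.\<close>
    define E where "E = (\<lambda>(x, s, n). (if s = (0::int) \<and> n = (0::int) then d k x else x, s, n))"
    have "wk \<circ> q = E \<circ> (q \<circ> wk)"
      by (rule ext) (auto simp: wk_def q_def E_def split: prod.splits)
    then have eq: "push a wk \<circ> push a q = push a E \<circ> (push a q \<circ> push a wk)"
      by (simp only: push_comp[OF a, symmetric])
    define X where "X = push a q \<circ> push a wk"
    have XK: "X \<in> ?K" unfolding X_def by (rule pgroup_comp[OF pg inK(2) wkK])
    have "push a wk \<circ> push a q \<circ> inv X = push a E"
      unfolding eq X_def[symmetric] using pgroup_inv_right[OF pg XK] by (simp add: fun_eq_iff)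
    then have "push a E \<in> ?K"
      using pgroup_comp[OF pg pgroup_comp[OF pg wkK inK(2)] pgroup_inv[OF pg XK]] by simp
    moreover have "push \<iota> (d k) = push a E"
    proof (rule ext)
      fix y
      show "push \<iota> (d k) y = push a E y"
      proof (cases "y \<in> range a")
        case True
        then obtain x s n where y: "y = a (x, s, n)" by (metis imageE prod_cases3)
        show ?thesis
        proof (cases "s = 0 \<and> n = 0")
          case True
          then have "y = \<iota> x" by (simp add: y \<iota>_def)
          then have "push \<iota> (d k) y = a (d k x, 0, 0)" using \<iota> by (simp add: \<iota>_def[symmetric])
          then show ?thesis using True a by (simp add: y E_def)
        next
          case False
          then have "y \<notin> range \<iota>" using a by (auto simp: y \<iota>_def inj_eq)
          then show ?thesis using False a by (auto simp: push_outside y E_def)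
        qed
      next
        case False
        then have "y \<notin> range \<iota>" by (auto simp: \<iota>_def)
        then show ?thesis using False by (simp add: push_outside)
      qed
    qed
    ultimately show ?thesis by simp
  qed
  then have "push \<iota> ` D \<subseteq> ?K" using rd by auto
  then have "push \<iota> ` D \<preceq> {}" using Ub by (intro belowI[of ?U]) auto
  then show ?thesis using \<iota> by blast
qed

text \<open>The return from a copy requires a coinfinite support, so C is replaced by the set of its
  factors in three coinfinite symmetric groups, which is again countable.\<close>

lemma countable_below:
  fixes C K :: "('a \<Rightarrow> 'a) set"
  assumes C: "countable C" "C \<subseteq> Collect bij" and K: "K \<subseteq> Collect bij"
  shows "C \<preceq> K"
proof -
  obtain M1 M2 M3 :: "'a set" where M: "infinite (- M1)" "infinite (- M2)" "infinite (- M3)"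
    and gen: "Collect bij \<subseteq> gen (symm M1 \<union> symm M2 \<union> symm M3)"
    by (rule three_coinfinite_generate)
  have "\<exists>F. finite F \<and> F \<subseteq> symm M1 \<union> symm M2 \<union> symm M3 \<and> c \<in> gen F" if "c \<in> C" for c
    by (rule gen_finite_support) (use gen C that in blast)
  then obtain F where F: "\<And>c. c \<in> C \<Longrightarrow> finite (F c) \<and> F c \<subseteq> symm M1 \<union> symm M2 \<union> symm M3 \<and> c \<in> gen (F c)"
    by metis
  define C' where "C' = (\<Union>c\<in>C. F c)"
  have cC': "countable C'" unfolding C'_def using C(1) F by (intro countable_UN) (auto intro: countable_finite)
  have b: "C' \<inter> symm M \<preceq> K" if "infinite (- M)" for M
  proof -
    have "countable (C' \<inter> symm M)" "C' \<inter> symm M \<subseteq> Collect bij"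
      using cC' by (auto simp: symm_def intro: countable_subset)
    from countable_push_below[OF this]
    obtain \<iota> :: "'a \<Rightarrow> 'a" where \<iota>: "inj \<iota>" "push \<iota> ` (C' \<inter> symm M) \<preceq> {}" by blast
    have "push \<iota> ` (C' \<inter> symm M) \<preceq> K" by (rule below_trans[OF \<iota>(2) below_subset K]) simp
    from below_of_push[OF countable_Omega \<iota>(1) that _ this K] show ?thesis by simp
  qed
  have g: "C \<subseteq> gen (((C' \<inter> symm M1) \<union> (C' \<inter> symm M2) \<union> (C' \<inter> symm M3)) \<union> {})"
  proof
    fix c assume c: "c \<in> C"
    have "F c \<subseteq> (C' \<inter> symm M1) \<union> (C' \<inter> symm M2) \<union> (C' \<inter> symm M3) \<union> {}"
      using F[OF c] c by (auto simp: C'_def)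
    from gen_mono[OF this] F[OF c]
    show "c \<in> gen (((C' \<inter> symm M1) \<union> (C' \<inter> symm M2) \<union> (C' \<inter> symm M3)) \<union> {})" by blast
  qed
  have b': "(C' \<inter> symm M1) \<union> (C' \<inter> symm M2) \<union> (C' \<inter> symm M3) \<preceq> K"
    by (intro below_Un b M)
  show ?thesis by (rule below_gen_trans[OF g _ _ b' K]) simp_all
qed

end

subsection \<open>Permutations preserving the blocks of a partition\<close>

text \<open>A partition into finite sets is given by the map from points to their blocks, so that
  \<open>orb G {}\<close> can be used as one directly.\<close>

definition blocks :: "('a \<Rightarrow> 'a set) \<Rightarrow> bool" where
  "blocks R \<longleftrightarrow> (\<forall>x. x \<in> R x \<and> finite (R x)) \<and> (\<forall>x y. y \<in> R x \<longrightarrow> R y = R x)"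

text \<open>The unrestricted product of the symmetric groups of the blocks.\<close>

definition block_perms :: "('a \<Rightarrow> 'a set) \<Rightarrow> ('a \<Rightarrow> 'a) set" where
  "block_perms R = {f. bij f \<and> (\<forall>x. f x \<in> R x)}"

definition restr :: "'a set \<Rightarrow> ('a \<Rightarrow> 'a) \<Rightarrow> 'a \<Rightarrow> 'a" where
  "restr M f x = (if x \<in> M then f x else x)"

definition saturated :: "('a \<Rightarrow> 'a set) \<Rightarrow> 'a set \<Rightarrow> bool" where
  "saturated R M \<longleftrightarrow> (\<forall>x\<in>M. R x \<subseteq> M)"

lemma saturated_iff: "blocks R \<Longrightarrow> saturated R M \<Longrightarrow> y \<in> R x \<Longrightarrow> y \<in> M \<longleftrightarrow> x \<in> M"
  unfolding blocks_def saturated_def by blast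

lemma saturated_Compl: "blocks R \<Longrightarrow> saturated R M \<Longrightarrow> saturated R (- M)"
  using saturated_iff[of R M] by (auto simp: saturated_def)

lemma block_perms_inv:
  assumes "blocks R" "f \<in> block_perms R" shows "inv f \<in> block_perms R"
proof -
  have f: "bij f" "\<And>x. f x \<in> R x" using assms(2) by (auto simp: block_perms_def)
  have "inv f x \<in> R x" for x
  proof -
    have "R x = R (inv f x)" using f(2)[of "inv f x"] f(1) assms(1) unfolding blocks_def by (metis inv_bij_right)
    then show ?thesis using assms(1) unfolding blocks_def by auto
  qed
  then show ?thesis using f(1) by (simp add: block_perms_def bij_imp_bij_inv)
qed

lemma restr_block_perms:
  assumes R: "blocks R" and M: "saturated R M" and f: "f \<in> block_perms R"
  shows "restr M f \<in> block_perms R" "restr M f \<in> symm M"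
proof -
  have fM: "f x \<in> M \<longleftrightarrow> x \<in> M" for x
    using saturated_iff[OF R M] f by (auto simp: block_perms_def)
  have fM': "inv f x \<in> M \<longleftrightarrow> x \<in> M" for x
    using saturated_iff[OF R M] block_perms_inv[OF R f] by (auto simp: block_perms_def)
  have bf: "bij f" using f by (simp add: block_perms_def)
  have "bij (restr M f)"
    by (rule o_bij[of "restr M (inv f)"]) (use bf fM fM' in \<open>auto simp: restr_def fun_eq_iff\<close>)
  then show "restr M f \<in> block_perms R" "restr M f \<in> symm M"
    using f R by (auto simp: block_perms_def symm_def restr_def blocks_def)
qed

lemma restr_comp_Compl:
  assumes R: "blocks R" and M: "saturated R M" and f: "f \<in> block_perms R"
  shows "f = restr M f \<circ> restr (- M) f"
proof (rule ext)
  fix x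
  have "f x \<in> M \<longleftrightarrow> x \<in> M"
    using saturated_iff[OF R M] f by (auto simp: block_perms_def)
  then show "f x = (restr M f \<circ> restr (- M) f) x" by (simp add: restr_def)
qed

lemma infinite_Union_blocks:
  assumes "infinite Q" shows "infinite (\<Union>Q)"
proof
  assume "finite (\<Union>Q)"
  moreover have "Q \<subseteq> Pow (\<Union>Q)" by blast
  ultimately show False using assms finite_subset by blast
qed

lemma saturated_split:
  assumes inf: "infinite (UNIV :: 'a set)" and R: "blocks (R :: 'a \<Rightarrow> 'a set)"
  obtains M where "saturated R M" "infinite M" "infinite (- M)"
proof -
  have "(\<Union>x. R x) = UNIV" using R by (auto simp: blocks_def)
  have "infinite (range R)"
  proof
    assume "finite (range R)"
    then have "finite (\<Union>x. R x)" by (rule finite_Union) (use R in \<open>auto simp: blocks_def\<close>)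
    then show False using inf \<open>(\<Union>x. R x) = UNIV\<close> by simp
  qed
  then obtain Q1 Q2 where Q: "Q1 \<inter> Q2 = {}" "infinite Q1" "infinite Q2" "range R = Q1 \<union> Q2"
    by (rule infinite_halves)
  have mem: "R x \<in> Q" if xQ: "x \<in> \<Union>Q" and QR: "Q \<subseteq> range R" for x Q
  proof -
    obtain X where "X \<in> Q" "x \<in> X" using xQ by blast
    moreover then obtain z where "X = R z" using QR by blast
    ultimately show ?thesis using R by (metis blocks_def)
  qed
  have Q12: "Q1 \<subseteq> range R" "Q2 \<subseteq> range R" using Q(4) by auto
  show thesis
  proof (rule that)
    show "saturated R (\<Union>Q1)" unfolding saturated_def using mem[OF _ Q12(1)] by blast
    show "infinite (\<Union>Q1)" using Q(2) by (rule infinite_Union_blocks)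
    have "\<Union>Q2 \<subseteq> - \<Union>Q1" using mem[OF _ Q12(1)] mem[OF _ Q12(2)] Q(1) by blast
    then show "infinite (- \<Union>Q1)" using infinite_Union_blocks[OF Q(3)] finite_subset by blast
  qed
qed

text \<open>Dividing the blocks into two infinite families splits each f into two restrictions with
  coinfinite support. Both belong to H again, so their copies can be moved back.\<close>

lemma block_perms_below_of_push:
  fixes R :: "'a \<Rightarrow> 'a set" and \<iota> :: "'a \<Rightarrow> 'a"
  assumes c: "countable (UNIV :: 'a set)" "infinite (UNIV :: 'a set)" and R: "blocks R"
    and H: "H \<subseteq> block_perms R" "\<And>f M. f \<in> H \<Longrightarrow> saturated R M \<Longrightarrow> restr M f \<in> H"
    and \<iota>: "inj \<iota>" "push \<iota> ` H \<preceq> K" and K: "K \<subseteq> Collect bij"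
  shows "H \<preceq> K"
proof -
  obtain M where M: "saturated R M" "infinite M" "infinite (- M)" by (rule saturated_split[OF c(2) R])
  have b: "H \<inter> symm N \<preceq> K" if "infinite (- N)" for N
  proof (rule below_of_push[OF c(1) \<iota>(1) that _ _ K])
    have "push \<iota> ` (H \<inter> symm N) \<subseteq> push \<iota> ` H" by blast
    then show "push \<iota> ` (H \<inter> symm N) \<preceq> K" using below_trans[OF below_subset \<iota>(2) K] by blast
  qed simp
  have "infinite (- (- M))" using M(2) by simp
  then have u: "(H \<inter> symm M) \<union> (H \<inter> symm (- M)) \<preceq> K" using b M(3) below_Un by blast
  have pg: "pgroup (gen ((H \<inter> symm M) \<union> (H \<inter> symm (- M)) \<union> {}))"
    by (rule pgroup_gen) (auto simp: symm_def)
  have "H \<subseteq> gen ((H \<inter> symm M) \<union> (H \<inter> symm (- M)) \<union> {})"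
  proof
    fix f assume f: "f \<in> H"
    then have fb: "f \<in> block_perms R" using H(1) by blast
    note MC = saturated_Compl[OF R M(1)]
    have "restr M f \<in> H \<inter> symm M" "restr (- M) f \<in> H \<inter> symm (- M)"
      using H(2)[OF f M(1)] H(2)[OF f MC] restr_block_perms(2)[OF R M(1) fb] restr_block_perms(2)[OF R MC fb]
      by blast+
    then have "restr M f \<circ> restr (- M) f \<in> gen ((H \<inter> symm M) \<union> (H \<inter> symm (- M)) \<union> {})"
      by (intro pgroup_comp[OF pg] gen_incl) auto
    then show "f \<in> gen ((H \<inter> symm M) \<union> (H \<inter> symm (- M)) \<union> {})"
      using restr_comp_Compl[OF R M(1) fb] by simp
  qed
  from below_gen_trans[OF this _ _ u K] show ?thesis by simp
qed

context enumeration begin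

text \<open>In \<open>big_orbs_transport\<close> one set of cuts must serve all block permutations
  on all levels. So each block on each level receives an interval of indices of its own, and the
  interval ends are the cuts.\<close>

lemma contiguous_injection:
  fixes R :: "'a \<Rightarrow> 'a set"
  assumes R: "blocks R"
  obtains \<kappa> :: "'a \<times> int \<Rightarrow> nat" and C where "inj \<kappa>" "\<And>n. \<exists>m>n. m \<in> C"
    "\<And>m x y s. m \<in> C \<Longrightarrow> y \<in> R x \<Longrightarrow> \<kappa> (y, s) < m \<longleftrightarrow> \<kappa> (x, s) < m"
proof -
  define cls where "cls p = (\<lambda>x. level_code (x, snd p)) ` R (fst p)" for p
  have fin: "finite (cls p)" and self: "level_code p \<in> cls p" for p
  proof -
    show "finite (cls p)" using R by (simp add: cls_def blocks_def)
    have "fst p \<in> R (fst p)" using R by (simp add: blocks_def)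
    then show "level_code p \<in> cls p" unfolding cls_def by (rule rev_image_eqI) simp
  qed
  have cls_eq: "cls q = cls p" if "level_code q \<in> cls p" for p q
  proof -
    obtain x where x: "x \<in> R (fst p)" "level_code q = level_code (x, snd p)" using \<open>level_code q \<in> cls p\<close> by (auto simp: cls_def)
    then have "q = (x, snd p)" using inj_level_code by (simp add: inj_eq)
    moreover have "R x = R (fst p)" using R x(1) by (auto simp: blocks_def)
    ultimately show ?thesis by (simp add: cls_def)
  qed
  define key where "key p = Min (cls p)" for p
  \<comment> \<open>The j-th interval is longer than every code in the class of the pair with code
    j, so that \<open>level_code p\<close> itself can serve as the offset.\<close>
  define bs where "bs k = (\<Sum>j<k. Suc (Max (insert 0 (cls (inv_into UNIV level_code j)))))" for k
  define \<kappa> where "\<kappa> p = bs (key p) + level_code p" for p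
  have key_cls: "cls (inv_into UNIV level_code (key p)) = cls p" for p
  proof (rule cls_eq)
    have "key p \<in> cls p" unfolding key_def by (rule Min_in[OF fin]) (use self[of p] in auto)
    then have "key p \<in> range level_code" by (auto simp: cls_def)
    then have "level_code (inv_into UNIV level_code (key p)) = key p" by (rule f_inv_into_f)
    then show "level_code (inv_into UNIV level_code (key p)) \<in> cls p" using \<open>key p \<in> cls p\<close> by simp
  qed
  have bs_Suc: "bs (Suc k) = bs k + Suc (Max (insert 0 (cls (inv_into UNIV level_code k))))" for k
    by (simp add: bs_def)
  have sm: "strict_mono bs"
    by (rule strict_mono_Suc_iff[THEN iffD2, rule_format]) (simp add: bs_Suc)
  have lo: "bs (key p) \<le> \<kappa> p" for p by (simp add: \<kappa>_def)
  have hi: "\<kappa> p < bs (Suc (key p))" for p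
  proof -
    have "level_code p \<le> Max (insert 0 (cls p))" by (rule Max_ge) (use fin self in auto)
    then show ?thesis by (simp add: \<kappa>_def bs_Suc key_cls)
  qed
  have lt: "\<kappa> p < bs j \<longleftrightarrow> key p < j" for p j
  proof
    assume "\<kappa> p < bs j"
    then have "bs (key p) < bs j" using lo[of p] by simp
    then show "key p < j" using sm by (simp add: strict_mono_less)
  next
    assume "key p < j"
    then have "bs (Suc (key p)) \<le> bs j" using sm by (simp add: strict_mono_less_eq)
    then show "\<kappa> p < bs j" using hi[of p] by simp
  qed
  show thesis
  proof (rule that)
    show "inj \<kappa>"
    proof (rule injI)
      fix p q assume eq: "\<kappa> p = \<kappa> q"
      have "\<not> key p < key q" using lt[of p "key q"] lo[of q] eq by auto
      moreover have "\<not> key q < key p" using lt[of q "key p"] lo[of p] eq by auto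
      ultimately have "key p = key q" by simp
      then have "level_code p = level_code q" using eq by (simp add: \<kappa>_def)
      then show "p = q" using inj_level_code by (simp add: inj_eq)
    qed
    show "\<exists>m>n. m \<in> range bs" for n
      using strict_mono_imp_increasing[OF sm, of "Suc n"] by (intro exI[of _ "bs (Suc n)"]) auto
    show "\<kappa> (y, s) < m \<longleftrightarrow> \<kappa> (x, s) < m" if "m \<in> range bs" and y: "y \<in> R x" for m x y s
    proof -
      have "R y = R x" using R y by (auto simp: blocks_def)
      then have "key (y, s) = key (x, s)" by (simp add: key_def cls_def)
      then show ?thesis using that(1) lt by auto
    qed
  qed
qed

lemma block_perms_below:
  fixes G :: "('a \<Rightarrow> 'a) set"
  assumes G: "pgroup G" "fclosed G" and fin: "\<And>a. finite (orb G {} a)" and big: "\<And>n. big_orbs G n"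
    and R: "blocks R"
  shows "block_perms R \<preceq> G"
proof -
  have Gb: "G \<subseteq> Collect bij" using G by (simp add: pgroup_def)
  obtain \<kappa> :: "'a \<times> int \<Rightarrow> nat" and C where \<kappa>: "inj \<kappa>" and C: "\<And>n. \<exists>m>n. m \<in> C"
    and cuts: "\<And>m x y s. m \<in> C \<Longrightarrow> y \<in> R x \<Longrightarrow> \<kappa> (y, s) < m \<longleftrightarrow> \<kappa> (x, s) < m"
    using contiguous_injection[OF R] by metis
  obtain \<alpha> :: "nat \<Rightarrow> 'a" and t where \<alpha>: "inj \<alpha>" "bij t"
    and u: "\<forall>\<phi>. bij \<phi> \<longrightarrow> (\<forall>m\<in>C. cut \<phi> m) \<longrightarrow> (\<exists>u\<in>gen (G \<union> {t}). \<forall>n. u (\<alpha> n) = \<alpha> (\<phi> n))"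
    using big_orbs_transport[OF G fin big C] by blast
  have "\<exists>\<iota>::'a \<Rightarrow> 'a. inj \<iota> \<and> push \<iota> ` block_perms R \<preceq> G"
  proof (rule push_half_copy_below[OF Gb \<alpha> \<kappa>])
    show "\<exists>u\<in>gen (G \<union> {t}). \<forall>n. u (\<alpha> n) = \<alpha> (\<phi> n)" if "\<phi> \<in> {\<phi>. bij \<phi> \<and> (\<forall>m\<in>C. cut \<phi> m)}" for \<phi>
      using u that by simp
    show "push \<kappa> (half_copy f) \<in> {\<phi>. bij \<phi> \<and> (\<forall>m\<in>C. cut \<phi> m)}" if f: "f \<in> block_perms R" for f
    proof -
      have f': "bij f" "\<And>x. f x \<in> R x" using f by (auto simp: block_perms_def)
      have "push \<kappa> (half_copy f) n < m \<longleftrightarrow> n < m" if m: "m \<in> C" for m n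
      proof (cases "n \<in> range \<kappa>")
        case True
        then obtain x s where n: "n = \<kappa> (x, s)" by auto
        show ?thesis using cuts[OF m f'(2)] by (simp add: n \<kappa> half_copy_def)
      qed (simp add: push_outside)
      then show ?thesis using push_bij[OF \<kappa> bij_half_copy[OF f'(1)]] by (simp add: cut_def)
    qed
  qed (auto simp: block_perms_def)
  then obtain \<iota> :: "'a \<Rightarrow> 'a" where \<iota>: "inj \<iota>" "push \<iota> ` block_perms R \<preceq> G" by blast
  show ?thesis
    by (rule block_perms_below_of_push[OF countable_Omega infinite_Omega R subset_refl _ \<iota> Gb])
      (rule restr_block_perms(1)[OF R])
qed

subsection \<open>Bounded orbits\<close>

text \<open>
  With the bound on the orbits chosen minimal, further stabilizers are still transitive on some
  orbit, so that branches need not record their history.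
\<close>

lemma uniform_orbits:
  fixes G :: "('a \<Rightarrow> 'a) set"
  assumes nt: "big_orbs G 1" and bdd: "\<not> big_orbs G K"
  obtains \<Gamma> where "finite \<Gamma>" "\<And>a. finite (orb G \<Gamma> a)"
    "\<And>F. finite F \<Longrightarrow> \<exists>a. orb (stab G \<Gamma>) F a = orb (stab G \<Gamma>) {} a \<and> card (orb (stab G \<Gamma>) {} a) > 1"
proof -
  have ex: "\<exists>n. \<not> big_orbs G n" using bdd by blast
  define N where "N = (LEAST n. \<not> big_orbs G n)"
  have N: "\<not> big_orbs G N" unfolding N_def by (rule LeastI_ex[OF ex])
  have min: "big_orbs G n" if "n < N" for n using not_less_Least[of n "\<lambda>n. \<not> big_orbs G n"] that by (simp add: N_def)
  obtain \<Gamma> where \<Gamma>: "finite \<Gamma>" "\<And>a. finite (orb G \<Gamma> a)" "\<And>a. card (orb G \<Gamma> a) \<le> N"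
    using N by (auto simp: big_orbs_def)
  have N1: "N > 1"
  proof -
    obtain a where "\<not> (finite (orb G \<Gamma> a) \<and> card (orb G \<Gamma> a) \<le> 1)" using nt \<Gamma>(1) by (auto simp: big_orbs_def)
    then show ?thesis using \<Gamma>(2,3)[of a] by linarith
  qed
  have "\<exists>a. orb (stab G \<Gamma>) F a = orb (stab G \<Gamma>) {} a \<and> card (orb (stab G \<Gamma>) {} a) > 1" if F: "finite F" for F
  proof -
    have fin: "finite (orb G (\<Gamma> \<union> F) a)" for a by (rule finite_subset[OF orb_antimono \<Gamma>(2)]) simp
    \<comment> \<open>By minimality some orbit still has at least N points over \<Gamma> \<union> F.
      Over \<Gamma> no orbit has more, so this one has not shrunk.\<close>
    obtain a where "\<not> (finite (orb G (\<Gamma> \<union> F) a) \<and> card (orb G (\<Gamma> \<union> F) a) \<le> N - 1)"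
      using min[of "N - 1", unfolded big_orbs_def, rule_format, of "\<Gamma> \<union> F"] N1 \<Gamma>(1) F by auto
    then have "card (orb G \<Gamma> a) \<le> card (orb G (\<Gamma> \<union> F) a)" "card (orb G (\<Gamma> \<union> F) a) \<ge> N"
      using fin[of a] \<Gamma>(3)[of a] by auto
    then have "orb G (\<Gamma> \<union> F) a = orb G \<Gamma> a"
      by (intro card_seteq[OF \<Gamma>(2) orb_antimono]) auto
    then show ?thesis using \<open>card (orb G (\<Gamma> \<union> F) a) \<ge> N\<close> N1
      by (intro exI[of _ a]) (simp add: orb_orb)
  qed
  then show thesis using that \<Gamma>(1,2) by blast
qed

lemma orb_image_eq:
  assumes "pgroup G" "g \<in> G" shows "g x \<in> orb G {} y \<longleftrightarrow> x \<in> orb G {} y"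
proof
  assume "x \<in> orb G {} y"
  then obtain h where "h \<in> G" "x = h y" by (auto simp: orb_def)
  then have "g x = (g \<circ> h) y" "g \<circ> h \<in> stab G {}" using assms by (simp_all add: pgroup_comp)
  then show "g x \<in> orb G {} y" using orbI by metis
next
  assume "g x \<in> orb G {} y"
  then obtain h where "h \<in> G" "g x = h y" by (auto simp: orb_def)
  then have "x = (inv g \<circ> h) y" "inv g \<circ> h \<in> stab G {}" using assms
    by (simp_all add: pgroup_comp pgroup_inv) (metis assms pgroup_inv_left)
  then show "x \<in> orb G {} y" using orbI by metis
qed

text \<open>The bit at n is set by an element fixing \<open>W n\<close> pointwise, which contains
  the earlier orbits; so the bits can be chosen independently.\<close>

lemma bit_choices:
  fixes H :: "('a \<Rightarrow> 'a) set"
  assumes H: "pgroup H" "fclosed H" and fin: "\<And>a. finite (orb H {} a)"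
    and uni: "\<And>F. finite F \<Longrightarrow> \<exists>a. orb H F a = orb H {} a \<and> card (orb H {} a) > 1"
  obtains b :: "nat \<Rightarrow> bool \<Rightarrow> 'a"
  where "\<And>n m x y. b n x = b m y \<longleftrightarrow> n = m \<and> x = y"
    "\<And>c. \<exists>g\<in>H. \<forall>n. g (b n False) = b n (c n)"
proof -
  have "\<exists>pick. \<forall>F. finite F \<longrightarrow> orb H F (pick F) = orb H {} (pick F) \<and> card (orb H {} (pick F)) > 1"
    using uni by metis
  then obtain pick where pick: "\<And>F. finite F \<Longrightarrow> orb H F (pick F) = orb H {} (pick F)"
    "\<And>F. finite F \<Longrightarrow> card (orb H {} (pick F)) > 1" by blast
  \<comment> \<open>Adding the orbit of \<open>en n\<close> makes these finite invariant sets
    exhaust \<Omega>, so images and preimages both settle along the sequence s.\<close>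
  define W where "W = rec_nat {} (\<lambda>n X. X \<union> orb H {} (pick X) \<union> orb H {} (en n))"
  have W0: "W 0 = {}" and WS: "W (Suc n) = W n \<union> orb H {} (pick (W n)) \<union> orb H {} (en n)" for n
    by (simp_all add: W_def)
  have finW: "finite (W n)" for n by (induction n) (simp_all add: W0 WS fin)
  have monoW: "W m \<subseteq> W n" if "m \<le> n" for m n
    by (rule lift_Suc_mono_le[of W, OF _ that]) (auto simp: WS)
  have invW: "g x \<in> W n \<longleftrightarrow> x \<in> W n" if "g \<in> H" for g x n
    by (induction n) (simp_all add: W0 WS orb_image_eq[OF H(1) that])
  define a where "a n = pick (W n)" for n
  have Oa: "orb H (W n) (a n) = orb H {} (a n)" "card (orb H {} (a n)) > 1" for n
    using pick[OF finW] by (simp_all add: a_def)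
  have aS: "orb H {} (a n) \<subseteq> W (Suc n)" and enS: "orb H {} (en n) \<subseteq> W (Suc n)" for n
    by (auto simp: WS a_def)
  have Oself: "x \<in> orb H {} x" for x by (rule orb_self[OF H(1)])
  \<comment> \<open>Otherwise \<open>a n\<close> would lie in \<open>W n\<close> and be alone in its
    orbit under the stabilizer of \<open>W n\<close>.\<close>
  have Oinv: "orb H {} (a n) \<inter> W n = {}" for n
  proof (rule ccontr)
    assume "orb H {} (a n) \<inter> W n \<noteq> {}"
    then obtain h where "h \<in> H" "h (a n) \<in> W n" by (auto simp: orb_def)
    then have "a n \<in> W n" using invW by blast
    then have "orb H (W n) (a n) \<subseteq> {a n}" by (auto simp: orb_def stab_def)
    then have "card (orb H (W n) (a n)) \<le> 1" using card_mono[of "{a n}"] by fastforce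
    then show False using Oa[of n] by simp
  qed
  have "\<exists>y. y \<in> orb H {} (a n) \<and> y \<noteq> a n" for n
  proof (rule ccontr)
    assume "\<nexists>y. y \<in> orb H {} (a n) \<and> y \<noteq> a n"
    then have "orb H {} (a n) \<subseteq> {a n}" by blast
    then have "card (orb H {} (a n)) \<le> 1" using card_mono[of "{a n}"] by fastforce
    then show False using Oa(2)[of n] by simp
  qed
  then obtain a' where a': "\<And>n. a' n \<in> orb H {} (a n)" "\<And>n. a' n \<noteq> a n" by metis
  define b where "b n x = (if x then a' n else a n)" for n x
  have bO: "b n x \<in> orb H {} (a n)" for n x using a'(1) Oself by (simp add: b_def)
  have disj: "b n x \<noteq> b m y" if "n < m" for n m x y
  proof -
    have "b n x \<in> W m" using bO[of n x] aS[of n] monoW[of "Suc n" m] that by (meson Suc_leI subsetD)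
    moreover have "b m y \<notin> W m" using bO[of m y] Oinv[of m] by blast
    ultimately show ?thesis by metis
  qed
  have inj: "b n x = b m y \<longleftrightarrow> n = m \<and> x = y" for n m x y
  proof
    assume eq: "b n x = b m y"
    then have "n = m" using disj[of n m x y] disj[of m n y x] by (metis linorder_neqE_nat)
    then show "n = m \<and> x = y" using eq a'(2)[of n] by (auto simp: b_def split: if_splits)
  qed simp
  have choice: "\<exists>g\<in>H. \<forall>n. g (b n False) = b n (c n)" for c
  proof -
    have "\<exists>s. \<forall>n. s n \<in> H \<and> (\<exists>h\<in>stab H (W n). s (Suc n) = s n \<circ> h \<and> s (Suc n) (a n) = b n (c n))"
    proof (rule dependent_nat_choice)
      show "\<exists>s. s \<in> H" using pgroup_id[OF H(1)] by blast
      fix s :: "'a \<Rightarrow> 'a" and n assume s: "s \<in> H"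
      have "s (inv s (b n (c n))) \<in> orb H {} (a n)" using bO H(1) s by simp
      then have "inv s (b n (c n)) \<in> orb H (W n) (a n)" using orb_image_eq[OF H(1) s] Oa(1) by simp
      then obtain h where h: "h \<in> stab H (W n)" "inv s (b n (c n)) = h (a n)" by (auto simp: orb_def)
      then have "(s \<circ> h) (a n) = b n (c n)" using H(1) s by (metis comp_apply pgroup_inv_right)
      moreover have "s \<circ> h \<in> H" using h(1) s H(1) by (simp add: pgroup_comp stab_in)
      ultimately show "\<exists>s'. s' \<in> H \<and> (\<exists>h\<in>stab H (W n). s' = s \<circ> h \<and> s' (a n) = b n (c n))"
        using h(1) by blast
    qed
    then obtain s where s: "\<And>n. s n \<in> H"
      "\<And>n. \<exists>h\<in>stab H (W n). s (Suc n) = s n \<circ> h \<and> s (Suc n) (a n) = b n (c n)" by blast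
    have fixW: "s (Suc n) x = s n x" if "x \<in> W n" for n x
    proof -
      obtain h where h: "h \<in> stab H (W n)" "s (Suc n) = s n \<circ> h" using s(2) by blast
      show ?thesis using stab_fix[OF h(1) that] h(2) by simp
    qed
    have enW: "en l \<in> W n" if "l < n" for l n
      using enS[of l] Oself[of "en l"] monoW[of "Suc l" n] that by (meson Suc_leI subsetD)
    obtain g where g: "g \<in> H" "\<And>x n. (\<And>m. m \<ge> n \<Longrightarrow> s (Suc m) x = s m x) \<Longrightarrow> g x = s n x"
    proof (rule limit_in_closed[OF H s(1)])
      show "s (Suc n) (en l) = s n (en l)" if "l < n" for n l by (rule fixW[OF enW[OF that]])
      show "inv (s (Suc n)) (en l) = inv (s n) (en l)" if "l < n" for n l
      proof -
        have "s n (inv (s n) (en l)) \<in> W n" using enW[OF that] H(1) s(1) by simp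
        then have "inv (s n) (en l) \<in> W n" using invW[OF s(1)] by blast
        then have "s (Suc n) (inv (s n) (en l)) = s n (inv (s n) (en l))" by (rule fixW)
        also have "\<dots> = en l" using H(1) s(1) by simp
        finally show ?thesis using s(1)[of "Suc n"] H(1) by (metis pgroup_inv_left)
      qed
    qed blast
    have "g (b n False) = b n (c n)" for n
    proof -
      have "g (a n) = s (Suc n) (a n)"
      proof (rule g(2))
        show "s (Suc m) (a n) = s m (a n)" if "m \<ge> Suc n" for m
          using fixW[of "a n" m] aS[of n] Oself[of "a n"] monoW[OF that] by blast
      qed
      also have "\<dots> = b n (c n)" using s(2)[of n] by blast
      finally show ?thesis by (simp add: b_def)
    qed
    then show ?thesis using g(1) by blast
  qed
  show thesis by (rule that[OF inj choice])
qed

text \<open>Invariance of the switch c under \<rho> gives c (\<phi> i) = c i, so the switch reads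
  the same before and after the move.\<close>

definition two_valued :: "('i \<Rightarrow> 'i) \<Rightarrow> ('i \<Rightarrow> 'i) set" where
  "two_valued \<rho> = {\<phi>. bij \<phi> \<and> (\<exists>c. (\<forall>i. c (\<rho> i) = c i) \<and> (\<forall>i. \<phi> i = (if c i then \<rho> i else i)))}"

text \<open>An element g of G attaches the bit c n to index n, t applies \<rho> to the indices with
  bit \<open>True\<close>, and \<open>inv g\<close> removes the bit, which is also the right one for
  the new index \<phi> n.\<close>

lemma two_valued_transport:
  fixes G :: "('a \<Rightarrow> 'a) set"
  assumes G: "pgroup G" "fclosed G" and nt: "big_orbs G 1" and bdd: "\<not> big_orbs G K" and \<rho>: "bij \<rho>"
  shows "\<exists>(\<alpha> :: nat \<Rightarrow> 'a) t. inj \<alpha> \<and> bij t \<and> (\<forall>\<phi>\<in>two_valued \<rho>. \<exists>u\<in>gen (G \<union> {t}). \<forall>n. u (\<alpha> n) = \<alpha> (\<phi> n))"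
proof -
  obtain \<Gamma> where \<Gamma>: "finite \<Gamma>" "\<And>a. finite (orb G \<Gamma> a)"
    "\<And>F. finite F \<Longrightarrow> \<exists>a. orb (stab G \<Gamma>) F a = orb (stab G \<Gamma>) {} a \<and> card (orb (stab G \<Gamma>) {} a) > 1"
    using uniform_orbits[OF nt bdd] by metis
  have fin: "finite (orb (stab G \<Gamma>) {} a)" for a using \<Gamma>(2) by (simp add: orb_orb)
  obtain b :: "nat \<Rightarrow> bool \<Rightarrow> 'a" where b: "\<And>n m x y. b n x = b m y \<longleftrightarrow> n = m \<and> x = y"
    "\<And>c. \<exists>g\<in>stab G \<Gamma>. \<forall>n. g (b n False) = b n (c n)"
    using bit_choices[OF pgroup_stab[OF G(1)] fclosed_stab[OF G(2)] fin \<Gamma>(3)] by metis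
  let ?p = "\<lambda>i. b (fst i) (snd i)" and ?q = "\<lambda>i. b (if snd i then \<rho> (fst i) else fst i) (snd i)"
  have "\<exists>t. bij t \<and> (\<forall>i\<in>UNIV. t (?p i) = ?q i) \<and> (\<forall>y. y \<notin> ?p ` UNIV \<longrightarrow> t y = y)"
  proof (rule ex_bij_transport)
    show "?p i = ?p j \<longleftrightarrow> ?q i = ?q j" for i j
      using bij_is_inj[OF \<rho>] by (auto simp: b inj_eq)
    show "range ?p = range ?q"
    proof
      have "?q i = ?p (if snd i then \<rho> (fst i) else fst i, snd i)" for i by simp
      then show "range ?q \<subseteq> range ?p" by blast
      have "b n x = ?q (if x then inv \<rho> n else n, x)" for n x using \<rho> by simp
      then show "range ?p \<subseteq> range ?q" by blast
    qed
  qed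
  then obtain t where t: "bij t" "\<And>n x. t (b n x) = b (if x then \<rho> n else n) x" by auto
  have "\<exists>u\<in>gen (G \<union> {t}). \<forall>n. u (b n False) = b (\<phi> n) False" if "\<phi> \<in> two_valued \<rho>" for \<phi>
  proof -
    obtain c where c: "\<And>i. c (\<rho> i) = c i" "\<And>i. \<phi> i = (if c i then \<rho> i else i)"
      using \<open>\<phi> \<in> two_valued \<rho>\<close> by (auto simp: two_valued_def)
    obtain g where g: "g \<in> G" "\<And>n. g (b n False) = b n (c n)" using b(2)[of c] stab_in by metis
    have "inv g (t (g (b n False))) = b (\<phi> n) False" for n
    proof -
      have "t (g (b n False)) = b (\<phi> n) (c (\<phi> n))" using c by (simp add: g(2) t(2))
      then show ?thesis using g G(1) by (metis pgroup_inv_left)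
    qed
    moreover have "inv g \<circ> t \<circ> g \<in> gen (G \<union> {t})"
      by (rule conj_in_gen) (use G g t in \<open>auto simp: pgroup_def\<close>)
    ultimately show ?thesis by (intro bexI[of _ "inv g \<circ> t \<circ> g"]) simp_all
  qed
  moreover have "inj (\<lambda>n. b n False)" by (rule injI) (simp add: b)
  ultimately show ?thesis using t(1) by blast
qed

lemma two_valued_below:
  fixes G :: "('a \<Rightarrow> 'a) set"
  assumes G: "pgroup G" "fclosed G" and nt: "big_orbs G 1" and bdd: "\<not> big_orbs G K"
    and R: "blocks R" and \<rho>: "\<rho> \<in> block_perms R"
  shows "{f \<in> block_perms R. \<forall>x. (\<forall>y\<in>R x. f y = y) \<or> (\<forall>y\<in>R x. f y = \<rho> y)} \<preceq> G" (is "?H \<preceq> _")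
proof -
  have Gb: "G \<subseteq> Collect bij" using G by (simp add: pgroup_def)
  have b\<rho>: "bij \<rho>" "\<And>x. \<rho> x \<in> R x" using \<rho> by (auto simp: block_perms_def)
  let ?\<rho> = "push level_code (half_copy \<rho>)"
  obtain \<alpha> :: "nat \<Rightarrow> 'a" and t where \<alpha>: "inj \<alpha>" "bij t"
    and u: "\<And>\<phi>. \<phi> \<in> two_valued ?\<rho> \<Longrightarrow> \<exists>u\<in>gen (G \<union> {t}). \<forall>n. u (\<alpha> n) = \<alpha> (\<phi> n)"
    using two_valued_transport[OF G nt bdd push_bij[OF inj_level_code bij_half_copy[OF b\<rho>(1)]]] by blast
  have "\<exists>\<iota>::'a \<Rightarrow> 'a. inj \<iota> \<and> push \<iota> ` ?H \<preceq> G"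
  proof (rule push_half_copy_below[OF Gb \<alpha> inj_level_code u])
    show "?H \<subseteq> Collect bij" by (auto simp: block_perms_def)
    show "push level_code (half_copy f) \<in> two_valued ?\<rho>" if f: "f \<in> ?H" for f
    proof -
      have bf: "bij f" using f by (simp add: block_perms_def)
      \<comment> \<open>Constant on blocks, hence along the cycles of \<rho>, which stay inside
        blocks.\<close>
      define c where "c x \<longleftrightarrow> \<not> (\<forall>y\<in>R x. f y = y)" for x
      have Rx: "x \<in> R x" for x using R by (simp add: blocks_def)
      have fc: "f x = (if c x then \<rho> x else x)" for x
      proof (cases "c x")
        case True
        then have "\<forall>y\<in>R x. f y = \<rho> y" using f unfolding c_def by blast
        then show ?thesis using True Rx by simp
      next
        case False then show ?thesis using Rx by (simp add: c_def)
      qed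
      have c\<rho>: "c (\<rho> x) = c x" for x
      proof -
        have "R (\<rho> x) = R x" using R b\<rho>(2)[of x] by (auto simp: blocks_def)
        then show ?thesis by (simp add: c_def)
      qed
      define C where "C m \<longleftrightarrow> (\<exists>x s. m = level_code (x, s) \<and> s \<ge> 0 \<and> c x)" for m
      have C_cd: "C (level_code (x, s)) \<longleftrightarrow> s \<ge> 0 \<and> c x" for x s
        unfolding C_def using inj_level_code by (auto simp: inj_eq)
      have C_out: "\<not> C m" if "m \<notin> range level_code" for m using that by (auto simp: C_def)
      have "C (?\<rho> m) = C m" for m
      proof (cases "m \<in> range level_code")
        case True
        then obtain x s where m: "m = level_code (x, s)" by auto
        show ?thesis by (simp add: m inj_level_code half_copy_def C_cd c\<rho>)
      qed (simp add: push_outside)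
      moreover have "push level_code (half_copy f) m = (if C m then ?\<rho> m else m)" for m
      proof (cases "m \<in> range level_code")
        case True
        then obtain x s where m: "m = level_code (x, s)" by auto
        show ?thesis using fc[of x] by (simp add: m inj_level_code half_copy_def C_cd)
      qed (simp add: push_outside)
      ultimately show ?thesis using push_bij[OF inj_level_code bij_half_copy[OF bf]] unfolding two_valued_def by blast
    qed
  qed
  then obtain \<iota> :: "'a \<Rightarrow> 'a" where \<iota>: "inj \<iota>" "push \<iota> ` ?H \<preceq> G" by blast
  show ?thesis
  proof (rule block_perms_below_of_push[OF countable_Omega infinite_Omega R _ _ \<iota> Gb])
    show "?H \<subseteq> block_perms R" by blast
    fix f M assume f: "f \<in> ?H" and M: "saturated R M"
    have "(\<forall>y\<in>R x. restr M f y = y) \<or> (\<forall>y\<in>R x. restr M f y = \<rho> y)" for x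
    proof (cases "x \<in> M")
      case True
      then have "\<forall>y\<in>R x. restr M f y = f y" using M by (auto simp: saturated_def restr_def)
      then show ?thesis using f by auto
    next
      case False
      then have "\<forall>y\<in>R x. restr M f y = y" using saturated_iff[OF R M] by (auto simp: restr_def)
      then show ?thesis by blast
    qed
    then show "restr M f \<in> ?H" using restr_block_perms(1)[OF R M] f by blast
  qed
qed

end

text \<open>A block with at most N points has at most \<open>fact N\<close> permutations. One range
  of indices thus lists the permutations of every block, with repetitions, and \<rho> i acts on all
  blocks by their i-th permutations simultaneously.\<close>

lemma finitely_many_patterns:
  fixes R :: "'a \<Rightarrow> 'a set"
  assumes R: "blocks R" and bd: "\<And>x. card (R x) \<le> N"
  obtains \<rho> :: "nat \<Rightarrow> 'a \<Rightarrow> 'a" and K where "\<And>i. i < K \<Longrightarrow> \<rho> i \<in> block_perms R"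
    "\<And>f x. f \<in> block_perms R \<Longrightarrow> \<exists>i<K. \<forall>y\<in>R x. f y = \<rho> i y"
proof -
  define K where "K = (fact N :: nat)"
  let ?P = "\<lambda>X. {p. p permutes X}"
  have ex: "\<exists>\<sigma>. \<sigma> ` {..<K} = ?P X" if X: "X \<in> range R" for X
  proof -
    have fX: "finite X" "card X \<le> N" using X R bd by (auto simp: blocks_def)
    have "card (?P X) = fact (card X)" by (rule card_permutations[OF refl fX(1)])
    also have "\<dots> \<le> fact N" by (rule fact_mono_nat[OF fX(2)])
    finally have c: "card (?P X) \<le> card {..<K}" by (simp add: K_def)
    have fP: "finite (?P X)" using fX(1) by (rule finite_permutations)
    have ne: "id \<in> ?P X" by (simp add: permutes_id)
    obtain j where j: "j ` ?P X \<subseteq> {..<K}" "inj_on j (?P X)"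
      using card_le_inj[OF fP finite_lessThan c] by blast
    \<comment> \<open>Spare indices repeat the identity, so that every block uses the same
      K.\<close>
    define \<sigma> where "\<sigma> i = (if i \<in> j ` ?P X then inv_into (?P X) j i else id)" for i
    have "\<sigma> i \<in> ?P X" for i
    proof (cases "i \<in> j ` ?P X")
      case True then show ?thesis using inv_into_into[OF True] by (simp add: \<sigma>_def)
    next
      case False then show ?thesis using ne by (simp add: \<sigma>_def)
    qed
    moreover have "p \<in> \<sigma> ` {..<K}" if "p \<in> ?P X" for p
    proof -
      have "p = \<sigma> (j p)" using inv_into_f_f[OF j(2) that] that by (simp add: \<sigma>_def)
      moreover have "j p \<in> {..<K}" using j(1) that by blast
      ultimately show ?thesis by blast
    qed
    ultimately show ?thesis by (intro exI[of _ \<sigma>]) blast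
  qed
  then have "\<exists>\<sigma>. \<forall>X\<in>range R. \<sigma> X ` {..<K} = ?P X" by (intro bchoice) blast
  then obtain \<sigma> where \<sigma>: "\<And>x. \<sigma> (R x) ` {..<K} = ?P (R x)" by blast
  have \<sigma>p: "\<sigma> (R x) i permutes R x" if "i < K" for x i using \<sigma>[of x] that by blast
  define \<rho> where "\<rho> i x = \<sigma> (R x) i x" for i x
  have Req: "R y = R x" if "y \<in> R x" for x y using R that by (auto simp: blocks_def)
  have Rx: "x \<in> R x" for x using R by (simp add: blocks_def)
  have \<rho>R: "\<rho> i x \<in> R x" if "i < K" for i x
    unfolding \<rho>_def using permutes_in_image[OF \<sigma>p[OF that]] Rx by blast
  have "\<rho> i \<in> block_perms R" if i: "i < K" for i
  proof -
    have "bij (\<rho> i)"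
    proof (rule o_bij[of "\<lambda>x. inv (\<sigma> (R x) i) x"])
      have "inv (\<sigma> (R (\<rho> i x)) i) (\<rho> i x) = x" for x
        using Req[OF \<rho>R[OF i, of x]] permutes_inverses(2)[OF \<sigma>p[OF i, of x]] by (simp add: \<rho>_def)
      then show "(\<lambda>x. inv (\<sigma> (R x) i) x) \<circ> \<rho> i = id" by (auto simp: fun_eq_iff)
      have "\<rho> i (inv (\<sigma> (R x) i) x) = x" for x
      proof -
        have "inv (\<sigma> (R x) i) x \<in> R x" using permutes_in_image[OF permutes_inv[OF \<sigma>p[OF i]]] Rx by blast
        then show ?thesis using Req permutes_inverses(1)[OF \<sigma>p[OF i, of x]] by (simp add: \<rho>_def)
      qed
      then show "\<rho> i \<circ> (\<lambda>x. inv (\<sigma> (R x) i) x) = id" by (auto simp: fun_eq_iff)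
    qed
    then show ?thesis using \<rho>R[OF i] by (simp add: block_perms_def)
  qed
  moreover have "\<exists>i<K. \<forall>y\<in>R x. f y = \<rho> i y" if f: "f \<in> block_perms R" for f x
  proof -
    have sat: "saturated R (R x)" using Req by (auto simp: saturated_def)
    have "restr (R x) f \<in> ?P (R x)"
      using restr_block_perms(2)[OF R sat f] unfolding symm_def
      by (auto simp: permutes_def bij_iff)
    then obtain i where i: "i < K" "restr (R x) f = \<sigma> (R x) i" using \<sigma>[of x] by (metis imageE lessThan_iff)
    have "f y = \<rho> i y" if "y \<in> R x" for y
      using fun_cong[OF i(2), of y] that Req[OF that] by (simp add: restr_def \<rho>_def)
    then show ?thesis using i(1) by blast
  qed
  ultimately show thesis using that by blast
qed

text \<open>By induction on k, the restriction of f to the blocks where it agrees with \<rho> k is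
  split off; on the others f follows smaller indices or is the identity.\<close>

lemma block_perms_generated:
  fixes R :: "'a \<Rightarrow> 'a set" and \<rho> :: "nat \<Rightarrow> 'a \<Rightarrow> 'a"
  assumes R: "blocks R"
  shows "{f \<in> block_perms R. \<forall>x. (\<forall>y\<in>R x. f y = y) \<or> (\<exists>i<k. \<forall>y\<in>R x. f y = \<rho> i y)}
    \<subseteq> gen (\<Union>i<k. {f \<in> block_perms R. \<forall>x. (\<forall>y\<in>R x. f y = y) \<or> (\<forall>y\<in>R x. f y = \<rho> i y)})"
proof (induction k)
  case 0
  have "f = id" if "f \<in> block_perms R" "\<forall>x. \<forall>y\<in>R x. f y = y" for f
    using that R by (auto simp: blocks_def fun_eq_iff)
  moreover have "id \<in> gen {}" using pgroup_id[OF pgroup_gen[of "{}"]] by simp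
  ultimately show ?case by auto
next
  case (Suc k)
  let ?T = "\<lambda>i. {f \<in> block_perms R. \<forall>x. (\<forall>y\<in>R x. f y = y) \<or> (\<forall>y\<in>R x. f y = \<rho> i y)}"
  have pg: "pgroup (gen (\<Union>i<Suc k. ?T i))" by (rule pgroup_gen) (auto simp: block_perms_def)
  have Req: "R y = R x" if "y \<in> R x" for x y using R that by (auto simp: blocks_def)
  show ?case
  proof
    fix f assume "f \<in> {f \<in> block_perms R. \<forall>x. (\<forall>y\<in>R x. f y = y) \<or> (\<exists>i<Suc k. \<forall>y\<in>R x. f y = \<rho> i y)}"
    then have f: "f \<in> block_perms R" "\<And>x. (\<forall>y\<in>R x. f y = y) \<or> (\<exists>i<Suc k. \<forall>y\<in>R x. f y = \<rho> i y)" by auto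
    define M where "M = {x. \<forall>y\<in>R x. f y = \<rho> k y}"
    have M: "saturated R M" using Req by (auto simp: saturated_def M_def)
    note MC = saturated_Compl[OF R M]
    have in_M: "y \<in> M \<longleftrightarrow> x \<in> M" if "y \<in> R x" for x y by (rule saturated_iff[OF R M that])
    have "restr M f \<in> ?T k"
    proof -
      have "(\<forall>y\<in>R x. restr M f y = y) \<or> (\<forall>y\<in>R x. restr M f y = \<rho> k y)" for x
        using in_M[of _ x] by (cases "x \<in> M") (auto simp: restr_def M_def)
      then show ?thesis using restr_block_perms(1)[OF R M f(1)] by blast
    qed
    then have 1: "restr M f \<in> gen (\<Union>i<Suc k. ?T i)" by (intro gen_incl) blast
    have "(\<forall>y\<in>R x. restr (- M) f y = y) \<or> (\<exists>i<k. \<forall>y\<in>R x. restr (- M) f y = \<rho> i y)" for x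
    proof (cases "x \<in> M")
      case True
      then show ?thesis using in_M[of _ x] by (auto simp: restr_def)
    next
      case False
      then have eq: "restr (- M) f y = f y" if "y \<in> R x" for y using in_M[OF that] by (simp add: restr_def)
      have "\<not> (\<forall>y\<in>R x. f y = \<rho> k y)" using False by (simp add: M_def)
      then have "(\<forall>y\<in>R x. f y = y) \<or> (\<exists>i<k. \<forall>y\<in>R x. f y = \<rho> i y)"
        using f(2)[of x] by (metis less_SucE)
      then show ?thesis using eq by metis
    qed
    then have "restr (- M) f \<in> gen (\<Union>i<k. ?T i)"
      using Suc.IH restr_block_perms(1)[OF R MC f(1)] by blast
    moreover have "gen (\<Union>i<k. ?T i) \<subseteq> gen (\<Union>i<Suc k. ?T i)"
      by (intro gen_mono UN_mono) auto
    ultimately have 2: "restr (- M) f \<in> gen (\<Union>i<Suc k. ?T i)" by blast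
    show "f \<in> gen (\<Union>i<Suc k. ?T i)"
      using pgroup_comp[OF pg 1 2] restr_comp_Compl[OF R M f(1)] by simp
  qed
qed

section \<open>Comparison of closed groups by orbit type\<close>

context enumeration begin

lemma blocks_orb:
  assumes G: "pgroup G" and fin: "\<And>a. finite (orb G {} a)"
  shows "blocks (orb G {})"
  unfolding blocks_def
proof (intro conjI allI impI)
  show "x \<in> orb G {} x" for x by (rule orb_self[OF G])
  show "finite (orb G {} x)" for x by (rule fin)
  show "orb G {} y = orb G {} x" if y: "y \<in> orb G {} x" for x y
  proof -
    obtain g where g: "g \<in> G" "y = g x" using y by (auto simp: orb_def)
    have "g ` orb G {} x = orb G {} x"
    proof
      show "g ` orb G {} x \<subseteq> orb G {} x" using orb_image_eq[OF G g(1)] by blast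
      show "orb G {} x \<subseteq> g ` orb G {} x"
      proof
        fix z assume "z \<in> orb G {} x"
        then have "inv g z \<in> orb G {} x" using orb_image_eq[OF G pgroup_inv[OF G g(1)]] by blast
        moreover have "z = g (inv g z)" using G g(1) by simp
        ultimately show "z \<in> g ` orb G {} x" by (rule rev_image_eqI)
      qed
    qed
    then show ?thesis using orb_conj[OF G g(1), of "{}" x] g(2) by simp
  qed
qed

text \<open>Countably many coset representatives cost only finitely many generators, so passing to
  the stabilizer of a finite set loses nothing.\<close>

lemma below_of_stab:
  fixes G K :: "('a \<Rightarrow> 'a) set"
  assumes G: "pgroup G" and F: "finite F" and below: "stab G F \<preceq> K" and K: "K \<subseteq> Collect bij"
  shows "G \<preceq> K"
proof -
  obtain D where D: "countable D" "D \<subseteq> G" "\<And>g. g \<in> G \<Longrightarrow> \<exists>d\<in>D. \<exists>h\<in>stab G F. g = d \<circ> h"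
    using countable_cosets[OF G F] by metis
  have Db: "D \<subseteq> Collect bij" "stab G F \<subseteq> Collect bij"
    using D(2) G stab_subset[of G F] by (auto simp: pgroup_def)
  have b: "D \<union> stab G F \<preceq> K" by (rule below_Un[OF countable_below[OF D(1) Db(1) K] below])
  have pg: "pgroup (gen ((D \<union> stab G F) \<union> {}))" by (rule pgroup_gen) (use Db in auto)
  have "G \<subseteq> gen ((D \<union> stab G F) \<union> {})"
  proof
    fix g assume "g \<in> G"
    then obtain d h where "d \<in> D" "h \<in> stab G F" "g = d \<circ> h" using D(3) by blast
    then show "g \<in> gen ((D \<union> stab G F) \<union> {})"
      using pgroup_comp[OF pg gen_incl gen_incl, of d h] by simp
  qed
  from below_gen_trans[OF this _ _ b K] show ?thesis by simp
qed

lemma bounded_block_perms_below: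
  fixes G :: "('a \<Rightarrow> 'a) set"
  assumes G: "pgroup G" "fclosed G" and nt: "big_orbs G 1" and bdd: "\<not> big_orbs G K"
    and R: "blocks R" and bd: "\<And>x. card (R x) \<le> N"
  shows "block_perms R \<preceq> G"
proof -
  have Gb: "G \<subseteq> Collect bij" using G by (simp add: pgroup_def)
  obtain \<rho> :: "nat \<Rightarrow> 'a \<Rightarrow> 'a" and k where \<rho>: "\<And>i. i < k \<Longrightarrow> \<rho> i \<in> block_perms R"
    "\<And>f x. f \<in> block_perms R \<Longrightarrow> \<exists>i<k. \<forall>y\<in>R x. f y = \<rho> i y"
    using finitely_many_patterns[OF R bd] by metis
  let ?T = "\<lambda>i. {f \<in> block_perms R. \<forall>x. (\<forall>y\<in>R x. f y = y) \<or> (\<forall>y\<in>R x. f y = \<rho> i y)}"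
  have b: "(\<Union>i<k. ?T i) \<preceq> G"
    by (rule below_UN) (use two_valued_below[OF G nt bdd R \<rho>(1)] in simp_all)
  have "block_perms R \<subseteq> {f \<in> block_perms R. \<forall>x. (\<forall>y\<in>R x. f y = y) \<or> (\<exists>i<k. \<forall>y\<in>R x. f y = \<rho> i y)}"
    using \<rho>(2) by blast
  also have "\<dots> \<subseteq> gen (\<Union>i<k. ?T i)" by (rule block_perms_generated[OF R])
  finally have "block_perms R \<subseteq> gen ((\<Union>i<k. ?T i) \<union> {})" by simp
  from below_gen_trans[OF this _ _ b Gb] show ?thesis by simp
qed

text \<open>The kind of G2 tells which model it generates with finitely many permutations; the
  implications from G1 to G2 ensure that some stabilizer in G1 fits into that model.\<close>

lemma below_of_orbit_types:
  fixes G1 G2 :: "('a \<Rightarrow> 'a) set"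
  assumes G1: "pgroup G1" and G2: "pgroup G2" "fclosed G2"
    and inf: "inf_orbs G1 \<Longrightarrow> inf_orbs G2"
    and big: "(\<And>n. big_orbs G1 n) \<Longrightarrow> (\<And>n. big_orbs G2 n)"
    and nt: "big_orbs G1 1 \<Longrightarrow> big_orbs G2 1"
  shows "G1 \<preceq> G2"
proof -
  have b1: "G1 \<subseteq> Collect bij" and b2: "G2 \<subseteq> Collect bij" using G1 G2 by (auto simp: pgroup_def)
  have orb_sub: "stab G F \<subseteq> block_perms (orb (stab G F) {})" if "pgroup G" for G :: "('a \<Rightarrow> 'a) set" and F
  proof
    fix g assume g: "g \<in> stab G F"
    have "g x \<in> orb (stab G F) {} x" for x by (rule orbI) (use g in simp)
    then show "g \<in> block_perms (orb (stab G F) {})"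
      using pgroup_bij[OF pgroup_stab[OF that] g] by (simp add: block_perms_def)
  qed
  show ?thesis
  proof (cases "inf_orbs G2")
    case True
    show ?thesis by (rule below_trans[OF below_subset[OF b1] Collect_bij_below[OF G2 True] b2])
  next
    case not_inf: False
    then obtain F1 where F1: "finite F1" "\<And>a. finite (orb G1 F1 a)" using inf by (auto simp: inf_orbs_def)
    show ?thesis
    proof (cases "\<forall>n. big_orbs G2 n")
      case True
      obtain F2 where F2: "finite F2" "\<And>a. finite (orb G2 F2 a)" using not_inf by (auto simp: inf_orbs_def)
      let ?H = "stab G2 F2"
      have fin1: "finite (orb (stab G1 F1) {} a)" and fin2: "finite (orb ?H {} a)" for a
        using F1(2) F2(2) by (simp_all add: orb_orb)
      have big2: "big_orbs ?H n" for n
        unfolding big_orbs_def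
      proof (intro allI impI)
        fix F :: "'a set" assume "finite F"
        then have "finite (F2 \<union> F)" using F2(1) by simp
        then show "\<exists>a. \<not> (finite (orb ?H F a) \<and> card (orb ?H F a) \<le> n)"
          using True unfolding big_orbs_def orb_orb by blast
      qed
      have "block_perms (orb (stab G1 F1) {}) \<preceq> ?H"
        by (rule block_perms_below[OF pgroup_stab[OF G2(1)] fclosed_stab[OF G2(2)] fin2 big2
              blocks_orb[OF pgroup_stab[OF G1] fin1]])
      then have "block_perms (orb (stab G1 F1) {}) \<preceq> G2"
        by (rule below_trans[OF _ below_subset[OF stab_subset] b2])
      then have "stab G1 F1 \<preceq> G2"
        by (rule below_trans[OF below_subset[OF orb_sub[OF G1]] _ b2])
      then show ?thesis by (rule below_of_stab[OF G1 F1(1) _ b2])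
    next
      case False
      then obtain K where K: "\<not> big_orbs G2 K" by blast
      have "\<exists>n. \<not> big_orbs G1 n" using big K by blast
      show ?thesis
      proof (cases "big_orbs G2 1")
        case True
        obtain N F where F: "finite F" "\<And>a. finite (orb G1 F a)" "\<And>a. card (orb G1 F a) \<le> N"
          using \<open>\<exists>n. \<not> big_orbs G1 n\<close> by (auto simp: big_orbs_def)
        have fin1: "finite (orb (stab G1 F) {} a)" and bd1: "card (orb (stab G1 F) {} a) \<le> N" for a
          using F(2,3) by (simp_all add: orb_orb)
        have "block_perms (orb (stab G1 F) {}) \<preceq> G2"
          by (rule bounded_block_perms_below[OF G2 True K blocks_orb[OF pgroup_stab[OF G1] fin1] bd1])
        then have "stab G1 F \<preceq> G2"
          by (rule below_trans[OF below_subset[OF orb_sub[OF G1]] _ b2])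
        then show ?thesis by (rule below_of_stab[OF G1 F(1) _ b2])
      next
        case False
        then obtain F where F: "finite F" "\<And>a. finite (orb G1 F a)" "\<And>a. card (orb G1 F a) \<le> 1"
          using nt by (auto simp: big_orbs_def)
        have "g = id" if g: "g \<in> stab G1 F" for g
        proof (rule ext)
          fix x
          have "g x \<in> orb G1 F x" "x \<in> orb G1 F x" using orbI[OF g] orb_self[OF G1] by auto
          then show "g x = id x" using F(2,3)[of x] card_le_Suc0_iff_eq[of "orb G1 F x"] by simp
        qed
        then have "stab G1 F \<subseteq> G2" using pgroup_id[OF G2(1)] by blast
        then show ?thesis by (rule below_of_stab[OF G1 F(1) below_subset b2])
      qed
    qed
  qed
qed

lemma below_of_submonoid:
  fixes G1 G2 :: "('a \<Rightarrow> 'a) set"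
  assumes G1: "pgroup G1" "fclosed G1" and G2: "pgroup G2" "fclosed G2" and U: "finite U"
    and sub: "G1 \<subseteq> generate_submonoid Self (G2 \<union> U)"
  shows "G1 \<preceq> G2"
proof (rule below_of_orbit_types[OF G1(1) G2])
  show "inf_orbs G1 \<Longrightarrow> inf_orbs G2" by (rule inf_orbs_mono[OF G1 G2(1) U sub])
  show "big_orbs G2 n" if "\<And>n. big_orbs G1 n" for n by (rule big_orbs_mono[OF G1 G2(1) U sub that])
  \<comment> \<open>All powers of 1 equal 1, so words of every length are covered.\<close>
  show "big_orbs G2 1" if "big_orbs G1 1" by (rule big_orbs_mono[OF G1 G2(1) U sub]) (use that in simp)
qed

end

section \<open>Passage between generated groups and generated submonoids\<close>

lemma gen_subset_submonoid:
  assumes "X \<subseteq> Collect bij" and "\<And>x. x \<in> X \<Longrightarrow> inv x \<in> X"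
  shows "gen X \<subseteq> generate_submonoid Self X"
proof
  fix f assume "f \<in> gen X"
  then have "f \<in> N" if "submonoid N Self" "X \<subseteq> N" for N
  proof (induction rule: generate.induct)
    case one
    then show ?case using submonoid.one_closed[OF that(1)] by (simp add: Sym_def Self_def id_def)
  next
    case (incl h) then show ?case using that(2) by blast
  next
    case (inv h)
    then have "inv h \<in> X" "bij h" using assms by auto
    then show ?case using that(2) by (auto simp: inv_Sym)
  next
    case (eng h1 h2)
    then show ?case using submonoid.m_closed[OF that(1), of h1 h2] by (simp add: Sym_def Self_def comp_def)
  qed
  then show "f \<in> generate_submonoid Self X" by (auto simp: generate_submonoid_def)
qed

text \<open>Submonoids need not contain inverses, but U together with its inverses is still
  finite.\<close>

lemma gen_eq_imp_submonoid:
  assumes G1: "pgroup G1" and G2: "pgroup G2" and U: "finite U" "U \<subseteq> Collect bij"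
    and eq: "gen (G1 \<union> U) = gen (G2 \<union> U)"
  shows "\<exists>V. finite V \<and> V \<subseteq> carrier Self \<and> G1 \<subseteq> generate_submonoid Self (G2 \<union> V)"
proof -
  let ?V = "U \<union> inv ` U"
  have b: "G2 \<union> ?V \<subseteq> Collect bij" using G2 U(2) by (auto simp: pgroup_def intro: bij_imp_bij_inv)
  have "G1 \<subseteq> gen (G1 \<union> U)" by (auto intro: gen_incl)
  also have "\<dots> \<subseteq> gen (G2 \<union> ?V)" unfolding eq by (rule gen_mono) auto
  also have "\<dots> \<subseteq> generate_submonoid Self (G2 \<union> ?V)"
  proof (rule gen_subset_submonoid[OF b])
    show "inv x \<in> G2 \<union> ?V" if "x \<in> G2 \<union> ?V" for x
      using that U(2) pgroup_inv[OF G2] by (auto simp: inv_inv_eq)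
  qed
  finally show ?thesis using U(1) by (intro exI[of _ ?V]) (simp add: Self_def)
qed

lemma approx_Sym_of_below:
  assumes G1: "pgroup G1" and G2: "pgroup G2" and le: "G1 \<preceq> G2" "G2 \<preceq> G1"
  shows "G1 \<approx>\<^sub>S G2"
proof -
  obtain U V where U: "finite U" "U \<subseteq> Collect bij" "G1 \<subseteq> gen (G2 \<union> U)"
    and V: "finite V" "V \<subseteq> Collect bij" "G2 \<subseteq> gen (G1 \<union> V)"
    using le by (auto simp: below_def)
  let ?W = "U \<union> V"
  have half: "gen (H \<union> ?W) \<subseteq> gen (H' \<union> ?W)"
    if "H \<subseteq> gen (H' \<union> W)" "W \<subseteq> ?W" "pgroup H'" for H H' W
  proof (rule gen_least[OF pgroup_gen])
    show "H' \<union> ?W \<subseteq> Collect bij" using that(3) U(2) V(2) by (auto simp: pgroup_def)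
    have "gen (H' \<union> W) \<subseteq> gen (H' \<union> ?W)" by (rule gen_mono) (use that(2) in auto)
    then show "H \<union> ?W \<subseteq> gen (H' \<union> ?W)" using that(1) by (auto intro: gen_incl)
  qed
  have "gen (G1 \<union> ?W) = gen (G2 \<union> ?W)"
    using half[OF U(3) _ G2] half[OF V(3) _ G1] by auto
  moreover have "?W \<subseteq> carrier Sym" using U(2) V(2) by (auto simp: Sym_def)
  ultimately show ?thesis unfolding approx_Sym_def using U(1) V(1) by blast
qed

theorem theorem15:
  fixes G1 G2 :: "('a \<Rightarrow> 'a) set"
  assumes "countable (UNIV :: 'a set)" and "infinite (UNIV :: 'a set)"
    and "subgroup G1 Sym" and "closedin (subtopology function_topology (carrier Sym)) G1"
    and "subgroup G2 Sym" and "closedin (subtopology function_topology (carrier Sym)) G2"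
  shows "G1 \<approx>\<^sub>S G2 \<longleftrightarrow> G1 \<approx>\<^sub>E G2"
proof -
  have G1: "pgroup G1" "fclosed G1" and G2: "pgroup G2" "fclosed G2"
    using assms(3-6) by (simp_all add: subgroup_Sym_iff closedin_imp_fclosed)
  have "bij (from_nat_into (UNIV :: 'a set))"
    by (rule bij_betw_from_nat_into[OF assms(1,2)])
  then interpret enumeration "from_nat_into (UNIV :: 'a set)" by unfold_locales
  show ?thesis
  proof
    assume "G1 \<approx>\<^sub>S G2"
    then obtain U where U: "finite U" "U \<subseteq> Collect bij" "gen (G1 \<union> U) = gen (G2 \<union> U)"
      by (auto simp: approx_Sym_def Sym_def)
    then show "G1 \<approx>\<^sub>E G2"
      unfolding approx_Self_def
      using gen_eq_imp_submonoid[OF G1(1) G2(1) U] gen_eq_imp_submonoid[OF G2(1) G1(1) U(1,2) U(3)[symmetric]]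
      by blast
  next
    assume "G1 \<approx>\<^sub>E G2"
    then obtain U V where UV: "finite U" "finite V" "G1 \<subseteq> generate_submonoid Self (G2 \<union> U)"
      "G2 \<subseteq> generate_submonoid Self (G1 \<union> V)" by (auto simp: approx_Self_def)
    show "G1 \<approx>\<^sub>S G2"
      by (rule approx_Sym_of_below[OF G1(1) G2(1) below_of_submonoid[OF G1 G2 UV(1,3)]
            below_of_submonoid[OF G2 G1 UV(2,4)]])
  qed
qed

end
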